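(* Let $\rho_{AB}$ be a density operator on $\mathcal{H}_A\otimes\mathcal{H}_B$ with operator Schmidt decomposition $\rho_{AB}=\sum_i r_i\,A_i\otimes B_i$, where $\{A_i\}_{i=1}^{d_A^2}$ and $\{B_i\}_{i=1}^{d_B^2}$ are orthonormal bases (with respect to the Hilbert–Schmidt inner product) of $\mathcal{L}(\mathcal{H}_A)$ and $\mathcal{L}(\mathcal{H}_B)$ respectively, consisting of Hermitian operators, and $r_1\ge r_2\ge\dots\ge 0$. Then $$\frac{r_{d_A^2}}{d_A^{5/2}}\;\le\;\mathrm{CDP}_A(\rho_{AB})\;\le\;\min_{1\le i\le d_A^2}\left\{r_i\,\frac{\|B_i\|_1}{\|A_i\|_\infty}\right\}\;\le\; r_{d_A^2}\sqrt{d_A d_B}.$$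
   Context: All Hilbert spaces are finite dimensional; $d_X=\dim\mathcal{H}_X$. $\|L\|_p=(\mathrm{Tr}((L^\dagger L)^{p/2}))^{1/p}$ denotes the Schatten $p$-norm ($\|\cdot\|_\infty$ is the operator norm); the Hilbert–Schmidt inner product is $\mathrm{Tr}(C^\dagger D)$. The numbers $r_i$ are the operator Schmidt coefficients of $\rho_{AB}$ in non-increasing order, i.e. the Schmidt coefficients of $\rho_{AB}$ regarded as a vector in $\mathcal{L}(\mathcal{H}_A)\otimes\mathcal{L}(\mathcal{H}_B)$; $r_i=0$ for $i$ larger than the operator Schmidt rank $\mathrm{OSR}(\rho_{AB})$ (the number of nonzero $r_i$). In the minimum, a term with $r_i=0$ is read as $0$ (including any $i>d_B^2$, for which no $B_i$ exists). A quantum channel is a completely positive trace-preserving linear map $\mathcal{L}(\mathcal{H}_X)\to\mathcal{L}(\mathcal{H}_Y)$. Let $D(\rho,\sigma)=\frac12\|\rho-\sigma\|_1$. For channels $\Lambda_0,\Lambda_1$ with the same input system $S$ and the same output system, $D_\diamond(\Lambda_0,\Lambda_1)=\max_{\rho}D\big((\Lambda_0\otimes\mathrm{id}_{S'})[\rho],(\Lambda_1\otimes\mathrm{id}_{S'})[\rho]\big)$, the maximum being over all density operators on $\mathcal{H}_S\otimes\mathcal{H}_{S'}$, with $S'$ a copy of $S$. The channel discrimination power on $A$ is $$\mathrm{CDP}_A(\rho_{AB})=\inf_{\Lambda_0\neq\Lambda_1}\frac{D\big((\Lambda_0\otimes\mathrm{id}_B)[\rho_{AB}],(\Lambda_1\otimes\mathrm{id}_B)[\rho_{AB}]\big)}{D_\diamond(\Lambda_0,\Lambda_1)},$$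 the infimum being over all pairs of distinct channels with input $\mathcal{L}(\mathcal{H}_A)$ and a common output space of arbitrary finite dimension. *)

theory Defs
  imports Complex_Main "Jordan_Normal_Form.Schur_Decomposition"
begin

(* A Hilbert space of dimension n is modelled as C^n, so operators on it are the elements of
   carrier_mat n n.  In a composite system of dimensions m and k (in this order), the product
   basis vector (a, p) with a < m and p < k has index a * k + p. *)

definition mat_trace :: "complex mat \<Rightarrow> complex" where
  "mat_trace M = (\<Sum>i<dim_row M. M $$ (i, i))"

definition hermitian :: "complex mat \<Rightarrow> bool" where
  "hermitian M \<longleftrightarrow> mat_adjoint M = M"

(* In the order on complex numbers, 0 \<le> z means that z is real and nonnegative. *)
definition psd :: "nat \<Rightarrow> complex mat \<Rightarrow> bool" where
  "psd n M \<longleftrightarrow> M \<in> carrier_mat n n \<and> (\<forall>v\<in>carrier_vec n. 0 \<le> (M *\<^sub>v v) \<bullet>c v)"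

definition density_operator :: "nat \<Rightarrow> complex mat \<Rightarrow> bool" where
  "density_operator n M \<longleftrightarrow> psd n M \<and> mat_trace M = 1"

(* Every positive semidefinite matrix has exactly one positive semidefinite square root;
   on other matrices the value is unspecified. *)
definition psd_sqrt :: "complex mat \<Rightarrow> complex mat" where
  "psd_sqrt M = (THE S. psd (dim_row M) S \<and> S * S = M)"

definition trace_norm :: "complex mat \<Rightarrow> real" where
  "trace_norm L = Re (mat_trace (psd_sqrt (mat_adjoint L * L)))"

definition operator_norm :: "complex mat \<Rightarrow> real" where
  "operator_norm L =
     (SUP v\<in>{v \<in> carrier_vec (dim_col L). v \<bullet>c v = 1}. sqrt (Re ((L *\<^sub>v v) \<bullet>c (L *\<^sub>v v))))"

definition trace_distance :: "complex mat \<Rightarrow> complex mat \<Rightarrow> real" where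
  "trace_distance \<rho> \<sigma> = trace_norm (\<rho> - \<sigma>) / 2"

definition tensor :: "complex mat \<Rightarrow> complex mat \<Rightarrow> complex mat" where
  "tensor X Y = mat (dim_row X * dim_row Y) (dim_col X * dim_col Y)
     (\<lambda>(i, j). X $$ (i div dim_row Y, j div dim_col Y) * Y $$ (i mod dim_row Y, j mod dim_col Y))"

(* The block of Z, an operator on C^m tensor C^k, that multiplies the matrix unit |p><q| of the
   second factor: Z is the sum over p, q < k of tensor (block m k Z p q) |p><q|. *)
definition block :: "nat \<Rightarrow> nat \<Rightarrow> complex mat \<Rightarrow> nat \<Rightarrow> nat \<Rightarrow> complex mat" where
  "block m k Z p q = mat m m (\<lambda>(a, b). Z $$ (a * k + p, b * k + q))"

(* The map \<Lambda> tensor id, for \<Lambda> from operators on C^m to operators on C^n and the identity on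
   operators on C^k; \<Lambda> acts on each block.  Lemma tensor_id_tensor is the defining property. *)
definition tensor_id ::
  "nat \<Rightarrow> nat \<Rightarrow> nat \<Rightarrow> (complex mat \<Rightarrow> complex mat) \<Rightarrow> complex mat \<Rightarrow> complex mat" where
  "tensor_id m n k \<Lambda> Z =
     mat (n * k) (n * k) (\<lambda>(i, j). \<Lambda> (block m k Z (i mod k) (j mod k)) $$ (i div k, j div k))"

definition linear_map :: "nat \<Rightarrow> nat \<Rightarrow> (complex mat \<Rightarrow> complex mat) \<Rightarrow> bool" where
  "linear_map m n \<Lambda> \<longleftrightarrow>
     (\<forall>X\<in>carrier_mat m m. \<Lambda> X \<in> carrier_mat n n) \<and>
     (\<forall>X\<in>carrier_mat m m. \<forall>Y\<in>carrier_mat m m. \<Lambda> (X + Y) = \<Lambda> X + \<Lambda> Y) \<and>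
     (\<forall>X\<in>carrier_mat m m. \<forall>c. \<Lambda> (c \<cdot>\<^sub>m X) = c \<cdot>\<^sub>m \<Lambda> X)"

definition completely_positive :: "nat \<Rightarrow> nat \<Rightarrow> (complex mat \<Rightarrow> complex mat) \<Rightarrow> bool" where
  "completely_positive m n \<Lambda> \<longleftrightarrow> (\<forall>k Z. psd (m * k) Z \<longrightarrow> psd (n * k) (tensor_id m n k \<Lambda> Z))"

definition trace_preserving :: "nat \<Rightarrow> (complex mat \<Rightarrow> complex mat) \<Rightarrow> bool" where
  "trace_preserving m \<Lambda> \<longleftrightarrow> (\<forall>X\<in>carrier_mat m m. mat_trace (\<Lambda> X) = mat_trace X)"

definition channel :: "nat \<Rightarrow> nat \<Rightarrow> (complex mat \<Rightarrow> complex mat) \<Rightarrow> bool" where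
  "channel m n \<Lambda> \<longleftrightarrow> linear_map m n \<Lambda> \<and> completely_positive m n \<Lambda> \<and> trace_preserving m \<Lambda>"

(* Channels are equal when they agree on carrier_mat m m; their values elsewhere are junk. *)
definition distinct_maps ::
  "nat \<Rightarrow> (complex mat \<Rightarrow> complex mat) \<Rightarrow> (complex mat \<Rightarrow> complex mat) \<Rightarrow> bool" where
  "distinct_maps m \<Lambda>0 \<Lambda>1 \<longleftrightarrow> (\<exists>X\<in>carrier_mat m m. \<Lambda>0 X \<noteq> \<Lambda>1 X)"

(* The supremum is a maximum, by compactness of the set of density operators. *)
definition diamond_distance ::
  "nat \<Rightarrow> nat \<Rightarrow> (complex mat \<Rightarrow> complex mat) \<Rightarrow> (complex mat \<Rightarrow> complex mat) \<Rightarrow> real" where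
  "diamond_distance m n \<Lambda>0 \<Lambda>1 =
     (SUP \<rho>\<in>{\<rho>. density_operator (m * m) \<rho>}.
        trace_distance (tensor_id m n m \<Lambda>0 \<rho>) (tensor_id m n m \<Lambda>1 \<rho>))"

definition CDP :: "nat \<Rightarrow> nat \<Rightarrow> complex mat \<Rightarrow> real" where
  "CDP dA dB \<rho> = Inf {trace_distance (tensor_id dA n dB \<Lambda>0 \<rho>) (tensor_id dA n dB \<Lambda>1 \<rho>)
                      / diamond_distance dA n \<Lambda>0 \<Lambda>1 | n \<Lambda>0 \<Lambda>1.
     channel dA n \<Lambda>0 \<and> channel dA n \<Lambda>1 \<and> distinct_maps dA \<Lambda>0 \<Lambda>1}"

definition hs_inner :: "complex mat \<Rightarrow> complex mat \<Rightarrow> complex" where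
  "hs_inner C D = mat_trace (mat_adjoint C * D)"

definition mat_lincomb ::
  "nat \<Rightarrow> 'i set \<Rightarrow> ('i \<Rightarrow> complex) \<Rightarrow> ('i \<Rightarrow> complex mat) \<Rightarrow> complex mat" where
  "mat_lincomb n I c M = mat n n (\<lambda>(a, b). \<Sum>i\<in>I. c i * M i $$ (a, b))"

definition orthonormal_basis :: "nat \<Rightarrow> 'i set \<Rightarrow> ('i \<Rightarrow> complex mat) \<Rightarrow> bool" where
  "orthonormal_basis d I M \<longleftrightarrow>
     (\<forall>i\<in>I. M i \<in> carrier_mat d d) \<and>
     (\<forall>i\<in>I. \<forall>j\<in>I. hs_inner (M i) (M j) = (if i = j then 1 else 0)) \<and>
     (\<forall>X\<in>carrier_mat d d. \<exists>c. X = mat_lincomb d I c M)"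

(* Indices start at 1, and A i, B i are constrained only for 1 \<le> i \<le> dA^2 and 1 \<le> i \<le> dB^2.
   The coefficients r i vanish where one of the two bases has run out. *)
definition operator_schmidt_decomposition ::
  "nat \<Rightarrow> nat \<Rightarrow> complex mat \<Rightarrow> (nat \<Rightarrow> real) \<Rightarrow> (nat \<Rightarrow> complex mat) \<Rightarrow> (nat \<Rightarrow> complex mat) \<Rightarrow> bool"
where
  "operator_schmidt_decomposition dA dB \<rho> r A B \<longleftrightarrow>
     orthonormal_basis dA {1..dA\<^sup>2} A \<and>
     orthonormal_basis dB {1..dB\<^sup>2} B \<and>
     (\<forall>i\<ge>1. 0 \<le> r i) \<and>
     (\<forall>i\<ge>1. \<forall>j\<ge>i. r j \<le> r i) \<and>
     (\<forall>i>min (dA\<^sup>2) (dB\<^sup>2). r i = 0) \<and>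
     \<rho> = mat_lincomb (dA * dB) {1..min (dA\<^sup>2) (dB\<^sup>2)} (\<lambda>i. complex_of_real (r i))
           (\<lambda>i. tensor (A i) (B i))"

lemma block_tensor:
  assumes "X \<in> carrier_mat m m" "Y \<in> carrier_mat k k" "p < k" "q < k"
  shows "block m k (tensor X Y) p q = Y $$ (p, q) \<cdot>\<^sub>m X"
proof -
  have *: "a * k + p < m * k" if "a < m" "p < k" for a p
  proof -
    have "a * k + p < Suc a * k" using that by simp
    also have "\<dots> \<le> m * k" using that by (intro mult_le_mono1) simp
    finally show ?thesis .
  qed
  show ?thesis
    using assms by (intro eq_matI) (auto simp: block_def tensor_def *)
qed

lemma tensor_id_tensor:
  assumes "linear_map m n \<Lambda>" "X \<in> carrier_mat m m" "Y \<in> carrier_mat k k"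
  shows "tensor_id m n k \<Lambda> (tensor X Y) = tensor (\<Lambda> X) Y"
proof -
  have c: "\<Lambda> X \<in> carrier_mat n n" and s: "\<Lambda> (y \<cdot>\<^sub>m X) = y \<cdot>\<^sub>m \<Lambda> X" for y
    using assms by (auto simp: linear_map_def)
  have lt: "i mod k < k" "i div k < n" if "i < n * k" for i
    using that by (auto simp: less_mult_imp_div_less intro!: mod_less_divisor gr0I)
  show ?thesis
  proof (rule eq_matI)
    fix i j assume "i < dim_row (tensor (\<Lambda> X) Y)" "j < dim_col (tensor (\<Lambda> X) Y)"
    then have ij: "i < n * k" "j < n * k" using c assms by (auto simp: tensor_def)
    then show "tensor_id m n k \<Lambda> (tensor X Y) $$ (i, j) = tensor (\<Lambda> X) Y $$ (i, j)"
      unfolding tensor_id_def using c assms lt[OF ij(1)] lt[OF ij(2)]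
      by (simp add: block_tensor[OF assms(2,3)] s) (simp add: tensor_def)
  qed (use c assms in \<open>auto simp: tensor_id_def tensor_def\<close>)
qed

end

theory Submission
  imports Defs
begin

text \<open>Both estimates rest on the Jordan decomposition \<open>H = P - N\<close> of a Hermitian matrix into positive
  semidefinite parts: the trace norm of \<open>H\<close> is the least value of \<open>Tr P + Tr N\<close>, so that every
  positive map that does not increase traces contracts it.

  Let \<open>\<Delta> = \<Lambda>0 - \<Lambda>1\<close>. For the lower bound, tracing \<open>(\<Delta> \<otimes> id) \<rho>\<close> out against \<open>B i\<close>, a contraction, leaves
  \<open>r i * \<Delta> (A i)\<close>, so every \<open>r i * \<parallel>\<Delta> (A i)\<parallel>\<close> is at most \<open>\<parallel>(\<Delta> \<otimes> id) \<rho>\<parallel>\<close>. Conversely a density operator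
  \<open>\<sigma>\<close> on two copies of the input expands as the sum of the \<open>A i \<otimes> C i\<close> with \<open>\<parallel>C i\<parallel> \<le> 1\<close>, so the
  diamond distance is at most half the sum of the \<open>dA\<^sup>2\<close> norms \<open>\<parallel>\<Delta> (A i)\<parallel>\<close>. This gives the bound with
  \<open>dA\<^sup>2\<close> in place of \<open>dA powr (5 / 2)\<close>.

  For the upper bound, the two channels measure the effects \<open>(1 \<plusminus> A i / \<parallel>A i\<parallel>) / 2\<close> and report the outcome,
  respectively its negation, in a qubit. Their difference detects only the component \<open>A i\<close> of \<open>\<rho>\<close>, while an
  eigenvector of \<open>A i\<close> for an eigenvalue of maximal modulus distinguishes them perfectly.\<close>

section \<open>The spectral theorem\<close>

text \<open>The trace norm is defined through a square root chosen by \<open>THE\<close>, so nothing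
  is known about it before such a root is shown to exist and to be unique. For Hermitian matrices an
  orthonormal eigenbasis settles this, so the norm estimates are stated for Hermitian matrices only.
  They stay applicable because the \<open>A i\<close>, the \<open>B i\<close>, states, weighted
  partial traces of states and differences of channel outputs are all Hermitian. The Hilbert-Schmidt
  normalization is used in two directions. The squared eigenvalues of a Hermitian unit operator sum
  to 1. Hence each has modulus at most 1, which makes \<open>A i\<close> and \<open>B i\<close>
  contractions and bounds \<open>C i\<close>, the partial trace of \<sigma> against
  \<open>A i\<close>. Conversely, the largest of the \<open>dA\<close> moduli for \<open>A i\<close>
  is at least 1 / sqrt dA, and by Cauchy-Schwarz the moduli for \<open>B i\<close> sum to at most
  sqrt dB; together these give the constant of the last inequality. The quotient in
  \<open>CDP\<close> is meaningful only for a positive diamond distance: division by 0 yields 0 in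
  HOL, which could undercut the lower bound. Distinct channels must therefore be separated by an
  actual state, which is found among eigenprojections of the \<open>A i\<close>.\<close>

definition qform :: "nat \<Rightarrow> complex mat \<Rightarrow> (nat \<Rightarrow> complex) \<Rightarrow> complex" where
  "qform n M v = (\<Sum>a<n. \<Sum>b<n. cnj (v a) * M $$ (a, b) * v b)"

definition orthonormal_family :: "nat \<Rightarrow> nat \<Rightarrow> (nat \<Rightarrow> nat \<Rightarrow> complex) \<Rightarrow> bool" where
  "orthonormal_family n k u \<longleftrightarrow>
     (\<forall>i<k. \<forall>j<k. (\<Sum>a<n. cnj (u i a) * u j a) = (if i = j then 1 else 0))"

definition eigenpair :: "nat \<Rightarrow> complex mat \<Rightarrow> real \<Rightarrow> (nat \<Rightarrow> complex) \<Rightarrow> bool" where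
  "eigenpair n H l v \<longleftrightarrow> (\<forall>a<n. (\<Sum>b<n. H $$ (a, b) * v b) = complex_of_real l * v a)"

text \<open>The second clause is the resolution of the identity. The vectors \<open>u\<close> are a
  parameter separate from the numbers \<open>l\<close>, so that functions of \<open>H\<close> share
  \<open>u\<close> and differ only in \<open>l\<close>.\<close>

definition spectral_decomposition ::
  "nat \<Rightarrow> complex mat \<Rightarrow> (nat \<Rightarrow> nat \<Rightarrow> complex) \<Rightarrow> (nat \<Rightarrow> real) \<Rightarrow> bool" where
  "spectral_decomposition n H u l \<longleftrightarrow>
     orthonormal_family n n u \<and>
     (\<forall>a<n. \<forall>b<n. (\<Sum>i<n. u i a * cnj (u i b)) = (if a = b then 1 else 0)) \<and>
     (\<forall>a<n. \<forall>b<n. H $$ (a, b) = (\<Sum>i<n. complex_of_real (l i) * u i a * cnj (u i b)))"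

lemma complex_nonneg_iff: "0 \<le> (z::complex) \<longleftrightarrow> Im z = 0 \<and> 0 \<le> Re z"
  by (auto simp: less_eq_complex_def)

lemma mat_adjoint_carrier [simp]: "M \<in> carrier_mat n m \<Longrightarrow> mat_adjoint M \<in> carrier_mat m n"
  by (auto simp: mat_adjoint_def mat_of_rows_def)

lemma mat_adjoint_index:
  assumes "M \<in> carrier_mat n m" "a < m" "b < n"
  shows "mat_adjoint M $$ (a, b) = cnj (M $$ (b, a))"
  using assms by (auto simp: mat_adjoint_def mat_of_rows_def)

lemma hermitian_iff:
  assumes "M \<in> carrier_mat n n"
  shows "hermitian M \<longleftrightarrow> (\<forall>a<n. \<forall>b<n. cnj (M $$ (b, a)) = M $$ (a, b))"
proof
  assume "hermitian M"
  then show "\<forall>a<n. \<forall>b<n. cnj (M $$ (b, a)) = M $$ (a, b)"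
    using mat_adjoint_index[OF assms] unfolding hermitian_def by metis
next
  assume "\<forall>a<n. \<forall>b<n. cnj (M $$ (b, a)) = M $$ (a, b)"
  then show "hermitian M"
    unfolding hermitian_def using assms mat_adjoint_carrier[OF assms] mat_adjoint_index[OF assms]
    by (intro eq_matI) (simp_all only: carrier_matD)
qed

lemma hermitianD:
  assumes "hermitian M" "M \<in> carrier_mat n n" "a < n" "b < n"
  shows "cnj (M $$ (b, a)) = M $$ (a, b)"
  using assms hermitian_iff by blast

lemma mult_mat_index:
  assumes "X \<in> carrier_mat n k" "Y \<in> carrier_mat k m" "a < n" "b < m"
  shows "(X * Y) $$ (a, b) = (\<Sum>c<k. X $$ (a, c) * Y $$ (c, b))"
  using assms by (auto simp: scalar_prod_def lessThan_atLeast0)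

lemma mult_mat_vec_index:
  assumes "X \<in> carrier_mat n k" "v \<in> carrier_vec k" "a < n"
  shows "(X *\<^sub>v v) $ a = (\<Sum>c<k. X $$ (a, c) * v $ c)"
  using assms by (auto simp: scalar_prod_def lessThan_atLeast0)

lemma cscalar_prod_sum:
  assumes "dim_vec w = n"
  shows "(v \<bullet>c w) = (\<Sum>a<n. v $ a * cnj (w $ a))"
  using assms by (auto simp: scalar_prod_def lessThan_atLeast0)

lemma mat_trace_sum: "M \<in> carrier_mat n n \<Longrightarrow> mat_trace M = (\<Sum>a<n. M $$ (a, a))"
  by (simp add: mat_trace_def)

lemma mat_trace_mult:
  assumes "X \<in> carrier_mat n m" "Y \<in> carrier_mat m n"
  shows "mat_trace (X * Y) = (\<Sum>a<n. \<Sum>b<m. X $$ (a, b) * Y $$ (b, a))"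
  using assms by (simp add: mat_trace_def mult_mat_index[OF assms] del: index_mult_mat(1))

lemma mat_trace_comm:
  assumes "X \<in> carrier_mat n m" "Y \<in> carrier_mat m n"
  shows "mat_trace (X * Y) = mat_trace (Y * X)"
  unfolding mat_trace_mult[OF assms] mat_trace_mult[OF assms(2,1)]
  by (subst sum.swap) (simp add: mult.commute)

text \<open>Vectors become plain functions, of which \<open>qform\<close> reads only the first
  \<open>n\<close> values, so test vectors can later be written down without carrier
  conditions.\<close>

lemma psd_iff: "psd n M \<longleftrightarrow> M \<in> carrier_mat n n \<and> (\<forall>v. 0 \<le> qform n M v)"
proof -
  have q: "(M *\<^sub>v v) \<bullet>c v = qform n M (\<lambda>a. v $ a)"
    if "M \<in> carrier_mat n n" "v \<in> carrier_vec n" for v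
  proof -
    have "dim_vec v = n" using that by simp
    then show ?thesis
      unfolding cscalar_prod_sum[OF \<open>dim_vec v = n\<close>] qform_def
      using that
      by (auto simp: mult_mat_vec_index[OF that] sum_distrib_left mult_ac
          simp del: index_mult_mat_vec intro!: sum.cong)
  qed
  have "qform n M v = qform n M (\<lambda>a. vec n v $ a)" for v
    unfolding qform_def by (intro sum.cong) auto
  then have "qform n M v = (M *\<^sub>v vec n v) \<bullet>c vec n v" if "M \<in> carrier_mat n n" for v
    using q[OF that vec_carrier] by simp
  then have "(\<forall>v\<in>carrier_vec n. 0 \<le> (M *\<^sub>v v) \<bullet>c v) \<longleftrightarrow> (\<forall>v. 0 \<le> qform n M v)" if "M \<in> carrier_mat n n"
    using q[OF that] that by (metis vec_carrier)
  then show ?thesis unfolding psd_def by blast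
qed

lemma psdI: "M \<in> carrier_mat n n \<Longrightarrow> (\<And>v. 0 \<le> qform n M v) \<Longrightarrow> psd n M"
  by (simp add: psd_iff)

lemma psd_carrier: "psd n M \<Longrightarrow> M \<in> carrier_mat n n"
  by (simp add: psd_iff)

lemma psd_qform: "psd n M \<Longrightarrow> 0 \<le> qform n M v"
  by (simp add: psd_iff)

lemma qform_two_point:
  assumes "a < n" "b < n" "a \<noteq> b"
  shows "qform n M (\<lambda>i. if i = a then x else if i = b then y else 0) =
    cnj x * M $$ (a, a) * x + cnj x * M $$ (a, b) * y + cnj y * M $$ (b, a) * x + cnj y * M $$ (b, b) * y"
proof -
  have s: "(\<Sum>i<n. f i * (if i = a then p else if i = b then q else 0)) = f a * p + f b * q"
    for f :: "nat \<Rightarrow> complex" and p q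
  proof -
    have "(\<Sum>i<n. f i * (if i = a then p else if i = b then q else 0)) =
       (\<Sum>i<n. (if i = a then f a * p else 0) + (if i = b then f b * q else 0))"
      using assms by (intro sum.cong) auto
    then show ?thesis using assms by (simp add: sum.distrib)
  qed
  have "qform n M (\<lambda>i. if i = a then x else if i = b then y else 0) =
     (\<Sum>i<n. (M $$ (i, a) * x + M $$ (i, b) * y) * (if i = a then cnj x else if i = b then cnj y else 0))"
    unfolding qform_def
  proof (intro sum.cong refl)
    fix i
    show "(\<Sum>j<n. cnj (if i = a then x else if i = b then y else 0) * M $$ (i, j) *
        (if j = a then x else if j = b then y else 0)) =
      (M $$ (i, a) * x + M $$ (i, b) * y) * (if i = a then cnj x else if i = b then cnj y else 0)"
      unfolding s by (auto simp: algebra_simps)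
  qed
  then show ?thesis unfolding s by (simp add: algebra_simps)
qed

lemma qform_one_point:
  assumes "a < n"
  shows "qform n M (\<lambda>i. if i = a then 1 else 0) = M $$ (a, a)"
proof -
  have "qform n M (\<lambda>i. if i = a then 1 else 0) =
    (\<Sum>i<n. if i = a then (\<Sum>j<n. if j = a then M $$ (a, a) else 0) else 0)"
    unfolding qform_def
  proof (intro sum.cong refl)
    fix i
    show "(\<Sum>j<n. cnj (if i = a then 1 else 0) * M $$ (i, j) * (if j = a then 1 else 0)) =
      (if i = a then (\<Sum>j<n. if j = a then M $$ (a, a) else 0) else 0)"
      by (cases "i = a") (auto intro!: sum.cong simp del: sum.delta sum.delta')
  qed
  then show ?thesis using assms by simp
qed

lemma psd_diag_nonneg: "psd n M \<Longrightarrow> a < n \<Longrightarrow> 0 \<le> M $$ (a, a)"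
  using psd_qform qform_one_point by metis

text \<open>Polarization: the form is real at the vectors \<open>e_a + e_b\<close> and
  \<open>e_a + \<i> e_b\<close>, which compares the imaginary and the real parts of the two
  off-diagonal entries.\<close>

lemma psd_hermitian:
  assumes "psd n M"
  shows "hermitian M"
  unfolding hermitian_iff[OF psd_carrier[OF assms]]
proof (intro allI impI)
  fix a b assume ab: "a < n" "b < n"
  note d = psd_diag_nonneg[OF assms, unfolded complex_nonneg_iff]
  show "cnj (M $$ (b, a)) = M $$ (a, b)"
  proof (cases "a = b")
    case True
    then show ?thesis using d[OF ab(1)] by (simp add: complex_eq_iff)
  next
    case False
    have "Im (M $$ (a, b) + M $$ (b, a)) = 0" "Re (M $$ (a, b) - M $$ (b, a)) = 0"
      using psd_qform[OF assms, of "\<lambda>i. if i = a then 1 else if i = b then 1 else 0"]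
        psd_qform[OF assms, of "\<lambda>i. if i = a then 1 else if i = b then \<i> else 0"]
        d[OF ab(1)] d[OF ab(2)]
      unfolding qform_two_point[OF ab False] complex_nonneg_iff by simp_all
    then show ?thesis by (simp add: complex_eq_iff)
  qed
qed

lemma hermitian_inner:
  assumes "hermitian H" "H \<in> carrier_mat n n"
  shows "(\<Sum>a<n. cnj (v a) * (\<Sum>b<n. H $$ (a, b) * w b)) =
         (\<Sum>a<n. cnj (\<Sum>b<n. H $$ (a, b) * v b) * w a)"
proof -
  have "(\<Sum>a<n. cnj (v a) * (\<Sum>b<n. H $$ (a, b) * w b)) =
        (\<Sum>a<n. \<Sum>b<n. cnj (v a) * (H $$ (a, b) * w b))"
    by (simp add: sum_distrib_left)
  also have "\<dots> = (\<Sum>b<n. \<Sum>a<n. cnj (v a) * (H $$ (a, b) * w b))"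
    by (rule sum.swap)
  also have "\<dots> = (\<Sum>b<n. cnj (\<Sum>a<n. H $$ (b, a) * v a) * w b)"
  proof (intro sum.cong refl)
    fix b assume "b \<in> {..<n}"
    then show "(\<Sum>a<n. cnj (v a) * (H $$ (a, b) * w b)) = cnj (\<Sum>a<n. H $$ (b, a) * v a) * w b"
      using hermitianD[OF assms] unfolding cnj_sum sum_distrib_right by (intro sum.cong) auto
  qed
  finally show ?thesis .
qed

lemma inner_self_eq_0:
  fixes v :: "nat \<Rightarrow> complex"
  assumes "(\<Sum>a<n. cnj (v a) * v a) = 0" "a < n"
  shows "v a = 0"
proof -
  have "(\<Sum>a<n. (cmod (v a))\<^sup>2) = 0"
  proof -
    have "complex_of_real (\<Sum>a<n. (cmod (v a))\<^sup>2) = (\<Sum>a<n. cnj (v a) * v a)"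
      unfolding of_real_sum by (intro sum.cong refl) (metis complex_norm_square mult.commute)
    then show ?thesis using assms(1) by (metis of_real_eq_0_iff)
  qed
  then show ?thesis using assms(2) by (simp add: sum_nonneg_eq_0_iff)
qed

text \<open>The conjugated vectors are the first rows of a square matrix padded with zero rows.
  Since \<open>k < n\<close>, its last row is zero, so it is singular, and a kernel vector is
  orthogonal to the family.\<close>

lemma orthonormal_family_extend:
  assumes "orthonormal_family n k u" "k < n"
  obtains w where "\<exists>a<n. w a \<noteq> 0" "\<And>i. i < k \<Longrightarrow> (\<Sum>a<n. cnj (u i a) * w a) = 0"
proof -
  define X where "X = mat\<^sub>r n n (\<lambda>i. if i = n - 1 then 0\<^sub>v n else vec n (\<lambda>a. if i < k then cnj (u i a) else 0))"
  have "X \<in> carrier_mat n n" "row X (n - 1) = 0\<^sub>v n"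
    using assms(2) by (auto simp: X_def)
  moreover have "det X = 0"
    unfolding X_def using assms(2) by (intro det_row_0) auto
  ultimately obtain w where w: "w \<in> carrier_vec n" "w \<noteq> 0\<^sub>v n" "X *\<^sub>v w = 0\<^sub>v n"
    using det_0_iff_vec_prod_zero_field by blast
  show thesis
  proof
    show "\<exists>a<n. w $ a \<noteq> 0" using w by (metis carrier_vecD eq_vecI index_zero_vec)
    fix i assume "i < k"
    then have "(X *\<^sub>v w) $ i = 0" "i < n" "i \<noteq> n - 1" using w assms by auto
    then show "(\<Sum>a<n. cnj (u i a) * w $ a) = 0"
      using \<open>i < k\<close> mult_mat_vec_index[OF \<open>X \<in> _\<close> w(1) \<open>i < n\<close>] by (simp add: X_def)
  qed
qed

lemma normalize_vector:
  fixes v :: "nat \<Rightarrow> complex"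
  assumes "\<exists>a<n. v a \<noteq> 0"
  obtains c where "c \<noteq> 0" "(\<Sum>a<n. cnj (complex_of_real c * v a) * (complex_of_real c * v a)) = 1"
proof -
  define s where "s = (\<Sum>a<n. (cmod (v a))\<^sup>2)"
  have "s \<noteq> 0" "s \<ge> 0" using assms by (auto simp: s_def sum_nonneg_eq_0_iff intro!: sum_nonneg)
  then have s: "s > 0" by simp
  have "(\<Sum>a<n. cnj (complex_of_real (1 / sqrt s) * v a) * (complex_of_real (1 / sqrt s) * v a))
      = (\<Sum>a<n. complex_of_real (1 / s) * complex_of_real ((cmod (v a))\<^sup>2))"
  proof (intro sum.cong refl)
    fix a
    have "cnj (complex_of_real (1 / sqrt s) * v a) * (complex_of_real (1 / sqrt s) * v a)
        = complex_of_real ((1 / sqrt s)\<^sup>2) * (v a * cnj (v a))"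
      unfolding power2_eq_square of_real_mult complex_cnj_mult complex_cnj_complex_of_real
      by (simp only: mult_ac)
    then show "cnj (complex_of_real (1 / sqrt s) * v a) * (complex_of_real (1 / sqrt s) * v a)
        = complex_of_real (1 / s) * complex_of_real ((cmod (v a))\<^sup>2)"
      using s by (simp only: complex_norm_square) (simp add: power_divide)
  qed
  also have "\<dots> = complex_of_real (1 / s * s)"
    by (simp only: s_def of_real_mult of_real_sum sum_distrib_left)
  finally show thesis using s by (intro that[of "1 / sqrt s"]) auto
qed

text \<open>The inner factors \<open>Q * P\<close> cancel and the outer ones are joined by cyclicity
  of the trace. The square is taken because its trace is the squared Hilbert-Schmidt norm of a
  Hermitian matrix.\<close>

lemma similar_mat_trace_square:
  assumes "K \<in> carrier_mat n n" "similar_mat K C"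
  shows "mat_trace (K * K) = mat_trace (C * C)"
proof -
  obtain P Q where "similar_mat_wit K C P Q" using assms(2) by (auto simp: similar_mat_def)
  note s = similar_mat_witD2[OF assms(1) this]
  have [simp]: "P \<in> carrier_mat n n" "Q \<in> carrier_mat n n" "C \<in> carrier_mat n n"
    using s by auto
  have QC: "Q * (P * Z) = Z" if "Z \<in> carrier_mat n n" for Z
    using that s(2) by (simp add: assoc_mult_mat[of Q n n P n Z n, symmetric])
  have assoc: "X * Y * Z = X * (Y * Z)"
    if "X \<in> carrier_mat n n" "Y \<in> carrier_mat n n" "Z \<in> carrier_mat n n" for X Y Z :: "complex mat"
    using that by (rule assoc_mult_mat)
  have [simp]: "X * Y \<in> carrier_mat n n"
    if "X \<in> carrier_mat n n" "Y \<in> carrier_mat n n" for X Y :: "complex mat"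
    using that by (rule mult_carrier_mat)
  have "K * K = P * (C * (C * Q))"
    by (subst (1 2) s(3)) (simp add: assoc QC)
  also have "mat_trace \<dots> = mat_trace (C * (C * Q) * P)"
    by (rule mat_trace_comm[of _ n n]) auto
  also have "C * (C * Q) * P = C * C"
    using s(2) by (simp add: assoc right_mult_one_mat[of C n n])
  finally show ?thesis .
qed

text \<open>Otherwise its Schur form would be strictly upper triangular, so that the trace of its square,
  which is the sum of the squared moduli of the entries, would vanish.\<close>

lemma hermitian_nonzero_eigenvalue:
  assumes "hermitian K" "K \<in> carrier_mat n n" "K \<noteq> 0\<^sub>m n n"
  obtains e where "e \<noteq> 0" "eigenvalue K e"
proof -
  obtain es where es: "char_poly K = (\<Prod>e\<leftarrow>es. [:- e, 1:])"
    using char_poly_factorized[OF assms(2)] by blast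
  then obtain C where C: "C \<in> carrier_mat n n" "upper_triangular C" "similar_mat K C"
    using schur_decomposition_exists[OF assms(2)] by blast
  have "\<exists>i<n. C $$ (i, i) \<noteq> 0"
  proof (rule ccontr)
    assume "\<not> ?thesis"
    then have "C $$ (i, j) = 0" if "i < n" "j \<le> i" for i j
      using that C by (cases "j = i") (auto dest: upper_triangularD)
    then have z: "C $$ (a, b) * C $$ (b, a) = 0" if "a < n" "b < n" for a b
      using that by (cases "b \<le> a") auto
    have "mat_trace (K * K) = 0"
      unfolding similar_mat_trace_square[OF assms(2) C(3)] mat_trace_mult[OF C(1) C(1)]
      using z by (intro sum.neutral) (auto intro!: sum.neutral)
    moreover have "mat_trace (K * K) = (\<Sum>a<n. \<Sum>b<n. complex_of_real ((cmod (K $$ (a, b)))\<^sup>2))"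
      unfolding mat_trace_mult[OF assms(2,2)]
    proof (intro sum.cong refl)
      fix a b assume "a \<in> {..<n}" "b \<in> {..<n}"
      then have "K $$ (b, a) = cnj (K $$ (a, b))" using hermitianD[OF assms(1,2)] by simp
      then show "K $$ (a, b) * K $$ (b, a) = complex_of_real ((cmod (K $$ (a, b)))\<^sup>2)"
        by (simp only: complex_norm_square)
    qed
    ultimately have "(\<Sum>a<n. \<Sum>b<n. (cmod (K $$ (a, b)))\<^sup>2) = 0"
      by (metis (no_types, lifting) of_real_sum of_real_eq_0_iff sum.cong)
    then have "\<forall>a<n. \<forall>b<n. K $$ (a, b) = 0"
      by (simp add: sum_nonneg_eq_0_iff sum_nonneg)
    then have "K = 0\<^sub>m n n" using assms(2) by (intro eq_matI) auto
    with assms(3) show False by simp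
  qed
  then obtain i where i: "i < n" "C $$ (i, i) \<noteq> 0" by blast
  have "char_poly K = (\<Prod>a\<leftarrow>diag_mat C. [:- a, 1:])"
    using char_poly_similar[OF C(3)] char_poly_upper_triangular[OF C(1,2)] by simp
  moreover have "C $$ (i, i) \<in> set (diag_mat C)" using i C by (auto simp: diag_mat_def)
  ultimately have "poly (char_poly K) (C $$ (i, i)) = 0"
    by (auto simp: poly_prod_list prod_list_zero_iff)
  then have "eigenvalue K (C $$ (i, i))" using eigenvalue_root_char_poly[OF assms(2)] by simp
  with i show thesis using that by blast
qed

lemma hermitian_eigenvalue_real:
  assumes "hermitian H" "H \<in> carrier_mat n n" "\<exists>a<n. v a \<noteq> 0"
    and "\<And>a. a < n \<Longrightarrow> (\<Sum>b<n. H $$ (a, b) * v b) = e * v a"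
  shows "cnj e = e"
proof -
  have "e * (\<Sum>a<n. cnj (v a) * v a) = cnj e * (\<Sum>a<n. cnj (v a) * v a)"
  proof -
    have "e * (\<Sum>a<n. cnj (v a) * v a) = (\<Sum>a<n. cnj (v a) * (\<Sum>b<n. H $$ (a, b) * v b))"
      using assms(4) by (simp add: sum_distrib_left mult.left_commute)
    also have "\<dots> = (\<Sum>a<n. cnj (e * v a) * v a)"
      unfolding hermitian_inner[OF assms(1,2)]
      by (intro sum.cong refl) (metis assms(4) lessThan_iff)
    finally show ?thesis by (simp add: sum_distrib_left mult.assoc)
  qed
  moreover have "(\<Sum>a<n. cnj (v a) * v a) \<noteq> 0" using inner_self_eq_0[of v n] assms(3) by blast
  ultimately show ?thesis by simp
qed

text \<open>An eigenvector of the deflated matrix \<open>K\<close> for a nonzero eigenvalue is orthogonal to its kernel,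
  which contains the vectors found so far.\<close>

lemma hermitian_next_eigenvector:
  assumes "hermitian H" "H \<in> carrier_mat n n" "orthonormal_family n k u" "k < n"
    and "\<And>i. i < k \<Longrightarrow> eigenpair n H (l i) (u i)"
  obtains w e where "\<exists>a<n. w a \<noteq> 0" "\<And>i. i < k \<Longrightarrow> (\<Sum>a<n. cnj (u i a) * w a) = 0" "eigenpair n H e w"
proof -
  define K where "K = mat n n (\<lambda>(a, b). H $$ (a, b) - (\<Sum>i<k. complex_of_real (l i) * u i a * cnj (u i b)))"
  have Kc: "K \<in> carrier_mat n n" by (simp add: K_def)
  have Kh: "hermitian K"
    unfolding hermitian_iff[OF Kc] using hermitianD[OF assms(1,2)]
    by (auto simp: K_def mult_ac)
  have Kv: "(\<Sum>b<n. K $$ (a, b) * v b) = (\<Sum>b<n. H $$ (a, b) * v b)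
      - (\<Sum>i<k. complex_of_real (l i) * u i a * (\<Sum>b<n. cnj (u i b) * v b))" if "a < n" for a v
  proof -
    have "(\<Sum>b<n. K $$ (a, b) * v b) = (\<Sum>b<n. H $$ (a, b) * v b)
      - (\<Sum>b<n. \<Sum>i<k. complex_of_real (l i) * u i a * (cnj (u i b) * v b))"
      using that by (simp add: K_def algebra_simps sum_subtractf sum_distrib_left)
    then show ?thesis by (subst (asm) sum.swap) (simp add: sum_distrib_left)
  qed
  show thesis
  proof (cases "K = 0\<^sub>m n n")
    case True
    \<comment> \<open>\<open>H\<close> is now a combination of the projections on the vectors found
      so far, so it annihilates every vector orthogonal to them.\<close>
    obtain w where w: "\<exists>a<n. w a \<noteq> 0" "\<And>i. i < k \<Longrightarrow> (\<Sum>a<n. cnj (u i a) * w a) = 0"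
      using orthonormal_family_extend[OF assms(3,4)] by blast
    have "eigenpair n H 0 w"
      unfolding eigenpair_def
    proof (intro allI impI)
      fix a assume a: "a < n"
      have "(\<Sum>b<n. K $$ (a, b) * w b) = 0" using a by (simp add: True)
      then show "(\<Sum>b<n. H $$ (a, b) * w b) = complex_of_real 0 * w a"
        unfolding Kv[OF a] using w(2) by simp
    qed
    then show thesis using that w by blast
  next
    case False
    then obtain e where e: "e \<noteq> 0" "eigenvalue K e"
      using hermitian_nonzero_eigenvalue[OF Kh Kc] by blast
    then obtain z where z: "z \<in> carrier_vec n" "z \<noteq> 0\<^sub>v n" "K *\<^sub>v z = e \<cdot>\<^sub>v z"
      using Kc by (auto simp: eigenvalue_def eigenvector_def)
    define w where "w = (\<lambda>a. z $ a)"
    have w0: "\<exists>a<n. w a \<noteq> 0" using z unfolding w_def by (metis carrier_vecD eq_vecI index_zero_vec)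
    have Kw: "(\<Sum>b<n. K $$ (a, b) * w b) = e * w a" if "a < n" for a
      using mult_mat_vec_index[OF Kc z(1) that] that z(1) unfolding z(3) by (simp add: w_def)
    have er: "cnj e = e" by (rule hermitian_eigenvalue_real[OF Kh Kc w0 Kw])
    have Ku: "(\<Sum>b<n. K $$ (a, b) * u j b) = 0" if "a < n" "j < k" for a j
    proof -
      have "(\<Sum>i<k. complex_of_real (l i) * u i a * (\<Sum>b<n. cnj (u i b) * u j b))
          = (\<Sum>i<k. if i = j then complex_of_real (l j) * u j a else 0)"
        using assms(3) that by (intro sum.cong) (auto simp: orthonormal_family_def)
      then show ?thesis unfolding Kv[OF that(1)]
        using assms(5)[OF that(2)] that by (simp add: eigenpair_def)
    qed
    have orth: "(\<Sum>a<n. cnj (u i a) * w a) = 0" if "i < k" for i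
    proof -
      have "e * (\<Sum>a<n. cnj (u i a) * w a) = (\<Sum>a<n. cnj (u i a) * (\<Sum>b<n. K $$ (a, b) * w b))"
        using Kw by (simp add: sum_distrib_left mult_ac)
      also have "\<dots> = 0" unfolding hermitian_inner[OF Kh Kc] using Ku that by simp
      finally show ?thesis using e by simp
    qed
    \<comment> \<open>The subtracted projections vanish on \<open>w\<close>, so \<open>K\<close> and
      \<open>H\<close> act alike there.\<close>
    have "eigenpair n H (Re e) w"
      unfolding eigenpair_def
    proof (intro allI impI)
      fix a assume a: "a < n"
      have "complex_of_real (Re e) = e" using er by (simp add: complex_eq_iff)
      then show "(\<Sum>b<n. H $$ (a, b) * w b) = complex_of_real (Re e) * w a"
        using Kw[OF a] unfolding Kv[OF a] using orth by simp
    qed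
    then show thesis using that w0 orth by blast
  qed
qed

lemma hermitian_eigenfamily:
  assumes "hermitian H" "H \<in> carrier_mat n n" "k \<le> n"
  shows "\<exists>u l. orthonormal_family n k u \<and> (\<forall>i<k. eigenpair n H (l i) (u i))"
  using assms(3)
proof (induction k)
  case 0
  then show ?case by (simp add: orthonormal_family_def)
next
  case (Suc k)
  then obtain u l where u: "orthonormal_family n k u" "\<And>i. i < k \<Longrightarrow> eigenpair n H (l i) (u i)" by auto
  obtain w e where w: "\<exists>a<n. w a \<noteq> 0" "\<And>i. i < k \<Longrightarrow> (\<Sum>a<n. cnj (u i a) * w a) = 0" "eigenpair n H e w"
    using hermitian_next_eigenvector[OF assms(1,2) u(1) _ u(2)] Suc.prems by auto
  obtain c where c: "(\<Sum>a<n. cnj (complex_of_real c * w a) * (complex_of_real c * w a)) = 1"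
    using normalize_vector[OF w(1)] by metis
  define w' where "w' = (\<lambda>a. complex_of_real c * w a)"
  have w': "(\<Sum>a<n. cnj (w' a) * w' a) = 1" "eigenpair n H e w'"
  proof -
    show "(\<Sum>a<n. cnj (w' a) * w' a) = 1" using c by (simp add: w'_def)
    have "(\<Sum>b<n. H $$ (a, b) * w' b) = complex_of_real c * (\<Sum>b<n. H $$ (a, b) * w b)" for a
      unfolding sum_distrib_left w'_def by (simp add: mult.left_commute)
    then show "eigenpair n H e w'"
      using w(3) by (simp add: eigenpair_def w'_def)
  qed
  have o: "(\<Sum>a<n. cnj (u i a) * w' a) = 0" if "i < k" for i
  proof -
    have "(\<Sum>a<n. cnj (u i a) * w' a) = complex_of_real c * (\<Sum>a<n. cnj (u i a) * w a)"
      unfolding sum_distrib_left w'_def by (simp add: mult.left_commute)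
    then show ?thesis using w(2)[OF that] by simp
  qed
  have o': "(\<Sum>a<n. cnj (w' a) * u i a) = 0" if "i < k" for i
    using arg_cong[OF o[OF that], of cnj] by (simp add: mult.commute)
  have "orthonormal_family n (Suc k) (u(k := w'))"
    using u(1) w'(1) o o' by (auto simp: orthonormal_family_def less_Suc_eq)
  moreover have "\<forall>i<Suc k. eigenpair n H ((l(k := e)) i) ((u(k := w')) i)"
    using u(2) w'(2) by (auto simp: less_Suc_eq)
  ultimately show ?case by blast
qed

text \<open>With \<open>n\<close> vectors in dimension \<open>n\<close> the matrix of the family is
  square, so its left inverse is also a right inverse.\<close>

lemma orthonormal_family_complete:
  assumes "orthonormal_family n n u" "a < n" "b < n"
  shows "(\<Sum>i<n. u i a * cnj (u i b)) = (if a = b then 1 else 0)"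
proof -
  define U where "U = mat n n (\<lambda>(a, i). u i a)"
  define V where "V = mat n n (\<lambda>(i, a). cnj (u i a))"
  have c: "U \<in> carrier_mat n n" "V \<in> carrier_mat n n" by (auto simp: U_def V_def)
  have "(V * U) $$ (i, j) = (if i = j then 1 else 0)" if "i < n" "j < n" for i j
    unfolding mult_mat_index[OF c(2,1) that]
    using assms(1) that by (simp add: U_def V_def orthonormal_family_def)
  then have "V * U = 1\<^sub>m n"
    using c by (intro eq_matI) (simp_all del: index_mult_mat(1))
  then have "U * V = 1\<^sub>m n" using mat_mult_left_right_inverse[OF c(2,1)] by simp
  then show ?thesis using mult_mat_index[OF c assms(2,3)] assms(2,3) by (simp add: U_def V_def)
qed

theorem spectral_theorem:
  assumes "hermitian H" "H \<in> carrier_mat n n"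
  obtains u l where "spectral_decomposition n H u l"
proof -
  obtain u l where u: "orthonormal_family n n u" "\<And>i. i < n \<Longrightarrow> eigenpair n H (l i) (u i)"
    using hermitian_eigenfamily[OF assms order_refl] by blast
  have "H $$ (a, b) = (\<Sum>i<n. complex_of_real (l i) * u i a * cnj (u i b))" if "a < n" "b < n" for a b
  proof -
    \<comment> \<open>The resolution of the identity is inserted behind \<open>H\<close>; the
      eigenvalue equation then acts on each term.\<close>
    have "H $$ (a, b) = (\<Sum>c<n. H $$ (a, c) * (\<Sum>i<n. u i c * cnj (u i b)))"
    proof -
      have "(\<Sum>c<n. H $$ (a, c) * (\<Sum>i<n. u i c * cnj (u i b))) = (\<Sum>c<n. if c = b then H $$ (a, b) else 0)"
        using orthonormal_family_complete[OF u(1)] that by (intro sum.cong) auto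
      then show ?thesis using that by simp
    qed
    also have "\<dots> = (\<Sum>i<n. (\<Sum>c<n. H $$ (a, c) * u i c) * cnj (u i b))"
      by (simp add: sum_distrib_left sum_distrib_right mult.assoc) (rule sum.swap)
    also have "\<dots> = (\<Sum>i<n. complex_of_real (l i) * u i a * cnj (u i b))"
      using u(2) that by (intro sum.cong) (auto simp: eigenpair_def)
    finally show ?thesis .
  qed
  then have "spectral_decomposition n H u l"
    unfolding spectral_decomposition_def using u(1) orthonormal_family_complete[OF u(1)] by blast
  then show thesis using that by blast
qed

section \<open>The trace norm and the operator norm\<close>

lemma qform_add:
  assumes "X \<in> carrier_mat n n" "Y \<in> carrier_mat n n"
  shows "qform n (X + Y) v = qform n X v + qform n Y v"
proof -
  have "qform n (X + Y) v = (\<Sum>a<n. \<Sum>b<n. cnj (v a) * X $$ (a, b) * v b + cnj (v a) * Y $$ (a, b) * v b)"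
    unfolding qform_def using assms by (intro sum.cong refl) (auto simp: algebra_simps)
  then show ?thesis by (simp add: qform_def sum.distrib)
qed

lemma qform_minus:
  assumes "X \<in> carrier_mat n n" "Y \<in> carrier_mat n n"
  shows "qform n (X - Y) v = qform n X v - qform n Y v"
proof -
  have "qform n (X - Y) v = (\<Sum>a<n. \<Sum>b<n. cnj (v a) * X $$ (a, b) * v b - cnj (v a) * Y $$ (a, b) * v b)"
    unfolding qform_def using assms by (intro sum.cong refl) (auto simp: algebra_simps)
  then show ?thesis by (simp add: qform_def sum_subtractf)
qed

lemma psd_add: "psd n X \<Longrightarrow> psd n Y \<Longrightarrow> psd n (X + Y)"
  by (auto simp: psd_iff qform_add intro!: add_nonneg_nonneg)

lemma hermitian_add:
  assumes "hermitian X" "X \<in> carrier_mat n n" "hermitian Y" "Y \<in> carrier_mat n n"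
  shows "hermitian (X + Y)"
  using hermitianD[OF assms(1,2)] hermitianD[OF assms(3,4)] assms
  by (subst hermitian_iff[of _ n]) auto

lemma hermitian_minus:
  assumes "hermitian X" "X \<in> carrier_mat n n" "hermitian Y" "Y \<in> carrier_mat n n"
  shows "hermitian (X - Y)"
  using hermitianD[OF assms(1,2)] hermitianD[OF assms(3,4)] assms
  by (subst hermitian_iff[of _ n]) (auto simp: minus_mat_def)

lemma hermitian_smult:
  assumes "hermitian X" "X \<in> carrier_mat n n"
  shows "hermitian (complex_of_real c \<cdot>\<^sub>m X)"
  using hermitianD[OF assms(1,2)] assms
  by (subst hermitian_iff[of _ n]) auto

lemma psd_minus_hermitian:
  assumes "psd n X" "psd n Y"
  shows "hermitian (X - Y)"
  using assms by (intro hermitian_minus[of _ n]) (auto intro: psd_hermitian psd_carrier)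

lemma mat_trace_add:
  "X \<in> carrier_mat n n \<Longrightarrow> Y \<in> carrier_mat n n \<Longrightarrow> mat_trace (X + Y) = mat_trace X + mat_trace Y"
  by (simp add: mat_trace_def sum.distrib)

lemma mat_trace_smult: "X \<in> carrier_mat n n \<Longrightarrow> mat_trace (c \<cdot>\<^sub>m X) = c * mat_trace X"
  by (simp add: mat_trace_def sum_distrib_left)

section \<open>Functional calculus in a fixed eigenbasis\<close>

lemma orthonormal_combination_inner:
  assumes "orthonormal_family n k u"
  shows "(\<Sum>a<n. (\<Sum>i<k. f i * u i a) * cnj (\<Sum>i<k. g i * u i a)) = (\<Sum>i<k. f i * cnj (g i))"
proof -
  have "(\<Sum>a<n. (\<Sum>i<k. f i * u i a) * cnj (\<Sum>i<k. g i * u i a)) =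
    (\<Sum>a<n. \<Sum>i<k. \<Sum>j<k. f i * cnj (g j) * (cnj (u j a) * u i a))"
    by (simp add: sum_product mult_ac)
  also have "\<dots> = (\<Sum>i<k. \<Sum>a<n. \<Sum>j<k. f i * cnj (g j) * (cnj (u j a) * u i a))"
    by (rule sum.swap)
  also have "\<dots> = (\<Sum>i<k. \<Sum>j<k. \<Sum>a<n. f i * cnj (g j) * (cnj (u j a) * u i a))"
    by (intro sum.cong refl sum.swap)
  also have "\<dots> = (\<Sum>i<k. \<Sum>j<k. if j = i then f i * cnj (g i) else 0)"
    using assms by (intro sum.cong refl) (auto simp: orthonormal_family_def simp flip: sum_distrib_left)
  finally show ?thesis by simp
qed

lemma spectral_decompositionD:
  assumes "spectral_decomposition n H u l"
  shows "orthonormal_family n n u"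
    and "a < n \<Longrightarrow> b < n \<Longrightarrow> (\<Sum>i<n. u i a * cnj (u i b)) = (if a = b then 1 else 0)"
    and "a < n \<Longrightarrow> b < n \<Longrightarrow> H $$ (a, b) = (\<Sum>i<n. complex_of_real (l i) * u i a * cnj (u i b))"
  using assms by (auto simp: spectral_decomposition_def)

lemma spectral_decomposition_hermitian:
  assumes "spectral_decomposition n H u l" "H \<in> carrier_mat n n"
  shows "hermitian H"
  using spectral_decompositionD(3)[OF assms(1)] by (auto simp: hermitian_iff[OF assms(2)] mult_ac)

text \<open>Since \<open>f\<close> depends on the index and not on the eigenvalue, repeated
  eigenvalues raise no question of well-definedness.\<close>

lemma spectral_decomposition_exists_fun:
  assumes "spectral_decomposition n H u l"
  obtains X where "X \<in> carrier_mat n n" "spectral_decomposition n X u f"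
proof
  let ?X = "mat n n (\<lambda>(a, b). \<Sum>i<n. complex_of_real (f i) * u i a * cnj (u i b))"
  show "?X \<in> carrier_mat n n" by simp
  show "spectral_decomposition n ?X u f" using assms by (simp add: spectral_decomposition_def)
qed

text \<open>Reduces matrix identities between functions of one Hermitian matrix to scalar identities
  between eigenvalues.\<close>

lemma spectral_decomposition_eqI:
  assumes "spectral_decomposition n X u f" "spectral_decomposition n Y u g"
    and "X \<in> carrier_mat n n" "Y \<in> carrier_mat n n" "\<And>i. i < n \<Longrightarrow> f i = g i"
  shows "X = Y"
  using assms spectral_decompositionD(3)[OF assms(1)] spectral_decompositionD(3)[OF assms(2)]
  by (intro eq_matI) auto

lemma spectral_decomposition_mult:
  assumes "spectral_decomposition n X u f" "spectral_decomposition n Y u g"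
    and "X \<in> carrier_mat n n" "Y \<in> carrier_mat n n"
  shows "spectral_decomposition n (X * Y) u (\<lambda>i. f i * g i)"
proof -
  have "(X * Y) $$ (a, b) = (\<Sum>i<n. complex_of_real (f i * g i) * u i a * cnj (u i b))"
    if ab: "a < n" "b < n" for a b
  proof -
    \<comment> \<open>Column \<open>b\<close> of \<open>Y\<close> and the conjugate of row
      \<open>a\<close> of \<open>X\<close> are combinations of the same orthonormal family, so their
      inner product collapses to a single sum.\<close>
    have "(X * Y) $$ (a, b) = (\<Sum>c<n. (\<Sum>i<n. complex_of_real (g i) * cnj (u i b) * u i c) *
        cnj (\<Sum>i<n. complex_of_real (f i) * cnj (u i a) * u i c))"
      unfolding mult_mat_index[OF assms(3,4) ab]
      using spectral_decompositionD(3)[OF assms(1)] spectral_decompositionD(3)[OF assms(2)] ab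
      by (intro sum.cong refl) (simp add: mult_ac)
    also have "\<dots> = (\<Sum>i<n. complex_of_real (f i * g i) * u i a * cnj (u i b))"
      unfolding orthonormal_combination_inner[OF spectral_decompositionD(1)[OF assms(1)]]
      by (simp add: mult_ac)
    finally show ?thesis .
  qed
  then show ?thesis using assms(1) by (auto simp: spectral_decomposition_def)
qed

lemma spectral_decomposition_minus:
  assumes "spectral_decomposition n X u f" "spectral_decomposition n Y u g"
    and "X \<in> carrier_mat n n" "Y \<in> carrier_mat n n"
  shows "spectral_decomposition n (X - Y) u (\<lambda>i. f i - g i)"
  using assms by (auto simp: spectral_decomposition_def algebra_simps sum_subtractf)

lemma spectral_decomposition_smult:
  assumes "spectral_decomposition n X u f" "X \<in> carrier_mat n n"
  shows "spectral_decomposition n (complex_of_real c \<cdot>\<^sub>m X) u (\<lambda>i. c * f i)"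
  using assms by (auto simp: spectral_decomposition_def sum_distrib_left mult_ac)

lemma spectral_decomposition_one:
  assumes "spectral_decomposition n X u f"
  shows "spectral_decomposition n (1\<^sub>m n) u (\<lambda>i. 1)"
  using assms by (auto simp: spectral_decomposition_def)

lemma qform_spectral:
  assumes "spectral_decomposition n H u l"
  shows "qform n H v = complex_of_real (\<Sum>i<n. l i * (cmod (\<Sum>a<n. cnj (u i a) * v a))\<^sup>2)"
proof -
  have "qform n H v = (\<Sum>a<n. \<Sum>b<n. \<Sum>i<n. complex_of_real (l i) * (cnj (v a) * u i a) * (cnj (u i b) * v b))"
    unfolding qform_def using spectral_decompositionD(3)[OF assms]
    by (intro sum.cong refl) (simp add: sum_distrib_left sum_distrib_right mult_ac)
  also have "\<dots> = (\<Sum>a<n. \<Sum>i<n. \<Sum>b<n. complex_of_real (l i) * (cnj (v a) * u i a) * (cnj (u i b) * v b))"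
    by (intro sum.cong refl sum.swap)
  also have "\<dots> = (\<Sum>i<n. \<Sum>a<n. \<Sum>b<n. complex_of_real (l i) * (cnj (v a) * u i a) * (cnj (u i b) * v b))"
    by (rule sum.swap)
  also have "\<dots> = (\<Sum>i<n. complex_of_real (l i) * ((\<Sum>a<n. cnj (u i a) * v a) * cnj (\<Sum>a<n. cnj (u i a) * v a)))"
  proof (intro sum.cong refl)
    fix i
    have "(\<Sum>a<n. cnj (u i a) * v a) * cnj (\<Sum>a<n. cnj (u i a) * v a) =
      (\<Sum>b<n. \<Sum>a<n. (cnj (v a) * u i a) * (cnj (u i b) * v b))"
      by (simp add: sum_product mult_ac)
    also have "\<dots> = (\<Sum>a<n. \<Sum>b<n. (cnj (v a) * u i a) * (cnj (u i b) * v b))"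
      by (rule sum.swap)
    finally show "(\<Sum>a<n. \<Sum>b<n. complex_of_real (l i) * (cnj (v a) * u i a) * (cnj (u i b) * v b)) =
      complex_of_real (l i) * ((\<Sum>a<n. cnj (u i a) * v a) * cnj (\<Sum>a<n. cnj (u i a) * v a))"
      by (simp add: sum_distrib_left mult.assoc)
  qed
  finally show ?thesis by (simp only: of_real_sum of_real_mult complex_norm_square)
qed

lemma spectral_decomposition_psd:
  assumes "spectral_decomposition n H u l" "H \<in> carrier_mat n n" "\<And>i. i < n \<Longrightarrow> 0 \<le> l i"
  shows "psd n H"
proof (rule psdI[OF assms(2)])
  fix v
  have "0 \<le> (\<Sum>i<n. l i * (cmod (\<Sum>a<n. cnj (u i a) * v a))\<^sup>2)"
    using assms(3) by (intro sum_nonneg) simp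
  then show "0 \<le> qform n H v"
    unfolding qform_spectral[OF assms(1)] complex_nonneg_iff Re_complex_of_real Im_complex_of_real by simp
qed

lemma spectral_decomposition_eigenpair:
  assumes "spectral_decomposition n H u l" "j < n"
  shows "eigenpair n H (l j) (u j)"
  unfolding eigenpair_def
proof (intro allI impI)
  fix a assume a: "a < n"
  have "(\<Sum>b<n. H $$ (a, b) * u j b) =
    (\<Sum>b<n. \<Sum>i<n. complex_of_real (l i) * u i a * (cnj (u i b) * u j b))"
    using spectral_decompositionD(3)[OF assms(1) a]
    by (intro sum.cong refl) (simp add: sum_distrib_right mult.assoc)
  also have "\<dots> = (\<Sum>i<n. \<Sum>b<n. complex_of_real (l i) * u i a * (cnj (u i b) * u j b))"
    by (rule sum.swap)
  also have "\<dots> = (\<Sum>i<n. if i = j then complex_of_real (l j) * u j a else 0)"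
    using spectral_decompositionD(1)[OF assms(1)] assms(2)
    by (intro sum.cong refl) (auto simp: orthonormal_family_def simp flip: sum_distrib_left)
  finally show "(\<Sum>b<n. H $$ (a, b) * u j b) = complex_of_real (l j) * u j a"
    using assms(2) by simp
qed

lemma trace_orthonormal_basis:
  assumes "spectral_decomposition n H u l" "X \<in> carrier_mat n n"
  shows "mat_trace X = (\<Sum>i<n. qform n X (u i))"
proof -
  have "(\<Sum>i<n. qform n X (u i)) = (\<Sum>a<n. \<Sum>i<n. \<Sum>b<n. cnj (u i a) * X $$ (a, b) * u i b)"
    unfolding qform_def by (rule sum.swap)
  also have "\<dots> = (\<Sum>a<n. \<Sum>b<n. \<Sum>i<n. X $$ (a, b) * (u i b * cnj (u i a)))"
  proof (rule sum.cong[OF refl])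
    fix a
    show "(\<Sum>i<n. \<Sum>b<n. cnj (u i a) * X $$ (a, b) * u i b) =
      (\<Sum>b<n. \<Sum>i<n. X $$ (a, b) * (u i b * cnj (u i a)))"
      by (subst sum.swap) (simp add: mult_ac)
  qed
  also have "\<dots> = (\<Sum>a<n. \<Sum>b<n. if b = a then X $$ (a, a) else 0)"
    using spectral_decompositionD(2)[OF assms(1)]
    by (intro sum.cong refl) (auto simp flip: sum_distrib_left)
  finally show ?thesis by (simp add: mat_trace_sum[OF assms(2)])
qed

lemma mat_trace_spectral:
  assumes "spectral_decomposition n H u l" "H \<in> carrier_mat n n"
  shows "mat_trace H = complex_of_real (\<Sum>i<n. l i)"
proof -
  have "(\<Sum>a<n. u i a * cnj (u i a)) = 1" if "i < n" for i
    using spectral_decompositionD(1)[OF assms(1)] that by (simp add: orthonormal_family_def mult.commute)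
  then have "complex_of_real (\<Sum>i<n. l i) = (\<Sum>i<n. \<Sum>a<n. complex_of_real (l i) * (u i a * cnj (u i a)))"
    by (simp flip: sum_distrib_left)
  also have "\<dots> = (\<Sum>a<n. \<Sum>i<n. complex_of_real (l i) * (u i a * cnj (u i a)))" by (rule sum.swap)
  finally show ?thesis
    using spectral_decompositionD(3)[OF assms(1)] by (simp add: mat_trace_sum[OF assms(2)] mult.assoc)
qed

text \<open>An eigenvector \<open>v\<close> of \<open>S - T\<close> for a nonzero eigenvalue \<open>e\<close> satisfies
  \<open>e * (\<langle>v, S v\<rangle> + \<langle>v, T v\<rangle>) = \<langle>(S + T) v, (S - T) v\<rangle>\<close>, whose real part is
  \<open>\<langle>v, S S v\<rangle> - \<langle>v, T T v\<rangle> = 0\<close>.\<close>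

lemma psd_sqrt_unique:
  assumes "psd n S" "psd n T" "S * S = T * T"
  shows "S = T"
proof (rule ccontr)
  assume "S \<noteq> T"
  note cS = psd_carrier[OF assms(1)] and cT = psd_carrier[OF assms(2)]
  have K: "S - T \<in> carrier_mat n n" using cS cT by auto
  have "S - T \<noteq> 0\<^sub>m n n"
  proof
    assume z: "S - T = 0\<^sub>m n n"
    have "S $$ (i, j) = T $$ (i, j)" if "i < n" "j < n" for i j
      using arg_cong[OF z, of "\<lambda>M. M $$ (i, j)"] that cS cT by simp
    then have "S = T" using cS cT by (intro eq_matI) auto
    with \<open>S \<noteq> T\<close> show False by simp
  qed
  then obtain e where e: "e \<noteq> 0" "eigenvalue (S - T) e"
    using hermitian_nonzero_eigenvalue[OF psd_minus_hermitian[OF assms(1,2)] K] by blast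
  then obtain z where z: "z \<in> carrier_vec n" "z \<noteq> 0\<^sub>v n" "(S - T) *\<^sub>v z = e \<cdot>\<^sub>v z"
    using K by (auto simp: eigenvalue_def eigenvector_def)
  define v where "v = (\<lambda>a. z $ a)"
  define s where "s = (\<lambda>a. \<Sum>b<n. S $$ (a, b) * v b)"
  define t where "t = (\<lambda>a. \<Sum>b<n. T $$ (a, b) * v b)"
  have v0: "\<exists>a<n. v a \<noteq> 0" using z unfolding v_def by (metis carrier_vecD eq_vecI index_zero_vec)
  have Kv: "(\<Sum>b<n. (S - T) $$ (a, b) * v b) = e * v a" if "a < n" for a
    using mult_mat_vec_index[OF K z(1) that] that z(1) unfolding z(3) by (simp add: v_def)
  have st: "s a - t a = e * v a" if "a < n" for a
    using Kv[OF that] that cS cT by (simp add: s_def t_def algebra_simps sum_subtractf)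
  have er: "cnj e = e" by (rule hermitian_eigenvalue_real[OF psd_minus_hermitian[OF assms(1,2)] K v0 Kv])
  have q: "qform n X v = (\<Sum>a<n. cnj (v a) * (\<Sum>b<n. X $$ (a, b) * v b))" for X
    by (simp add: qform_def sum_distrib_left mult.assoc)
  have sq: "(\<Sum>a<n. cnj (\<Sum>b<n. X $$ (a, b) * v b) * (\<Sum>b<n. X $$ (a, b) * v b)) = qform n (X * X) v"
    if X: "psd n X" for X
  proof -
    note cX = psd_carrier[OF X]
    have "qform n (X * X) v = (\<Sum>a<n. cnj (v a) * (\<Sum>b<n. \<Sum>c<n. X $$ (a, c) * X $$ (c, b) * v b))"
      unfolding q by (intro sum.cong refl) (simp add: mult_mat_index[OF cX cX] sum_distrib_right del: index_mult_mat)
    also have "\<dots> = (\<Sum>a<n. cnj (v a) * (\<Sum>c<n. X $$ (a, c) * (\<Sum>b<n. X $$ (c, b) * v b)))"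
      by (subst sum.swap) (simp add: sum_distrib_left mult.assoc)
    also have "\<dots> = (\<Sum>a<n. cnj (\<Sum>b<n. X $$ (a, b) * v b) * (\<Sum>b<n. X $$ (a, b) * v b))"
      by (rule hermitian_inner[OF psd_hermitian[OF X] cX])
    finally show ?thesis by simp
  qed
  have "(\<Sum>a<n. cnj (s a) * s a) = (\<Sum>a<n. cnj (t a) * t a)"
    using sq[OF assms(1)] sq[OF assms(2)] assms(3) by (simp add: s_def t_def)
  then have "(\<Sum>a<n. cnj (s a + t a) * (s a - t a)) = (\<Sum>a<n. cnj (t a) * s a) - (\<Sum>a<n. cnj (s a) * t a)"
    by (simp add: algebra_simps sum.distrib sum_subtractf)
  also have "\<dots> = (\<Sum>a<n. cnj (t a) * s a) - cnj (\<Sum>a<n. cnj (t a) * s a)"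
    by (simp add: mult.commute)
  finally have 1: "Re (\<Sum>a<n. cnj (s a + t a) * (s a - t a)) = 0" by simp
  have 2: "(\<Sum>a<n. cnj (s a + t a) * (s a - t a)) = e * (qform n S v + qform n T v)"
  proof -
    have "(\<Sum>a<n. cnj (s a + t a) * (s a - t a)) =
      (\<Sum>a<n. e * (cnj (s a) * v a) + e * (cnj (t a) * v a))"
      using st by (intro sum.cong refl) (simp add: algebra_simps)
    also have "\<dots> = e * ((\<Sum>a<n. cnj (s a) * v a) + (\<Sum>a<n. cnj (t a) * v a))"
      by (simp add: sum.distrib sum_distrib_left distrib_left)
    also have "(\<Sum>a<n. cnj (s a) * v a) = qform n S v"
      unfolding q s_def by (rule hermitian_inner[OF psd_hermitian[OF assms(1)] cS, symmetric])
    also have "(\<Sum>a<n. cnj (t a) * v a) = qform n T v"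
      unfolding q t_def by (rule hermitian_inner[OF psd_hermitian[OF assms(2)] cT, symmetric])
    finally show ?thesis .
  qed
  have "Re e \<noteq> 0" "Im e = 0" using e er by (auto simp: complex_eq_iff)
  then have "Re (qform n S v + qform n T v) = 0" using 1 unfolding 2 by simp
  moreover have "0 \<le> qform n S v" "0 \<le> qform n T v" using assms psd_qform by auto
  ultimately have "qform n S v = 0" "qform n T v = 0"
    by (auto simp: complex_nonneg_iff complex_eq_iff)
  then have "qform n (S - T) v = 0" by (simp add: qform_minus[OF cS cT])
  moreover have "qform n (S - T) v = e * (\<Sum>a<n. cnj (v a) * v a)"
    unfolding q using Kv by (simp add: sum_distrib_left mult_ac del: index_minus_mat)
  ultimately have "(\<Sum>a<n. cnj (v a) * v a) = 0" using e(1) by simp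
  then show False using inner_self_eq_0[of v n] v0 by blast
qed

section \<open>The trace norm of Hermitian matrices\<close>

text \<open>The matrix with eigenvalues \<open>\<bar>l i\<bar>\<close> in the same basis is a
  positive root of \<open>H * H\<close>, and \<open>psd_sqrt_unique\<close> makes it the value of
  the \<open>THE\<close> in \<open>psd_sqrt\<close>. This is the passage from the definition of the
  trace norm to eigenvalues.\<close>

theorem trace_norm_spectral:
  assumes "spectral_decomposition n H u l" "H \<in> carrier_mat n n"
  shows "trace_norm H = (\<Sum>i<n. \<bar>l i\<bar>)"
proof -
  have h: "mat_adjoint H = H"
    using spectral_decomposition_hermitian[OF assms] by (simp add: hermitian_def)
  obtain R where R: "R \<in> carrier_mat n n" "spectral_decomposition n R u (\<lambda>i. \<bar>l i\<bar>)"
    by (rule spectral_decomposition_exists_fun[OF assms(1)])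
  have psd: "psd n R" by (rule spectral_decomposition_psd[OF R(2,1)]) simp
  have "R * R = H * H"
    by (rule spectral_decomposition_eqI[OF spectral_decomposition_mult[OF R(2,2,1,1)]
          spectral_decomposition_mult[OF assms(1,1,2,2)]]) (use R assms in auto)
  then have "psd_sqrt (H * H) = R"
    unfolding psd_sqrt_def using psd assms(2)
    by (intro the_equality) (simp, metis carrier_matD(1) index_mult_mat(2) psd_sqrt_unique)
  then show ?thesis
    unfolding trace_norm_def h using mat_trace_spectral[OF R(2,1)] by simp
qed

text \<open>Positive and negative eigenvalues are separated; at each index the two parts add up to
  \<open>\<bar>l i\<bar>\<close>.\<close>

lemma jordan_decomposition:
  assumes "hermitian H" "H \<in> carrier_mat n n"
  obtains P N where "psd n P" "psd n N" "H = P - N"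
    "Re (mat_trace P) + Re (mat_trace N) = trace_norm H"
proof -
  obtain u l where u: "spectral_decomposition n H u l" using spectral_theorem[OF assms] by blast
  obtain P where P: "P \<in> carrier_mat n n" "spectral_decomposition n P u (\<lambda>i. max (l i) 0)"
    by (rule spectral_decomposition_exists_fun[OF u])
  obtain N where N: "N \<in> carrier_mat n n" "spectral_decomposition n N u (\<lambda>i. max (- l i) 0)"
    by (rule spectral_decomposition_exists_fun[OF u])
  show thesis
  proof
    show "psd n P" "psd n N" 
      using spectral_decomposition_psd[OF P(2,1)] spectral_decomposition_psd[OF N(2,1)] by auto
    show "H = P - N"
      by (rule spectral_decomposition_eqI[OF u spectral_decomposition_minus[OF P(2) N(2) P(1) N(1)]])
        (use assms P N in auto)
    show "Re (mat_trace P) + Re (mat_trace N) = trace_norm H"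
      unfolding mat_trace_spectral[OF P(2,1)] mat_trace_spectral[OF N(2,1)]
        trace_norm_spectral[OF u assms(2)] Re_complex_of_real sum.distrib[symmetric]
      by (intro sum.cong) auto
  qed
qed

text \<open>In an eigenbasis of \<open>P - N\<close> each eigenvalue is a difference of two
  nonnegative diagonal values, one of \<open>P\<close> and one of \<open>N\<close>, and is at most
  their sum in modulus. Traces may be computed in this basis.\<close>

lemma trace_norm_le:
  assumes "psd n P" "psd n N"
  shows "trace_norm (P - N) \<le> Re (mat_trace P) + Re (mat_trace N)"
proof -
  note c = psd_carrier[OF assms(1)] psd_carrier[OF assms(2)]
  have c': "P - N \<in> carrier_mat n n" using c by auto
  obtain u l where u: "spectral_decomposition n (P - N) u l"
    using spectral_theorem[OF psd_minus_hermitian[OF assms] c'] by blast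
  have "\<bar>l i\<bar> \<le> Re (qform n P (u i)) + Re (qform n N (u i))" if "i < n" for i
  proof -
    have "qform n (P - N) (u i) = (\<Sum>a<n. cnj (u i a) * (\<Sum>b<n. (P - N) $$ (a, b) * u i b))"
      by (simp add: qform_def sum_distrib_left mult.assoc)
    also have "\<dots> = complex_of_real (l i) * (\<Sum>a<n. cnj (u i a) * u i a)"
      using spectral_decomposition_eigenpair[OF u that]
      by (simp add: eigenpair_def sum_distrib_left mult_ac del: index_minus_mat)
    also have "(\<Sum>a<n. cnj (u i a) * u i a) = 1"
      using spectral_decompositionD(1)[OF u] that by (simp add: orthonormal_family_def)
    finally have "l i = Re (qform n P (u i)) - Re (qform n N (u i))"
      unfolding qform_minus[OF c] by (simp add: complex_eq_iff)
    then show ?thesis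
      using psd_qform[OF assms(1), of "u i"] psd_qform[OF assms(2), of "u i"]
      by (auto simp: complex_nonneg_iff)
  qed
  then have "(\<Sum>i<n. \<bar>l i\<bar>) \<le> (\<Sum>i<n. Re (qform n P (u i)) + Re (qform n N (u i)))"
    by (intro sum_mono) auto
  then show ?thesis
    unfolding trace_norm_spectral[OF u c'] trace_orthonormal_basis[OF u c(1)] trace_orthonormal_basis[OF u c(2)]
    by (simp add: sum.distrib)
qed

lemma trace_norm_nonneg:
  assumes "hermitian H" "H \<in> carrier_mat n n"
  shows "0 \<le> trace_norm H"
  by (rule spectral_theorem[OF assms]) (simp add: trace_norm_spectral[OF _ assms(2)] sum_nonneg)

lemma trace_norm_smult:
  assumes "hermitian H" "H \<in> carrier_mat n n"
  shows "trace_norm (complex_of_real c \<cdot>\<^sub>m H) = \<bar>c\<bar> * trace_norm H"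
proof -
  obtain u l where u: "spectral_decomposition n H u l" using spectral_theorem[OF assms] by blast
  show ?thesis
    unfolding trace_norm_spectral[OF u assms(2)]
      trace_norm_spectral[OF spectral_decomposition_smult[OF u assms(2)] smult_carrier_mat[OF assms(2)]]
    by (simp add: abs_mult sum_distrib_left)
qed

text \<open>Adding the Jordan parts of \<open>X\<close> and \<open>Y\<close> gives a decomposition
  of \<open>X + Y\<close>, which need not be its Jordan decomposition.\<close>

lemma trace_norm_add:
  assumes "hermitian X" "X \<in> carrier_mat n n" "hermitian Y" "Y \<in> carrier_mat n n"
  shows "trace_norm (X + Y) \<le> trace_norm X + trace_norm Y"
proof -
  obtain P N where P: "psd n P" "psd n N" "X = P - N" "Re (mat_trace P) + Re (mat_trace N) = trace_norm X"
    using jordan_decomposition[OF assms(1,2)] by blast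
  obtain P' N' where P': "psd n P'" "psd n N'" "Y = P' - N'" "Re (mat_trace P') + Re (mat_trace N') = trace_norm Y"
    using jordan_decomposition[OF assms(3,4)] by blast
  note c = P(1,2)[THEN psd_carrier] P'(1,2)[THEN psd_carrier]
  have "X + Y = (P + P') - (N + N')" unfolding P(3) P'(3) using c by (intro eq_matI) auto
  then show ?thesis
    using trace_norm_le[OF psd_add[OF P(1) P'(1)] psd_add[OF P(2) P'(2)]] P(4) P'(4) c
    by (simp add: mat_trace_add[of _ n])
qed

lemma trace_norm_eq_0_imp:
  assumes "hermitian H" "H \<in> carrier_mat n n" "trace_norm H = 0"
  shows "H = 0\<^sub>m n n"
proof -
  obtain u l where u: "spectral_decomposition n H u l" using spectral_theorem[OF assms(1,2)] by blast
  have "\<forall>i<n. l i = 0"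
    using assms(3) unfolding trace_norm_spectral[OF u assms(2)] by (simp add: sum_nonneg_eq_0_iff)
  then show ?thesis using spectral_decompositionD(3)[OF u] assms(2) by (intro eq_matI) auto
qed

text \<open>Diagonal entries of the Jordan parts are nonnegative, so the triangle inequality at each
  entry suffices. It serves to bound the diamond distance of the measuring channels from
  below.\<close>

lemma sum_diag_le_trace_norm:
  assumes "hermitian H" "H \<in> carrier_mat n n"
  shows "(\<Sum>a<n. cmod (H $$ (a, a))) \<le> trace_norm H"
proof -
  obtain P N where P: "psd n P" "psd n N" "H = P - N" "Re (mat_trace P) + Re (mat_trace N) = trace_norm H"
    using jordan_decomposition[OF assms] by blast
  note c = P(1,2)[THEN psd_carrier]
  have "cmod (H $$ (a, a)) \<le> Re (P $$ (a, a)) + Re (N $$ (a, a))" if "a < n" for a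
  proof -
    have "cmod (H $$ (a, a)) \<le> cmod (P $$ (a, a)) + cmod (N $$ (a, a))"
      using that c unfolding P(3) by (simp add: norm_triangle_ineq4)
    then show ?thesis
      using psd_diag_nonneg[OF P(1) that] psd_diag_nonneg[OF P(2) that]
      by (simp add: complex_nonneg_iff cmod_eq_Re)
  qed
  then have "(\<Sum>a<n. cmod (H $$ (a, a))) \<le> (\<Sum>a<n. Re (P $$ (a, a)) + Re (N $$ (a, a)))"
    by (intro sum_mono) auto
  then show ?thesis
    using P(4) unfolding mat_trace_sum[OF c(1)] mat_trace_sum[OF c(2)] by (simp add: sum.distrib)
qed

section \<open>Comparison with the Hilbert-Schmidt norm, and the operator norm\<close>

lemma hs_inner_spectral:
  assumes "spectral_decomposition n H u l" "H \<in> carrier_mat n n"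
  shows "hs_inner H H = complex_of_real (\<Sum>i<n. (l i)\<^sup>2)"
proof -
  have "mat_adjoint H = H"
    using spectral_decomposition_hermitian[OF assms] by (simp add: hermitian_def)
  then show ?thesis
    using mat_trace_spectral[OF spectral_decomposition_mult[OF assms(1,1,2,2)]] assms(2)
    by (simp add: hs_inner_def power2_eq_square)
qed

lemma trace_norm_le_hs:
  assumes "hermitian H" "H \<in> carrier_mat n n" "hs_inner H H = 1"
  shows "trace_norm H \<le> sqrt n"
proof -
  obtain u l where u: "spectral_decomposition n H u l" using spectral_theorem[OF assms(1,2)] by blast
  have "(\<Sum>i<n. (l i)\<^sup>2) = 1"
    using hs_inner_spectral[OF u assms(2)] assms(3) by (metis of_real_eq_1_iff)
  \<comment> \<open>Cauchy-Schwarz against the constant vector, as an expanded square; 1 / sqrt n is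
    the common modulus in the case of equality.\<close>
  moreover have "0 \<le> (\<Sum>i<n. (\<bar>l i\<bar> - 1 / sqrt n)\<^sup>2)" by (intro sum_nonneg) simp
  moreover have "(\<Sum>i<n. (\<bar>l i\<bar> - 1 / sqrt n)\<^sup>2) =
      (\<Sum>i<n. (l i)\<^sup>2) - 2 / sqrt n * (\<Sum>i<n. \<bar>l i\<bar>) + real n * (1 / sqrt n)\<^sup>2"
    by (simp add: power2_diff sum.distrib sum_subtractf sum_distrib_left sum_divide_distrib mult_ac)
  moreover have "n \<noteq> 0" using \<open>(\<Sum>i<n. (l i)\<^sup>2) = 1\<close> by (intro notI) simp
  ultimately have "0 \<le> 1 - 2 / sqrt n * (\<Sum>i<n. \<bar>l i\<bar>) + 1" by (simp add: power_divide)
  then show ?thesis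
    unfolding trace_norm_spectral[OF u assms(2)] using \<open>n \<noteq> 0\<close> by (simp add: field_simps)
qed

lemma operator_norm_attained:
  assumes "spectral_decomposition n H u l" "H \<in> carrier_mat n n" "0 < n"
  obtains j where "j < n" "operator_norm H = \<bar>l j\<bar>" "\<And>i. i < n \<Longrightarrow> \<bar>l i\<bar> \<le> \<bar>l j\<bar>"
proof -
  obtain j where j: "j < n" "\<And>i. i < n \<Longrightarrow> \<bar>l i\<bar> \<le> \<bar>l j\<bar>"
  proof -
    have f: "finite ((\<lambda>i. \<bar>l i\<bar>) ` {..<n})" "(\<lambda>i. \<bar>l i\<bar>) ` {..<n} \<noteq> {}" using assms(3) by auto
    then obtain j where "j < n" "\<bar>l j\<bar> = Max ((\<lambda>i. \<bar>l i\<bar>) ` {..<n})" using Max_in[OF f] by force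
    then show thesis using that Max_ge[OF f(1)] by (metis imageI lessThan_iff)
  qed
  define U where "U = {v \<in> carrier_vec n. v \<bullet>c v = (1 :: complex)}"
  \<comment> \<open>Squared coefficients in the eigenbasis. For a unit vector they are weights of
    sum 1, so the squared length of \<open>H v\<close> is an average of the
    \<open>(l i)\<^sup>2\<close>.\<close>
  define c where "c = (\<lambda>v i. (cmod (\<Sum>a<n. cnj (u i a) * v $ a))\<^sup>2)"
  have h: "mat_adjoint H = H"
    using spectral_decomposition_hermitian[OF assms(1,2)] by (simp add: hermitian_def)
  have val: "(H *\<^sub>v v) \<bullet>c (H *\<^sub>v v) = complex_of_real (\<Sum>i<n. (l i)\<^sup>2 * c v i)"
    and one: "v \<bullet>c v = complex_of_real (\<Sum>i<n. c v i)" if v: "v \<in> carrier_vec n" for v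
  proof -
    have Hv: "(H *\<^sub>v v) $ a = (\<Sum>i<n. complex_of_real (l i) * (\<Sum>b<n. cnj (u i b) * v $ b) * u i a)"
      if a: "a < n" for a
    proof -
      have "(H *\<^sub>v v) $ a = (\<Sum>b<n. \<Sum>i<n. complex_of_real (l i) * (cnj (u i b) * v $ b) * u i a)"
        unfolding mult_mat_vec_index[OF assms(2) v a]
        using spectral_decompositionD(3)[OF assms(1) a]
        by (intro sum.cong refl) (simp add: sum_distrib_left sum_distrib_right mult_ac)
      then show ?thesis by (subst (asm) sum.swap) (simp add: sum_distrib_left sum_distrib_right)
    qed
    have "(H *\<^sub>v v) \<bullet>c (H *\<^sub>v v) = (\<Sum>a<n. (H *\<^sub>v v) $ a * cnj ((H *\<^sub>v v) $ a))"
      using assms(2) by (intro cscalar_prod_sum) simp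
    also have "\<dots> = (\<Sum>i<n. complex_of_real (l i) * (\<Sum>b<n. cnj (u i b) * v $ b) *
        cnj (complex_of_real (l i) * (\<Sum>b<n. cnj (u i b) * v $ b)))"
      using Hv by (subst orthonormal_combination_inner[OF spectral_decompositionD(1)[OF assms(1)], symmetric])
        (simp del: index_mult_mat_vec)
    also have "\<dots> = (\<Sum>i<n. complex_of_real ((l i)\<^sup>2 * c v i))"
    proof (intro sum.cong refl)
      fix i
      show "complex_of_real (l i) * (\<Sum>b<n. cnj (u i b) * v $ b) *
        cnj (complex_of_real (l i) * (\<Sum>b<n. cnj (u i b) * v $ b)) = complex_of_real ((l i)\<^sup>2 * c v i)"
        unfolding c_def of_real_mult complex_norm_square by (simp add: power2_eq_square)
    qed
    finally show "(H *\<^sub>v v) \<bullet>c (H *\<^sub>v v) = complex_of_real (\<Sum>i<n. (l i)\<^sup>2 * c v i)" by simp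
    \<comment> \<open>Parseval's identity: the identity matrix is diagonal in the basis
      \<open>u\<close> with all eigenvalues 1.\<close>
    have "v \<bullet>c v = qform n (1\<^sub>m n) (\<lambda>a. v $ a)"
    proof -
      have "qform n (1\<^sub>m n) (\<lambda>a. v $ a) = (\<Sum>a<n. \<Sum>b<n. if b = a then cnj (v $ a) * v $ a else 0)"
        unfolding qform_def by (intro sum.cong refl) auto
      then show ?thesis using v by (simp add: cscalar_prod_sum[of v n] mult.commute)
    qed
    then show "v \<bullet>c v = complex_of_real (\<Sum>i<n. c v i)"
      unfolding qform_spectral[OF spectral_decomposition_one[OF assms(1)]] by (simp add: c_def)
  qed
  have le: "sqrt (Re ((H *\<^sub>v v) \<bullet>c (H *\<^sub>v v))) \<le> \<bar>l j\<bar>" if v: "v \<in> U" for v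
  proof -
    have v': "v \<in> carrier_vec n" "(\<Sum>i<n. c v i) = 1"
      using v one[of v] unfolding U_def by (auto, metis of_real_eq_1_iff)
    have "(\<Sum>i<n. (l i)\<^sup>2 * c v i) \<le> (\<Sum>i<n. (l j)\<^sup>2 * c v i)"
      using j(2) by (intro sum_mono mult_right_mono) (auto simp: c_def abs_le_square_iff)
    also have "\<dots> = (l j)\<^sup>2" using v'(2) by (simp flip: sum_distrib_left)
    finally show ?thesis unfolding val[OF v'(1)] Re_complex_of_real
      by (intro real_le_lsqrt) auto
  qed
  have w: "vec n (u j) \<in> U" and wv: "sqrt (Re ((H *\<^sub>v vec n (u j)) \<bullet>c (H *\<^sub>v vec n (u j)))) = \<bar>l j\<bar>"
  proof -
    have c1: "c (vec n (u j)) i = (if i = j then 1 else 0)" if "i < n" for i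
      using spectral_decompositionD(1)[OF assms(1)] j(1) that by (simp add: c_def orthonormal_family_def)
    show "vec n (u j) \<in> U" unfolding U_def using one[of "vec n (u j)"] c1 j(1) by simp
    have "(\<Sum>i<n. (l i)\<^sup>2 * c (vec n (u j)) i) = (\<Sum>i<n. if i = j then (l j)\<^sup>2 else 0)"
      using c1 by (intro sum.cong) auto
    then show "sqrt (Re ((H *\<^sub>v vec n (u j)) \<bullet>c (H *\<^sub>v vec n (u j)))) = \<bar>l j\<bar>"
      using val[of "vec n (u j)"] j(1) by simp
  qed
  have "operator_norm H = (SUP v\<in>U. sqrt (Re ((H *\<^sub>v v) \<bullet>c (H *\<^sub>v v))))"
    using assms(2) by (simp add: operator_norm_def U_def)
  also have "\<dots> = \<bar>l j\<bar>"
    using le w wv by (intro cSup_eq_maximum) (force intro: image_eqI)+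
  finally show thesis using that j by blast
qed

section \<open>Tensor products and partial traces\<close>

lemma prod_index_less: "a < m \<Longrightarrow> p < k \<Longrightarrow> a * k + p < m * (k::nat)"
proof -
  assume "a < m" "p < k"
  then have "a * k + p < Suc a * k" by simp
  also have "\<dots> \<le> m * k" using \<open>a < m\<close> by (intro mult_le_mono1) simp
  finally show ?thesis .
qed

lemma sum_prod_index: "(\<Sum>i<m * k. f i) = (\<Sum>a<m. \<Sum>p<k. f (a * k + p))" for k :: nat
proof (induction m)
  case (Suc m)
  have "(\<Sum>i<Suc m * k. f i) = (\<Sum>i<m * k. f i) + (\<Sum>i\<in>{m * k..<m * k + k}. f i)"
    by (simp add: lessThan_atLeast0 sum.atLeastLessThan_concat add.commute)
  also have "(\<Sum>i\<in>{m * k..<m * k + k}. f i) = (\<Sum>p<k. f (m * k + p))"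
    using sum.shift_bounds_nat_ivl[of f 0 "m * k" k] by (simp add: lessThan_atLeast0 add.commute)
  finally show ?case by (simp add: Suc)
qed simp

text \<open>A single sum is moved past a double one by the same rule, after adding a dummy inner sum
  over \<open>{()}\<close>.\<close>

lemma sum_swap_pairs: "(\<Sum>p\<in>P. \<Sum>q\<in>Q. \<Sum>a\<in>A. \<Sum>b\<in>B. f p q a b) = (\<Sum>a\<in>A. \<Sum>b\<in>B. \<Sum>p\<in>P. \<Sum>q\<in>Q. f p q a b)"
proof -
  have "(\<Sum>p\<in>P. \<Sum>q\<in>Q. \<Sum>a\<in>A. \<Sum>b\<in>B. f p q a b) = (\<Sum>p\<in>P. \<Sum>a\<in>A. \<Sum>q\<in>Q. \<Sum>b\<in>B. f p q a b)"
    by (intro sum.cong[OF refl] sum.swap)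
  also have "\<dots> = (\<Sum>a\<in>A. \<Sum>p\<in>P. \<Sum>q\<in>Q. \<Sum>b\<in>B. f p q a b)" by (rule sum.swap)
  also have "\<dots> = (\<Sum>a\<in>A. \<Sum>p\<in>P. \<Sum>b\<in>B. \<Sum>q\<in>Q. f p q a b)" by (rule sum.cong[OF refl], rule sum.cong[OF refl], rule sum.swap)
  also have "\<dots> = (\<Sum>a\<in>A. \<Sum>b\<in>B. \<Sum>p\<in>P. \<Sum>q\<in>Q. f p q a b)" by (rule sum.cong[OF refl], rule sum.swap)
  finally show ?thesis .
qed

lemma sum_sandwich:
  fixes c :: complex
  shows "(\<Sum>p\<in>P. \<Sum>q\<in>Q. x p * c * y q) = (\<Sum>p\<in>P. x p) * c * (\<Sum>q\<in>Q. y q)"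
  by (subst sum_distrib_right, subst sum_product, rule refl)

lemma prod_index_cases:
  assumes "i < m * (k::nat)"
  obtains a p where "a < m" "p < k" "i = a * k + p"
proof
  have "0 < k" using assms by (intro gr0I) auto
  then show "i div k < m" "i mod k < k" using assms by (auto simp: less_mult_imp_div_less)
qed simp

lemma eq_mat_prodI:
  assumes "X \<in> carrier_mat (m * k) (m * k)" "Y \<in> carrier_mat (m * k) (m * k)"
    and "\<And>a p b q. a < m \<Longrightarrow> p < k \<Longrightarrow> b < m \<Longrightarrow> q < k \<Longrightarrow>
      X $$ (a * k + p, b * k + q) = Y $$ (a * k + p, b * k + q)"
  shows "X = Y"
proof (rule eq_matI)
  fix i j assume "i < dim_row Y" "j < dim_col Y"
  then have "i < m * k" "j < m * k" using assms(2) by auto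
  then show "X $$ (i, j) = Y $$ (i, j)" using assms(3) by (metis prod_index_cases)
qed (use assms in auto)

lemma mat_trace_prod_index:
  "X \<in> carrier_mat (m * k) (m * k) \<Longrightarrow> mat_trace X = (\<Sum>a<m. \<Sum>p<k. X $$ (a * k + p, a * k + p))"
  by (simp add: mat_trace_sum[of _ "m * k"] sum_prod_index)

lemma qform_prod_index:
  "qform (m * k) Z w = (\<Sum>a<m. \<Sum>b<m. \<Sum>p<k. \<Sum>q<k.
     cnj (w (a * k + p)) * Z $$ (a * k + p, b * k + q) * w (b * k + q))"
  unfolding qform_def sum_prod_index by (intro sum.cong[OF refl] sum.swap)

lemma tensor_carrier [simp]:
  "X \<in> carrier_mat m m \<Longrightarrow> Y \<in> carrier_mat k k \<Longrightarrow> tensor X Y \<in> carrier_mat (m * k) (m * k)"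
  by (simp add: tensor_def)

lemma tensor_index:
  assumes "X \<in> carrier_mat m m" "Y \<in> carrier_mat k k" "a < m" "b < m" "p < k" "q < k"
  shows "tensor X Y $$ (a * k + p, b * k + q) = X $$ (a, b) * Y $$ (p, q)"
  using assms by (simp add: tensor_def prod_index_less)

lemma mat_trace_tensor:
  assumes "X \<in> carrier_mat m m" "Y \<in> carrier_mat k k"
  shows "mat_trace (tensor X Y) = mat_trace X * mat_trace Y"
  using assms
  by (simp add: mat_trace_prod_index[OF tensor_carrier[OF assms]] mat_trace_sum tensor_index sum_product)

lemma hermitian_tensor:
  assumes "X \<in> carrier_mat m m" "Y \<in> carrier_mat k k" "hermitian X" "hermitian Y"
  shows "hermitian (tensor X Y)"
  unfolding hermitian_iff[OF tensor_carrier[OF assms(1,2)]]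
proof (intro allI impI)
  fix i j assume "i < m * k" "j < m * k"
  then obtain a p b q where "a < m" "p < k" "i = a * k + p" "b < m" "q < k" "j = b * k + q"
    by (metis prod_index_cases)
  then show "cnj (tensor X Y $$ (j, i)) = tensor X Y $$ (i, j)"
    using hermitianD[OF assms(3,1)] hermitianD[OF assms(4,2)] by (simp add: tensor_index[OF assms(1,2)])
qed

text \<open>The common core of the positivity of tensor products and of partial traces: the form \<open>G\<close> is
  paired with the spectral decomposition of \<open>Q\<close>.\<close>

lemma psd_pairing_nonneg:
  assumes "psd k Q" "\<And>u. 0 \<le> (\<Sum>p<k. \<Sum>q<k. u p * cnj (u q) * G p q)"
  shows "0 \<le> (\<Sum>p<k. \<Sum>q<k. Q $$ (p, q) * G p q)"
proof -
  obtain u l where u: "spectral_decomposition k Q u l"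
    using spectral_theorem[OF psd_hermitian[OF assms(1)] psd_carrier[OF assms(1)]] by blast
  have "0 \<le> l i" if "i < k" for i
  proof -
    have "qform k Q (u i) = complex_of_real (\<Sum>j<k. if j = i then l i else 0)"
      unfolding qform_spectral[OF u] using spectral_decompositionD(1)[OF u] that
      by (intro arg_cong[of _ _ complex_of_real] sum.cong) (auto simp: orthonormal_family_def)
    then show ?thesis using psd_qform[OF assms(1), of "u i"] that by (simp add: complex_nonneg_iff)
  qed
  then have "0 \<le> complex_of_real (l i) * (\<Sum>p<k. \<Sum>q<k. u i p * cnj (u i q) * G p q)" if "i < k" for i
    using assms(2)[of "u i"] that by (intro mult_nonneg_nonneg) (auto simp: complex_nonneg_iff)
  then have "0 \<le> (\<Sum>i<k. complex_of_real (l i) * (\<Sum>p<k. \<Sum>q<k. u i p * cnj (u i q) * G p q))"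
    by (intro sum_nonneg) auto
  also have "\<dots> = (\<Sum>i<k. \<Sum>j\<in>{()}. \<Sum>p<k. \<Sum>q<k. complex_of_real (l i) * u i p * cnj (u i q) * G p q)"
    by (simp add: sum_distrib_left mult.assoc)
  also have "\<dots> = (\<Sum>p<k. \<Sum>q<k. \<Sum>i<k. complex_of_real (l i) * u i p * cnj (u i q) * G p q)"
    by (subst sum_swap_pairs) simp
  also have "\<dots> = (\<Sum>p<k. \<Sum>q<k. Q $$ (p, q) * G p q)"
    using spectral_decompositionD(3)[OF u] by (intro sum.cong refl) (simp add: sum_distrib_right)
  finally show ?thesis .
qed

text \<open>For \<open>Q\<close> the projector on a vector \<open>u\<close>, the form of the tensor
  product at \<open>w\<close> is the form of \<open>P\<close> at the contraction of \<open>w\<close>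
  with \<open>u\<close>; \<open>psd_pairing_nonneg\<close> extends this to all
  \<open>Q\<close>.\<close>

lemma psd_tensor:
  assumes "psd m P" "psd k Q"
  shows "psd (m * k) (tensor P Q)"
proof (rule psdI)
  note c = psd_carrier[OF assms(1)] psd_carrier[OF assms(2)]
  show "tensor P Q \<in> carrier_mat (m * k) (m * k)" using c by simp
  fix w
  define G where "G = (\<lambda>p q. \<Sum>a<m. \<Sum>b<m. cnj (w (a * k + p)) * P $$ (a, b) * w (b * k + q))"
  have "qform (m * k) (tensor P Q) w = (\<Sum>a<m. \<Sum>b<m. \<Sum>p<k. \<Sum>q<k.
      Q $$ (p, q) * (cnj (w (a * k + p)) * P $$ (a, b) * w (b * k + q)))"
    unfolding qform_prod_index by (intro sum.cong refl) (simp add: tensor_index[OF c])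
  also have "\<dots> = (\<Sum>p<k. \<Sum>q<k. Q $$ (p, q) * G p q)"
    by (subst sum_swap_pairs) (simp add: G_def sum_distrib_left)
  also have "0 \<le> \<dots>"
  proof (rule psd_pairing_nonneg[OF assms(2)])
    fix u
    have "(\<Sum>p<k. \<Sum>q<k. u p * cnj (u q) * G p q) = (\<Sum>p<k. \<Sum>q<k. \<Sum>a<m. \<Sum>b<m.
        (u p * cnj (w (a * k + p))) * P $$ (a, b) * (cnj (u q) * w (b * k + q)))"
      by (simp add: G_def sum_distrib_left mult_ac)
    also have "\<dots> = (\<Sum>a<m. \<Sum>b<m. \<Sum>p<k. \<Sum>q<k.
        (u p * cnj (w (a * k + p))) * P $$ (a, b) * (cnj (u q) * w (b * k + q)))"
      by (rule sum_swap_pairs)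
    also have "\<dots> = qform m P (\<lambda>a. \<Sum>p<k. cnj (u p) * w (a * k + p))"
      unfolding qform_def sum_sandwich by simp
    finally show "0 \<le> (\<Sum>p<k. \<Sum>q<k. u p * cnj (u q) * G p q)" using psd_qform[OF assms(1)] by simp
  qed
  finally show "0 \<le> qform (m * k) (tensor P Q) w" .
qed

lemma trace_norm_tensor_le:
  assumes "hermitian X" "X \<in> carrier_mat m m" "hermitian Y" "Y \<in> carrier_mat k k"
  shows "trace_norm (tensor X Y) \<le> trace_norm X * trace_norm Y"
proof -
  obtain P N where P: "psd m P" "psd m N" "X = P - N" "Re (mat_trace P) + Re (mat_trace N) = trace_norm X"
    using jordan_decomposition[OF assms(1,2)] by blast
  obtain P' N' where P': "psd k P'" "psd k N'" "Y = P' - N'" "Re (mat_trace P') + Re (mat_trace N') = trace_norm Y"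
    using jordan_decomposition[OF assms(3,4)] by blast
  note c = P(1,2)[THEN psd_carrier] P'(1,2)[THEN psd_carrier]
  \<comment> \<open>Traces of positive matrices are real, so the real part of a product of two
    traces is the product of the real parts.\<close>
  have im: "Im (mat_trace Z) = 0" if "psd d Z" for d Z
    using psd_diag_nonneg[OF that] by (simp add: mat_trace_sum[OF psd_carrier[OF that]] complex_nonneg_iff)
  \<comment> \<open>Products of parts with equal signs form the positive part, mixed products the
    negative one; the four traces then factor into (Tr P + Tr N) (Tr P' + Tr N').\<close>
  have "tensor X Y = (tensor P P' + tensor N N') - (tensor P N' + tensor N P')"
  proof (rule eq_mat_prodI[of _ m k])
    show "tensor P P' + tensor N N' - (tensor P N' + tensor N P') \<in> carrier_mat (m * k) (m * k)"
      using c by (intro minus_carrier_mat add_carrier_mat tensor_carrier)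
  next
    fix a p b q assume i: "a < m" "p < k" "b < m" "q < k"
    then have "a * k + p < m * k" "b * k + q < m * k" by (auto intro: prod_index_less)
    then show "tensor X Y $$ (a * k + p, b * k + q) =
      (tensor P P' + tensor N N' - (tensor P N' + tensor N P')) $$ (a * k + p, b * k + q)"
      using i c assms(2,4) carrier_matD[OF tensor_carrier[OF c(1,3)]] carrier_matD[OF tensor_carrier[OF c(2,4)]]
        carrier_matD[OF tensor_carrier[OF c(1,4)]] carrier_matD[OF tensor_carrier[OF c(2,3)]]
      by (simp add: tensor_index[of _ m _ k]) (simp add: P(3) P'(3) algebra_simps)
  qed (use assms in auto)
  then have "trace_norm (tensor X Y) \<le>
      Re (mat_trace (tensor P P' + tensor N N')) + Re (mat_trace (tensor P N' + tensor N P'))"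
    using trace_norm_le[OF psd_add[OF psd_tensor[OF P(1) P'(1)] psd_tensor[OF P(2) P'(2)]]
        psd_add[OF psd_tensor[OF P(1) P'(2)] psd_tensor[OF P(2) P'(1)]]] by simp
  also have "\<dots> = trace_norm X * trace_norm Y"
    using c P(1,2) P'(1,2) unfolding P(4)[symmetric] P'(4)[symmetric]
    by (simp add: mat_trace_add[OF tensor_carrier[OF c(1,3)] tensor_carrier[OF c(2,4)]]
        mat_trace_add[OF tensor_carrier[OF c(1,4)] tensor_carrier[OF c(2,3)]]
        mat_trace_tensor[of _ m _ k] im algebra_simps)
  finally show ?thesis .
qed

section \<open>Weighted partial traces and contractions\<close>

text \<open>This is the trace over the first factor of \<open>tensor E 1 * Z\<close>; the product
  with \<open>E\<close> explains why \<open>a\<close> and \<open>b\<close> are exchanged in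
  \<open>Z\<close>. The mirror image below traces \<open>tensor 1 F * Z\<close> over the second
  factor.\<close>

definition ptrace_left :: "nat \<Rightarrow> nat \<Rightarrow> complex mat \<Rightarrow> complex mat \<Rightarrow> complex mat" where
  "ptrace_left m k E Z = mat k k (\<lambda>(p, q). \<Sum>a<m. \<Sum>b<m. E $$ (a, b) * Z $$ (b * k + p, a * k + q))"

definition ptrace_right :: "nat \<Rightarrow> nat \<Rightarrow> complex mat \<Rightarrow> complex mat \<Rightarrow> complex mat" where
  "ptrace_right n k F Z = mat n n (\<lambda>(a, b). \<Sum>p<k. \<Sum>q<k. F $$ (p, q) * Z $$ (a * k + q, b * k + p))"

lemma ptrace_carrier [simp]:
  "ptrace_left m k E Z \<in> carrier_mat k k" "ptrace_right n k F Z \<in> carrier_mat n n"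
  by (simp_all add: ptrace_left_def ptrace_right_def)

text \<open>By \<open>psd_pairing_nonneg\<close> it suffices to take for \<open>E\<close> the
  projector on a vector \<open>u\<close>; the form at \<open>v\<close> is then that of
  \<open>Z\<close> at the product vector of \<open>u\<close> and \<open>v\<close>.\<close>

lemma psd_ptrace_left:
  assumes "psd m E" "psd (m * k) Z"
  shows "psd k (ptrace_left m k E Z)"
proof (rule psdI)
  fix v
  define G where "G = (\<lambda>a b. \<Sum>p<k. \<Sum>q<k. cnj (v p) * Z $$ (b * k + p, a * k + q) * v q)"
  have "qform k (ptrace_left m k E Z) v = (\<Sum>p<k. \<Sum>q<k. \<Sum>a<m. \<Sum>b<m.
      E $$ (a, b) * (cnj (v p) * Z $$ (b * k + p, a * k + q) * v q))"
    unfolding qform_def ptrace_left_def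
    by (intro sum.cong refl) (simp add: sum_distrib_left sum_distrib_right mult_ac)
  also have "\<dots> = (\<Sum>a<m. \<Sum>b<m. E $$ (a, b) * G a b)"
    by (subst sum_swap_pairs) (simp add: G_def sum_distrib_left)
  also have "0 \<le> \<dots>"
  proof (rule psd_pairing_nonneg[OF assms(1)])
    fix u
    have "(\<Sum>a<m. \<Sum>b<m. u a * cnj (u b) * G a b) = (\<Sum>b<m. \<Sum>a<m. u a * cnj (u b) * G a b)"
      by (rule sum.swap)
    also have "\<dots> = qform (m * k) Z (\<lambda>i. u (i div k) * v (i mod k))"
      unfolding qform_prod_index by (intro sum.cong refl) (simp add: G_def sum_distrib_left mult_ac)
    finally show "0 \<le> (\<Sum>a<m. \<Sum>b<m. u a * cnj (u b) * G a b)" using psd_qform[OF assms(2)] by simp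
  qed
  finally show "0 \<le> qform k (ptrace_left m k E Z) v" .
qed simp

lemma psd_ptrace_right:
  assumes "psd k F" "psd (n * k) Z"
  shows "psd n (ptrace_right n k F Z)"
proof (rule psdI)
  fix v
  define G where "G = (\<lambda>p q. \<Sum>a<n. \<Sum>b<n. cnj (v a) * Z $$ (a * k + q, b * k + p) * v b)"
  have "qform n (ptrace_right n k F Z) v = (\<Sum>a<n. \<Sum>b<n. \<Sum>p<k. \<Sum>q<k.
      F $$ (p, q) * (cnj (v a) * Z $$ (a * k + q, b * k + p) * v b))"
    unfolding qform_def ptrace_right_def
    by (intro sum.cong refl) (simp add: sum_distrib_left sum_distrib_right mult_ac)
  also have "\<dots> = (\<Sum>p<k. \<Sum>q<k. F $$ (p, q) * G p q)"
    by (subst sum_swap_pairs) (simp add: G_def sum_distrib_left)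
  also have "0 \<le> \<dots>"
  proof (rule psd_pairing_nonneg[OF assms(1)])
    fix u
    have "(\<Sum>p<k. \<Sum>q<k. u p * cnj (u q) * G p q) = (\<Sum>q<k. \<Sum>p<k. u p * cnj (u q) * G p q)"
      by (rule sum.swap)
    also have "\<dots> = (\<Sum>q<k. \<Sum>p<k. \<Sum>a<n. \<Sum>b<n.
        cnj (v a * u q) * Z $$ (a * k + q, b * k + p) * (v b * u p))"
      by (simp add: G_def sum_distrib_left mult_ac)
    also have "\<dots> = (\<Sum>a<n. \<Sum>b<n. \<Sum>q<k. \<Sum>p<k.
        cnj (v a * u q) * Z $$ (a * k + q, b * k + p) * (v b * u p))"
      by (rule sum_swap_pairs)
    also have "\<dots> = qform (n * k) Z (\<lambda>i. v (i div k) * u (i mod k))"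
      unfolding qform_prod_index by (intro sum.cong refl) simp
    finally show "0 \<le> (\<Sum>p<k. \<Sum>q<k. u p * cnj (u q) * G p q)" using psd_qform[OF assms(2)] by simp
  qed
  finally show "0 \<le> qform n (ptrace_right n k F Z) v" .
qed simp

lemma mat_trace_ptrace_left:
  "mat_trace (ptrace_left m k E Z) = (\<Sum>a<m. \<Sum>b<m. E $$ (a, b) * (\<Sum>p<k. Z $$ (b * k + p, a * k + p)))"
proof -
  have "mat_trace (ptrace_left m k E Z) = (\<Sum>p<k. \<Sum>j\<in>{()}. \<Sum>a<m. \<Sum>b<m. E $$ (a, b) * Z $$ (b * k + p, a * k + p))"
    by (simp add: mat_trace_def ptrace_left_def)
  then show ?thesis by (subst (asm) sum_swap_pairs) (simp add: sum_distrib_left)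
qed

lemma mat_trace_ptrace_right:
  "mat_trace (ptrace_right n k F Z) = (\<Sum>p<k. \<Sum>q<k. F $$ (p, q) * (\<Sum>a<n. Z $$ (a * k + q, a * k + p)))"
proof -
  have "mat_trace (ptrace_right n k F Z) = (\<Sum>a<n. \<Sum>j\<in>{()}. \<Sum>p<k. \<Sum>q<k. F $$ (p, q) * Z $$ (a * k + q, a * k + p))"
    by (simp add: mat_trace_def ptrace_right_def)
  then show ?thesis by (subst (asm) sum_swap_pairs) (simp add: sum_distrib_left)
qed

text \<open>For Hermitian \<open>F\<close> this says that the operator norm is at most \<open>1\<close>: take \<open>(1 \<plusminus> F) / 2\<close>.\<close>

definition contraction :: "nat \<Rightarrow> complex mat \<Rightarrow> bool" where
  "contraction k F \<longleftrightarrow> (\<exists>E E'. psd k E \<and> psd k E' \<and> E + E' = 1\<^sub>m k \<and> F = E - E')"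

lemma contractionE:
  assumes "contraction k F"
  obtains E E' where "psd k E" "psd k E'"
    "\<And>a b. a < k \<Longrightarrow> b < k \<Longrightarrow> E $$ (a, b) + E' $$ (a, b) = (if a = b then 1 else 0)"
    "\<And>a b. a < k \<Longrightarrow> b < k \<Longrightarrow> F $$ (a, b) = E $$ (a, b) - E' $$ (a, b)"
proof -
  obtain E E' where E: "psd k E" "psd k E'" "E + E' = 1\<^sub>m k" "F = E - E'"
    using assms by (auto simp: contraction_def)
  have "E $$ (a, b) + E' $$ (a, b) = (if a = b then 1 else 0)" if "a < k" "b < k" for a b
    using arg_cong[OF E(3), of "\<lambda>M. M $$ (a, b)"] that psd_carrier[OF E(1)] psd_carrier[OF E(2)] by simp
  then show thesis using that[OF E(1,2)] E(4) psd_carrier[OF E(1)] psd_carrier[OF E(2)] by simp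
qed

text \<open>\<open>E\<close> and \<open>E'\<close> are the effects of a two-outcome measurement: the
  two conditional parts of \<open>Z\<close> are positive, and their traces add up to that of
  \<open>Z\<close> because \<open>E + E' = 1\<close>.\<close>

lemma ptrace_left_psd_contraction:
  assumes "contraction m F" "psd (m * k) Z"
  shows "hermitian (ptrace_left m k F Z)" "trace_norm (ptrace_left m k F Z) \<le> Re (mat_trace Z)"
proof -
  obtain E E' where E: "psd m E" "psd m E'"
    and one: "\<And>a b. a < m \<Longrightarrow> b < m \<Longrightarrow> E $$ (a, b) + E' $$ (a, b) = (if a = b then 1 else 0)"
    and F: "\<And>a b. a < m \<Longrightarrow> b < m \<Longrightarrow> F $$ (a, b) = E $$ (a, b) - E' $$ (a, b)"
    using contractionE[OF assms(1)] by metis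
  have eq: "ptrace_left m k F Z = ptrace_left m k E Z - ptrace_left m k E' Z"
    by (intro eq_matI) (auto simp: ptrace_left_def F algebra_simps sum_subtractf)
  have "mat_trace (ptrace_left m k E Z) + mat_trace (ptrace_left m k E' Z) =
    (\<Sum>a<m. \<Sum>b<m. (E $$ (a, b) + E' $$ (a, b)) * (\<Sum>p<k. Z $$ (b * k + p, a * k + p)))"
    unfolding mat_trace_ptrace_left by (simp add: distrib_right sum.distrib)
  also have "\<dots> = (\<Sum>a<m. \<Sum>b<m. if b = a then (\<Sum>p<k. Z $$ (a * k + p, a * k + p)) else 0)"
    using one by (intro sum.cong refl) auto
  finally have tr: "mat_trace (ptrace_left m k E Z) + mat_trace (ptrace_left m k E' Z) = mat_trace Z"
    by (simp add: mat_trace_prod_index[OF psd_carrier[OF assms(2)]])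
  note p = psd_ptrace_left[OF E(1) assms(2)] psd_ptrace_left[OF E(2) assms(2)]
  show "hermitian (ptrace_left m k F Z)" unfolding eq by (rule psd_minus_hermitian[OF p])
  show "trace_norm (ptrace_left m k F Z) \<le> Re (mat_trace Z)"
    unfolding eq tr[symmetric] using trace_norm_le[OF p] by simp
qed

lemma ptrace_right_psd_contraction:
  assumes "contraction k F" "psd (n * k) Z"
  shows "hermitian (ptrace_right n k F Z)" "trace_norm (ptrace_right n k F Z) \<le> Re (mat_trace Z)"
proof -
  obtain E E' where E: "psd k E" "psd k E'"
    and one: "\<And>a b. a < k \<Longrightarrow> b < k \<Longrightarrow> E $$ (a, b) + E' $$ (a, b) = (if a = b then 1 else 0)"
    and F: "\<And>a b. a < k \<Longrightarrow> b < k \<Longrightarrow> F $$ (a, b) = E $$ (a, b) - E' $$ (a, b)"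
    using contractionE[OF assms(1)] by metis
  have eq: "ptrace_right n k F Z = ptrace_right n k E Z - ptrace_right n k E' Z"
    by (intro eq_matI) (auto simp: ptrace_right_def F algebra_simps sum_subtractf)
  have "mat_trace (ptrace_right n k E Z) + mat_trace (ptrace_right n k E' Z) =
    (\<Sum>p<k. \<Sum>q<k. (E $$ (p, q) + E' $$ (p, q)) * (\<Sum>a<n. Z $$ (a * k + q, a * k + p)))"
    unfolding mat_trace_ptrace_right by (simp add: distrib_right sum.distrib)
  also have "\<dots> = (\<Sum>p<k. \<Sum>q<k. if q = p then (\<Sum>a<n. Z $$ (a * k + p, a * k + p)) else 0)"
    using one by (intro sum.cong refl) auto
  also have "\<dots> = (\<Sum>p<k. \<Sum>a<n. Z $$ (a * k + p, a * k + p))" by simp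
  also have "\<dots> = mat_trace Z"
    unfolding mat_trace_prod_index[OF psd_carrier[OF assms(2)]] by (rule sum.swap)
  finally have tr: "mat_trace (ptrace_right n k E Z) + mat_trace (ptrace_right n k E' Z) = mat_trace Z" .
  note p = psd_ptrace_right[OF E(1) assms(2)] psd_ptrace_right[OF E(2) assms(2)]
  show "hermitian (ptrace_right n k F Z)" unfolding eq by (rule psd_minus_hermitian[OF p])
  show "trace_norm (ptrace_right n k F Z) \<le> Re (mat_trace Z)"
    unfolding eq tr[symmetric] using trace_norm_le[OF p] by simp
qed

lemma trace_norm_minus:
  assumes "hermitian X" "X \<in> carrier_mat n n" "hermitian Y" "Y \<in> carrier_mat n n"
  shows "trace_norm (X - Y) \<le> trace_norm X + trace_norm Y"
proof -
  have "X - Y = X + complex_of_real (- 1) \<cdot>\<^sub>m Y" using assms by (intro eq_matI) auto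
  then show ?thesis
    using trace_norm_add[OF assms(1,2) hermitian_smult[OF assms(3,4)] smult_carrier_mat[OF assms(4)], of "- 1"]
      trace_norm_smult[OF assms(3,4), of "- 1"] by simp
qed

text \<open>The bound for positive operators is applied to both Jordan parts of \<open>T\<close>.
  This Hermitian version is required because \<open>T\<close> will be a difference of channel
  outputs.\<close>

lemma trace_norm_ptrace_right_le:
  assumes "contraction k F" "hermitian T" "T \<in> carrier_mat (n * k) (n * k)"
  shows "trace_norm (ptrace_right n k F T) \<le> trace_norm T"
proof -
  obtain P N where P: "psd (n * k) P" "psd (n * k) N" "T = P - N"
    "Re (mat_trace P) + Re (mat_trace N) = trace_norm T"
    using jordan_decomposition[OF assms(2,3)] by blast
  note c = P(1,2)[THEN psd_carrier]
  have "ptrace_right n k F T = ptrace_right n k F P - ptrace_right n k F N"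
    using c by (intro eq_matI)
      (auto simp: ptrace_right_def P(3) prod_index_less right_diff_distrib sum_subtractf)
  then have "trace_norm (ptrace_right n k F T) \<le> trace_norm (ptrace_right n k F P) + trace_norm (ptrace_right n k F N)"
    using trace_norm_minus ptrace_right_psd_contraction(1)[OF assms(1)] P(1,2) ptrace_carrier by metis
  then show ?thesis
    using ptrace_right_psd_contraction(2)[OF assms(1) P(1)] ptrace_right_psd_contraction(2)[OF assms(1) P(2)] P(4)
    by simp
qed

lemma spectral_contraction:
  assumes "spectral_decomposition k F u l" "F \<in> carrier_mat k k" "\<And>i. i < k \<Longrightarrow> \<bar>l i\<bar> \<le> 1"
  shows "contraction k F"
proof -
  obtain E where E: "E \<in> carrier_mat k k" "spectral_decomposition k E u (\<lambda>i. (1 + l i) / 2)"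
    by (rule spectral_decomposition_exists_fun[OF assms(1)])
  obtain E' where E': "E' \<in> carrier_mat k k" "spectral_decomposition k E' u (\<lambda>i. (1 - l i) / 2)"
    by (rule spectral_decomposition_exists_fun[OF assms(1)])
  have "0 \<le> (1 + l i) / 2" "0 \<le> (1 - l i) / 2" if "i < k" for i
    using assms(3)[OF that] by auto
  then have psd: "psd k E" "psd k E'"
    using spectral_decomposition_psd[OF E(2,1)] spectral_decomposition_psd[OF E'(2,1)] by auto
  have "1\<^sub>m k - E = E'"
    by (rule spectral_decomposition_eqI[OF spectral_decomposition_minus[OF spectral_decomposition_one[OF assms(1)] E(2) _ E(1)] E'(2)])
      (use E E' in \<open>auto simp: field_simps\<close>)
  then have "E + E' = 1\<^sub>m k" using E E' by (auto intro!: eq_matI)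
  moreover have "F = E - E'"
    by (rule spectral_decomposition_eqI[OF assms(1) spectral_decomposition_minus[OF E(2) E'(2) E(1) E'(1)]])
      (use E E' assms in \<open>auto simp: field_simps\<close>)
  ultimately show ?thesis using psd by (auto simp: contraction_def)
qed

text \<open>The squared eigenvalues sum to 1, so none exceeds 1. This applies to every member of an
  orthonormal basis of Hermitian operators.\<close>

lemma hs_unit_contraction:
  assumes "hermitian F" "F \<in> carrier_mat k k" "hs_inner F F = 1"
  shows "contraction k F"
proof -
  obtain u l where u: "spectral_decomposition k F u l" using spectral_theorem[OF assms(1,2)] by blast
  have 1: "(\<Sum>i<k. (l i)\<^sup>2) = 1"
    using hs_inner_spectral[OF u assms(2)] assms(3) by (metis of_real_eq_1_iff)
  have "\<bar>l i\<bar> \<le> 1" if "i < k" for i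
  proof -
    have "(l i)\<^sup>2 \<le> (\<Sum>i<k. (l i)\<^sup>2)" using that by (intro member_le_sum) auto
    then show ?thesis using 1 by (simp add: abs_square_le_1)
  qed
  then show ?thesis using spectral_contraction[OF u assms(2)] by blast
qed

section \<open>Channels\<close>

lemma mat_lincomb_carrier [simp]: "mat_lincomb n I c M \<in> carrier_mat n n"
  by (simp add: mat_lincomb_def)

lemma block_carrier [simp]: "block m k Z p q \<in> carrier_mat m m"
  by (simp add: block_def)

lemma tensor_id_carrier [simp]: "tensor_id m n k \<Lambda> Z \<in> carrier_mat (n * k) (n * k)"
  by (simp add: tensor_id_def)

lemma tensor_id_index:
  assumes "a < n" "p < k" "b < n" "q < k"
  shows "tensor_id m n k \<Lambda> Z $$ (a * k + p, b * k + q) = \<Lambda> (block m k Z p q) $$ (a, b)"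
  using assms by (simp add: tensor_id_def prod_index_less)

lemma smult_zero: "X \<in> carrier_mat n n \<Longrightarrow> 0 \<cdot>\<^sub>m X = (0\<^sub>m n n :: complex mat)"
  by (intro eq_matI) auto

lemma linear_map_zero:
  assumes "linear_map m n \<Lambda>"
  shows "\<Lambda> (0\<^sub>m m m) = 0\<^sub>m n n"
proof -
  have "\<Lambda> (0 \<cdot>\<^sub>m 0\<^sub>m m m) = 0 \<cdot>\<^sub>m \<Lambda> (0\<^sub>m m m)" "\<Lambda> (0\<^sub>m m m) \<in> carrier_mat n n"
    using assms zero_carrier_mat[of m m] unfolding linear_map_def by blast+
  moreover have "0 \<cdot>\<^sub>m 0\<^sub>m m m = (0\<^sub>m m m :: complex mat)" by (intro eq_matI) auto
  ultimately show ?thesis by (metis smult_zero)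
qed

lemma linear_map_minus:
  assumes "linear_map m n \<Lambda>" "X \<in> carrier_mat m m" "Y \<in> carrier_mat m m"
  shows "\<Lambda> (X - Y) = \<Lambda> X - \<Lambda> Y"
proof -
  have c: "(- 1) \<cdot>\<^sub>m Y \<in> carrier_mat m m" using assms by simp
  have "X - Y = X + (- 1) \<cdot>\<^sub>m Y" using assms by (intro eq_matI) auto
  then have "\<Lambda> (X - Y) = \<Lambda> X + (- 1) \<cdot>\<^sub>m \<Lambda> Y"
    using assms c unfolding linear_map_def by metis
  moreover have "\<Lambda> X \<in> carrier_mat n n" "\<Lambda> Y \<in> carrier_mat n n" using assms by (auto simp: linear_map_def)
  ultimately show ?thesis by (intro eq_matI) auto
qed

lemma linear_map_lincomb:
  assumes "linear_map m n \<Lambda>" "finite I" "\<And>i. i \<in> I \<Longrightarrow> M i \<in> carrier_mat m m"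
  shows "\<Lambda> (mat_lincomb m I c M) = mat_lincomb n I c (\<lambda>i. \<Lambda> (M i))"
  using assms(2,3)
proof (induction I)
  case empty
  have "mat_lincomb d {} c L = 0\<^sub>m d d" for d and L :: "'a \<Rightarrow> complex mat"
    by (intro eq_matI) (auto simp: mat_lincomb_def)
  then show ?case using linear_map_zero[OF assms(1)] by simp
next
  case (insert i I)
  have L: "mat_lincomb d (insert i I) c L = c i \<cdot>\<^sub>m L i + mat_lincomb d I c L"
    if "L i \<in> carrier_mat d d" for d and L :: "'a \<Rightarrow> complex mat"
    using that insert by (intro eq_matI) (auto simp: mat_lincomb_def)
  have "\<Lambda> (M i) \<in> carrier_mat n n" using assms(1) insert.prems by (auto simp: linear_map_def)
  moreover have "\<Lambda> (c i \<cdot>\<^sub>m M i + mat_lincomb m I c M) = c i \<cdot>\<^sub>m \<Lambda> (M i) + \<Lambda> (mat_lincomb m I c M)"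
  proof -
    have "c i \<cdot>\<^sub>m M i \<in> carrier_mat m m" "M i \<in> carrier_mat m m" using insert.prems by auto
    then show ?thesis using assms(1) mat_lincomb_carrier[of m I c M] unfolding linear_map_def by metis
  qed
  ultimately show ?case using insert by (simp add: L)
qed

lemma channelD:
  assumes "channel m n \<Lambda>"
  shows "linear_map m n \<Lambda>" "X \<in> carrier_mat m m \<Longrightarrow> \<Lambda> X \<in> carrier_mat n n"
    "X \<in> carrier_mat m m \<Longrightarrow> mat_trace (\<Lambda> X) = mat_trace X"
    "psd (m * k) Z \<Longrightarrow> psd (n * k) (tensor_id m n k \<Lambda> Z)"
  using assms by (auto simp: channel_def linear_map_def trace_preserving_def completely_positive_def)

lemma channel_psd:
  assumes "channel m n \<Lambda>" "psd m X"
  shows "psd n (\<Lambda> X)"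
proof -
  \<comment> \<open>Positivity is complete positivity with a one-dimensional second factor.\<close>
  have "block m 1 X 0 0 = X" using psd_carrier[OF assms(2)] by (intro eq_matI) (auto simp: block_def)
  then have "tensor_id m n 1 \<Lambda> X = \<Lambda> X"
    using channelD(2)[OF assms(1) psd_carrier[OF assms(2)]] by (intro eq_matI) (auto simp: tensor_id_def)
  then show ?thesis using channelD(4)[OF assms(1), of 1 X] assms(2) by simp
qed

lemma channel_hermitian:
  assumes "channel m n \<Lambda>" "hermitian X" "X \<in> carrier_mat m m"
  shows "hermitian (\<Lambda> X)"
proof -
  obtain P N where P: "psd m P" "psd m N" "X = P - N" using jordan_decomposition[OF assms(2,3)] by metis
  then have "\<Lambda> X = \<Lambda> P - \<Lambda> N" using linear_map_minus[OF channelD(1)[OF assms(1)]] psd_carrier by metis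
  then show ?thesis using psd_minus_hermitian channel_psd[OF assms(1)] P by metis
qed

lemma mat_trace_tensor_id:
  assumes "channel m n \<Lambda>" "Z \<in> carrier_mat (m * k) (m * k)"
  shows "mat_trace (tensor_id m n k \<Lambda> Z) = mat_trace Z"
proof -
  have "mat_trace (tensor_id m n k \<Lambda> Z) = (\<Sum>a<n. \<Sum>p<k. \<Lambda> (block m k Z p p) $$ (a, a))"
    by (simp add: mat_trace_prod_index[OF tensor_id_carrier] tensor_id_index)
  also have "\<dots> = (\<Sum>p<k. mat_trace (\<Lambda> (block m k Z p p)))"
    by (subst sum.swap) (simp add: mat_trace_sum[OF channelD(2)[OF assms(1) block_carrier]])
  also have "\<dots> = (\<Sum>p<k. \<Sum>a<m. Z $$ (a * k + p, a * k + p))"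
    by (simp add: channelD(3)[OF assms(1)] mat_trace_sum[OF block_carrier]) (simp add: block_def)
  also have "\<dots> = mat_trace Z" unfolding mat_trace_prod_index[OF assms(2)] by (rule sum.swap)
  finally show ?thesis .
qed

lemma tensor_id_difference:
  assumes "channel m n \<Lambda>0" "channel m n \<Lambda>1" "density_operator (m * k) Z"
  shows "hermitian (tensor_id m n k \<Lambda>0 Z - tensor_id m n k \<Lambda>1 Z)"
    and "trace_distance (tensor_id m n k \<Lambda>0 Z) (tensor_id m n k \<Lambda>1 Z) \<le> 1"
proof -
  have Z: "psd (m * k) Z" "mat_trace Z = 1" using assms(3) by (auto simp: density_operator_def)
  note p = channelD(4)[OF assms(1) Z(1)] channelD(4)[OF assms(2) Z(1)]
  show "hermitian (tensor_id m n k \<Lambda>0 Z - tensor_id m n k \<Lambda>1 Z)" by (rule psd_minus_hermitian[OF p])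
  show "trace_distance (tensor_id m n k \<Lambda>0 Z) (tensor_id m n k \<Lambda>1 Z) \<le> 1"
    unfolding trace_distance_def using trace_norm_le[OF p]
      mat_trace_tensor_id[OF assms(1) psd_carrier[OF Z(1)]] mat_trace_tensor_id[OF assms(2) psd_carrier[OF Z(1)]] Z(2)
    by simp
qed

text \<open>A supremum of reals dominates its members only when the set is bounded; the bound 1
  comes from \<open>tensor_id_difference\<close>.\<close>

lemma trace_distance_le_diamond:
  assumes "channel m n \<Lambda>0" "channel m n \<Lambda>1" "density_operator (m * m) Z"
  shows "trace_distance (tensor_id m n m \<Lambda>0 Z) (tensor_id m n m \<Lambda>1 Z) \<le> diamond_distance m n \<Lambda>0 \<Lambda>1"
  unfolding diamond_distance_def
  using assms tensor_id_difference(2)[OF assms(1,2)]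
  by (intro cSUP_upper bdd_aboveI2[of _ _ 1]) auto

lemma trace_distance_nonneg:
  assumes "channel m n \<Lambda>0" "channel m n \<Lambda>1" "density_operator (m * k) Z"
  shows "0 \<le> trace_distance (tensor_id m n k \<Lambda>0 Z) (tensor_id m n k \<Lambda>1 Z)"
  unfolding trace_distance_def
  using trace_norm_nonneg[OF tensor_id_difference(1)[OF assms] minus_carrier_mat[OF tensor_id_carrier]]
  by simp

section \<open>Pure states as test inputs\<close>

definition rank_one :: "nat \<Rightarrow> (nat \<Rightarrow> complex) \<Rightarrow> complex mat" where
  "rank_one n v = mat n n (\<lambda>(a, b). v a * cnj (v b))"

lemma rank_one_carrier [simp]: "rank_one n v \<in> carrier_mat n n"
  by (simp add: rank_one_def)

lemma density_operator_rank_one: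
  assumes "(\<Sum>a<n. cnj (v a) * v a) = 1"
  shows "density_operator n (rank_one n v)"
  unfolding density_operator_def
proof
  show "psd n (rank_one n v)"
  proof (rule psdI)
    fix w
    have "qform n (rank_one n v) w = (\<Sum>a<n. cnj (w a) * v a) * cnj (\<Sum>a<n. cnj (w a) * v a)"
      unfolding qform_def cnj_sum sum_product rank_one_def by (intro sum.cong refl) simp
    then show "0 \<le> qform n (rank_one n v) w"
      by (simp add: complex_norm_square[symmetric] complex_nonneg_iff del: cnj_sum flip: of_real_power)
  qed simp
  show "mat_trace (rank_one n v) = 1"
    using assms by (simp add: mat_trace_def rank_one_def mult.commute)
qed

lemma density_operator_tensor:
  assumes "density_operator m X" "density_operator k Y"
  shows "density_operator (m * k) (tensor X Y)"
  using assms psd_tensor by (auto simp: density_operator_def mat_trace_tensor[of X m Y k] psd_carrier)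

lemma spectral_decomposition_lincomb:
  assumes "spectral_decomposition n H u l" "H \<in> carrier_mat n n"
  shows "H = mat_lincomb n {..<n} (\<lambda>i. complex_of_real (l i)) (\<lambda>i. rank_one n (u i))"
  using spectral_decompositionD(3)[OF assms(1)] assms(2)
  by (intro eq_matI) (auto simp: mat_lincomb_def rank_one_def mult.assoc)

definition ancilla :: "nat \<Rightarrow> complex mat" where
  "ancilla k = rank_one k (\<lambda>a. if a = 0 then 1 else 0)"

lemma density_operator_ancilla:
  assumes "0 < k"
  shows "density_operator k (ancilla k)"
  unfolding ancilla_def
proof (rule density_operator_rank_one)
  have "(\<Sum>a<k. cnj (if a = 0 then 1 else 0) * (if a = 0 then 1 else 0)) = (\<Sum>a<k. if a = 0 then 1 else (0 :: complex))"
    by (intro sum.cong) auto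
  then show "(\<Sum>a<k. cnj (if a = 0 then 1 else 0) * (if a = 0 then 1 else (0 :: complex))) = 1"
    using assms by simp
qed

lemma ancilla_carrier [simp]: "ancilla k \<in> carrier_mat k k"
  by (simp add: ancilla_def)

lemma ancilla_00 [simp]: "0 < k \<Longrightarrow> ancilla k $$ (0, 0) = 1"
  by (simp add: ancilla_def rank_one_def)

text \<open>The entries with ancilla index 0 reproduce \<open>\<Lambda>0 X - \<Lambda>1 X\<close>.
  The first claim keeps only diagonal entries; the second uses that only the zero matrix has trace
  norm 0.\<close>

lemma trace_distance_ancilla_ge:
  assumes "channel m n \<Lambda>0" "channel m n \<Lambda>1" "density_operator m X" "0 < m"
  shows "(\<Sum>a<n. cmod ((\<Lambda>0 X - \<Lambda>1 X) $$ (a, a))) / 2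
    \<le> trace_distance (tensor_id m n m \<Lambda>0 (tensor X (ancilla m))) (tensor_id m n m \<Lambda>1 (tensor X (ancilla m)))"
    and "\<Lambda>0 X \<noteq> \<Lambda>1 X \<Longrightarrow>
      0 < trace_distance (tensor_id m n m \<Lambda>0 (tensor X (ancilla m))) (tensor_id m n m \<Lambda>1 (tensor X (ancilla m)))"
proof -
  note dens = density_operator_tensor[OF assms(3) density_operator_ancilla[OF assms(4)]]
  define T where "T = tensor_id m n m \<Lambda>0 (tensor X (ancilla m)) - tensor_id m n m \<Lambda>1 (tensor X (ancilla m))"
  have X: "X \<in> carrier_mat m m" using assms(3) psd_carrier by (auto simp: density_operator_def)
  have h: "hermitian T" unfolding T_def by (rule tensor_id_difference(1)[OF assms(1,2) dens])
  have c: "T \<in> carrier_mat (n * m) (n * m)" unfolding T_def by (intro minus_carrier_mat tensor_id_carrier)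
  note L = channelD(2)[OF assms(1) X] channelD(2)[OF assms(2) X]
  have T: "T $$ (a * m, b * m) = (\<Lambda>0 X - \<Lambda>1 X) $$ (a, b)" if ab: "a < n" "b < n" for a b
  proof -
    have i: "a * m + 0 < n * m" "b * m + 0 < n * m" using ab assms(4) by (intro prod_index_less; simp)+
    have "tensor (\<Lambda> X) (ancilla m) $$ (a * m + 0, b * m + 0) = \<Lambda> X $$ (a, b)"
      if "\<Lambda> X \<in> carrier_mat n n" for \<Lambda>
      by (subst tensor_index[OF that ancilla_carrier ab assms(4,4)]) (simp add: assms(4))
    then show ?thesis
      using i ab L carrier_matD[OF tensor_carrier[OF L(2) ancilla_carrier[of m]]]
      unfolding T_def tensor_id_tensor[OF channelD(1)[OF assms(1)] X ancilla_carrier]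
        tensor_id_tensor[OF channelD(1)[OF assms(2)] X ancilla_carrier] by simp
  qed
  have td: "trace_distance (tensor_id m n m \<Lambda>0 (tensor X (ancilla m))) (tensor_id m n m \<Lambda>1 (tensor X (ancilla m)))
    = trace_norm T / 2" by (simp add: trace_distance_def T_def)
  have "(\<Sum>a<n. cmod ((\<Lambda>0 X - \<Lambda>1 X) $$ (a, a))) = (\<Sum>a<n. cmod (T $$ (a * m, a * m)))"
    using T by (intro sum.cong) auto
  also have "\<dots> \<le> (\<Sum>a<n. \<Sum>p<m. cmod (T $$ (a * m + p, a * m + p)))"
  proof (intro sum_mono)
    fix a
    show "cmod (T $$ (a * m, a * m)) \<le> (\<Sum>p<m. cmod (T $$ (a * m + p, a * m + p)))"
      using member_le_sum[of 0 "{..<m}" "\<lambda>p. cmod (T $$ (a * m + p, a * m + p))"] assms(4) by simp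
  qed
  also have "\<dots> = (\<Sum>i<n * m. cmod (T $$ (i, i)))" by (rule sum_prod_index[symmetric])
  also have "\<dots> \<le> trace_norm T" by (rule sum_diag_le_trace_norm[OF h c])
  finally show "(\<Sum>a<n. cmod ((\<Lambda>0 X - \<Lambda>1 X) $$ (a, a))) / 2
    \<le> trace_distance (tensor_id m n m \<Lambda>0 (tensor X (ancilla m))) (tensor_id m n m \<Lambda>1 (tensor X (ancilla m)))"
    unfolding td by simp
  assume "\<Lambda>0 X \<noteq> \<Lambda>1 X"
  have "trace_norm T \<noteq> 0"
  proof
    assume "trace_norm T = 0"
    then have z: "T = 0\<^sub>m (n * m) (n * m)" by (rule trace_norm_eq_0_imp[OF h c])
    have "\<Lambda>0 X $$ (a, b) = \<Lambda>1 X $$ (a, b)" if "a < n" "b < n" for a b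
      using T[OF that] L that assms(4) by (simp add: z)
    then have "\<Lambda>0 X = \<Lambda>1 X" using L by (intro eq_matI) auto
    with \<open>\<Lambda>0 X \<noteq> \<Lambda>1 X\<close> show False by simp
  qed
  then show "0 < trace_distance (tensor_id m n m \<Lambda>0 (tensor X (ancilla m))) (tensor_id m n m \<Lambda>1 (tensor X (ancilla m)))"
    unfolding td using trace_norm_nonneg[OF h c] by simp
qed

section \<open>Two-outcome measurements as channels\<close>

text \<open>The outcome is stored as a diagonal qubit state, so exchanging \<open>E\<close> and
  \<open>F\<close> negates the outcome.\<close>

definition measure_prepare :: "complex mat \<Rightarrow> complex mat \<Rightarrow> complex mat \<Rightarrow> complex mat" where
  "measure_prepare E F X =
     mat 2 2 (\<lambda>(a, b). if a = b then mat_trace ((if a = 0 then E else F) * X) else 0)"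

lemma sum_lessThan_2: "(\<Sum>a<2. f a) = f 0 + f (Suc 0)" for f :: "nat \<Rightarrow> complex"
  by (simp add: numeral_2_eq_2)

lemma channel_measure_prepare:
  assumes "psd m E" "psd m F" "E + F = 1\<^sub>m m"
  shows "channel m 2 (measure_prepare E F)"
proof -
  note c = psd_carrier[OF assms(1)] psd_carrier[OF assms(2)]
  have G: "(if a = (0::nat) then E else F) \<in> carrier_mat m m" for a using c by simp
  have lin: "linear_map m 2 (measure_prepare E F)"
  proof -
    have "mat_trace (G * (X + Y)) = mat_trace (G * X) + mat_trace (G * Y)"
      "mat_trace (G * (z \<cdot>\<^sub>m X)) = z * mat_trace (G * X)"
      if "G \<in> carrier_mat m m" "X \<in> carrier_mat m m" "Y \<in> carrier_mat m m" for G X Y z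
      using that mat_trace_add[of "G * X" m "G * Y"] mat_trace_smult[of "G * X" m z]
      by (simp_all add: mult_add_distrib_mat[of G m m X m Y] mult_smult_distrib[of G m m X m])
    then show ?thesis
      unfolding linear_map_def using c by (auto simp: measure_prepare_def intro!: eq_matI)
  qed
  moreover have "completely_positive m 2 (measure_prepare E F)"
    unfolding completely_positive_def
  proof (intro allI impI)
    fix k Z assume Z: "psd (m * k) Z"
    show "psd (2 * k) (tensor_id m 2 k (measure_prepare E F) Z)"
    proof (rule psdI)
      fix w
      have e: "mat_trace ((if a = (0::nat) then E else F) * block m k Z p q) =
        ptrace_left m k (if a = 0 then E else F) Z $$ (p, q)" if "p < k" "q < k" for a p q
        unfolding mat_trace_mult[OF G block_carrier] using that by (simp add: ptrace_left_def block_def)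
      \<comment> \<open>The output is block diagonal, its two blocks being the partial traces of
        \<open>Z\<close> against \<open>E\<close> and \<open>F\<close>, both positive.\<close>
      have "qform (2 * k) (tensor_id m 2 k (measure_prepare E F) Z) w =
        (\<Sum>a<2. \<Sum>b<2. if b = a then
          qform k (ptrace_left m k (if a = 0 then E else F) Z) (\<lambda>p. w (a * k + p)) else 0)"
        unfolding qform_prod_index
      proof (intro sum.cong refl)
        fix a b :: nat assume "a \<in> {..<2}" "b \<in> {..<2}"
        then show "(\<Sum>p<k. \<Sum>q<k. cnj (w (a * k + p)) *
            tensor_id m 2 k (measure_prepare E F) Z $$ (a * k + p, b * k + q) * w (b * k + q)) =
          (if b = a then qform k (ptrace_left m k (if a = 0 then E else F) Z) (\<lambda>p. w (a * k + p)) else 0)"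
          unfolding qform_def by (auto simp: tensor_id_index measure_prepare_def e intro!: sum.cong)
      qed
      also have "0 \<le> \<dots>"
        using psd_qform[OF psd_ptrace_left[OF assms(1) Z]] psd_qform[OF psd_ptrace_left[OF assms(2) Z]]
        by (intro sum_nonneg) auto
      finally show "0 \<le> qform (2 * k) (tensor_id m 2 k (measure_prepare E F) Z) w" .
    qed simp
  qed
  moreover have "trace_preserving m (measure_prepare E F)"
    unfolding trace_preserving_def
  proof
    fix X :: "complex mat" assume X: "X \<in> carrier_mat m m"
    have "mat_trace (measure_prepare E F X) = mat_trace (E * X) + mat_trace (F * X)"
      by (subst mat_trace_sum[of _ 2]) (simp_all add: measure_prepare_def sum_lessThan_2)
    also have "\<dots> = mat_trace ((E + F) * X)"
      using c X by (simp add: add_mult_distrib_mat[of E m m F X m] mat_trace_add[of "E * X" m "F * X"])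
    finally show "mat_trace (measure_prepare E F X) = mat_trace X" using X by (simp add: assms(3))
  qed
  ultimately show ?thesis by (simp add: channel_def)
qed

definition pauli_z :: "complex mat" where
  "pauli_z = mat 2 2 (\<lambda>(a, b). if a = b then (if a = 0 then 1 else - 1) else 0)"

lemma pauli_z_carrier [simp]: "pauli_z \<in> carrier_mat 2 2"
  by (simp add: pauli_z_def)

lemma spectral_decomposition_pauli_z:
  "spectral_decomposition 2 pauli_z (\<lambda>i a. if a = i then 1 else 0) (\<lambda>i. if i = 0 then 1 else - 1)"
  by (auto simp: spectral_decomposition_def orthonormal_family_def sum_lessThan_2 pauli_z_def
      less_2_cases_iff)

lemma trace_norm_pauli_z: "trace_norm pauli_z = 2"
  unfolding trace_norm_spectral[OF spectral_decomposition_pauli_z pauli_z_carrier]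
  by (simp add: numeral_2_eq_2)

lemma measure_prepare_difference:
  assumes "E \<in> carrier_mat m m" "F \<in> carrier_mat m m" "X \<in> carrier_mat m m"
  shows "measure_prepare E F X - measure_prepare F E X = mat_trace ((E - F) * X) \<cdot>\<^sub>m pauli_z"
proof -
  have "mat_trace ((E - F) * X) = mat_trace (E * X) - mat_trace (F * X)"
    unfolding mat_trace_mult[OF minus_carrier_mat[OF assms(2)] assms(3)]
      mat_trace_mult[OF assms(1,3)] mat_trace_mult[OF assms(2,3)]
    using assms by (simp add: algebra_simps sum_subtractf)
  then show ?thesis by (intro eq_matI) (auto simp: measure_prepare_def pauli_z_def)
qed

text \<open>Discriminating the two channels on \<open>Z\<close> thus amounts to the size of a single
  operator on the second factor, tensored with a fixed matrix.\<close>

lemma tensor_id_measure_prepare_difference: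
  assumes "E \<in> carrier_mat m m" "F \<in> carrier_mat m m"
  shows "tensor_id m 2 k (measure_prepare E F) Z - tensor_id m 2 k (measure_prepare F E) Z =
    tensor pauli_z (ptrace_left m k (E - F) Z)"
proof (rule eq_mat_prodI[of _ 2 k])
  show "tensor_id m 2 k (measure_prepare E F) Z - tensor_id m 2 k (measure_prepare F E) Z
    \<in> carrier_mat (2 * k) (2 * k)" by (intro minus_carrier_mat tensor_id_carrier)
  show "tensor pauli_z (ptrace_left m k (E - F) Z) \<in> carrier_mat (2 * k) (2 * k)" by simp
  fix a p b q :: nat assume i: "a < 2" "p < k" "b < 2" "q < k"
  have "(tensor_id m 2 k (measure_prepare E F) Z - tensor_id m 2 k (measure_prepare F E) Z) $$ (a * k + p, b * k + q) =
    (measure_prepare E F (block m k Z p q) - measure_prepare F E (block m k Z p q)) $$ (a, b)"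
    using i prod_index_less[of a 2 p k] prod_index_less[of b 2 q k]
      carrier_matD[OF tensor_id_carrier[of m 2 k "measure_prepare F E" Z]]
    by (simp add: tensor_id_index) (simp add: measure_prepare_def)
  also have "\<dots> = mat_trace ((E - F) * block m k Z p q) * pauli_z $$ (a, b)"
    unfolding measure_prepare_difference[OF assms block_carrier] using i by (simp add: pauli_z_def)
  also have "mat_trace ((E - F) * block m k Z p q) = ptrace_left m k (E - F) Z $$ (p, q)"
    unfolding mat_trace_mult[OF minus_carrier_mat[OF assms(2)] block_carrier]
    using i by (simp add: ptrace_left_def block_def)
  finally show "(tensor_id m 2 k (measure_prepare E F) Z - tensor_id m 2 k (measure_prepare F E) Z) $$ (a * k + p, b * k + q) =
    tensor pauli_z (ptrace_left m k (E - F) Z) $$ (a * k + p, b * k + q)"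
    using i by (simp add: tensor_index[OF pauli_z_carrier ptrace_carrier(1)])
qed

section \<open>Operator Schmidt decompositions and channel discrimination\<close>

lemma mat_trace_mult_lincomb:
  assumes "E \<in> carrier_mat d d" "\<And>i. i \<in> I \<Longrightarrow> M i \<in> carrier_mat d d"
  shows "mat_trace (E * mat_lincomb d I c M) = (\<Sum>i\<in>I. c i * mat_trace (E * M i))"
proof -
  have "mat_trace (E * mat_lincomb d I c M) =
    (\<Sum>a<d. \<Sum>b<d. \<Sum>i\<in>I. \<Sum>j\<in>{()}. c i * (E $$ (a, b) * M i $$ (b, a)))"
    unfolding mat_trace_mult[OF assms(1) mat_lincomb_carrier]
    by (intro sum.cong refl) (simp add: mat_lincomb_def sum_distrib_left mult_ac)
  also have "\<dots> = (\<Sum>i\<in>I. \<Sum>j\<in>{()}. \<Sum>a<d. \<Sum>b<d. c i * (E $$ (a, b) * M i $$ (b, a)))"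
    by (rule sum_swap_pairs)
  also have "\<dots> = (\<Sum>i\<in>I. c i * mat_trace (E * M i))"
    using assms by (intro sum.cong refl) (simp add: mat_trace_mult[of _ d d] sum_distrib_left del: index_mult_mat)
  finally show ?thesis .
qed

lemma orthonormal_basis_trace:
  assumes "orthonormal_basis d I M" "\<And>i. i \<in> I \<Longrightarrow> hermitian (M i)" "i \<in> I" "j \<in> I"
  shows "mat_trace (M i * M j) = (if i = j then 1 else 0)"
  using assms unfolding orthonormal_basis_def hs_inner_def hermitian_def by metis

lemma orthonormal_basis_expansion:
  assumes "orthonormal_basis d I M" "finite I" "\<And>i. i \<in> I \<Longrightarrow> hermitian (M i)" "X \<in> carrier_mat d d"
  shows "X = mat_lincomb d I (\<lambda>i. mat_trace (M i * X)) M"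
proof -
  have M: "M i \<in> carrier_mat d d" if "i \<in> I" for i using assms(1) that by (auto simp: orthonormal_basis_def)
  obtain c where c: "X = mat_lincomb d I c M" using assms(1,4) by (auto simp: orthonormal_basis_def)
  have "mat_trace (M j * X) = c j" if "j \<in> I" for j
  proof -
    have "mat_trace (M j * X) = (\<Sum>i\<in>I. c i * mat_trace (M j * M i))"
      unfolding c by (rule mat_trace_mult_lincomb[OF M[OF that] M])
    also have "\<dots> = (\<Sum>i\<in>I. if j = i then c j else 0)"
      by (intro sum.cong refl) (simp add: orthonormal_basis_trace[OF assms(1,3) that])
    finally show ?thesis using that assms(2) by simp
  qed
  then have "mat_lincomb d I (\<lambda>i. mat_trace (M i * X)) M = mat_lincomb d I c M"
    by (simp add: mat_lincomb_def)
  then show ?thesis using c by simp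
qed

lemma tensor_lincomb_index:
  assumes "\<And>i. i \<in> I \<Longrightarrow> X i \<in> carrier_mat m m" "\<And>i. i \<in> I \<Longrightarrow> Y i \<in> carrier_mat k k"
    and "a < m" "b < m" "p < k" "q < k"
  shows "mat_lincomb (m * k) I c (\<lambda>i. tensor (X i) (Y i)) $$ (a * k + p, b * k + q) =
    (\<Sum>i\<in>I. c i * (X i $$ (a, b) * Y i $$ (p, q)))"
  using assms by (simp add: mat_lincomb_def prod_index_less tensor_index[OF assms(1,2)])

lemma block_tensor_lincomb:
  assumes "\<And>i. i \<in> I \<Longrightarrow> X i \<in> carrier_mat m m" "\<And>i. i \<in> I \<Longrightarrow> Y i \<in> carrier_mat k k"
    and "p < k" "q < k"
  shows "block m k (mat_lincomb (m * k) I c (\<lambda>i. tensor (X i) (Y i))) p q =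
    mat_lincomb m I (\<lambda>i. c i * Y i $$ (p, q)) X"
proof (rule eq_matI)
  fix a b assume "a < dim_row (mat_lincomb m I (\<lambda>i. c i * Y i $$ (p, q)) X)"
    "b < dim_col (mat_lincomb m I (\<lambda>i. c i * Y i $$ (p, q)) X)"
  then have ab: "a < m" "b < m" by (simp_all add: mat_lincomb_def)
  then show "block m k (mat_lincomb (m * k) I c (\<lambda>i. tensor (X i) (Y i))) p q $$ (a, b) =
    mat_lincomb m I (\<lambda>i. c i * Y i $$ (p, q)) X $$ (a, b)"
    using tensor_lincomb_index[OF assms(1,2) ab assms(3,4)]
    by (simp add: block_def) (simp add: mat_lincomb_def mult_ac)
qed (simp_all add: block_def mat_lincomb_def)

lemma ptrace_left_index:
  assumes "E \<in> carrier_mat m m" "p < k" "q < k"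
  shows "ptrace_left m k E Z $$ (p, q) = mat_trace (E * block m k Z p q)"
  unfolding mat_trace_mult[OF assms(1) block_carrier]
  using assms by (simp add: ptrace_left_def block_def)

lemma ptrace_left_tensor_lincomb:
  assumes "\<And>i. i \<in> I \<Longrightarrow> X i \<in> carrier_mat m m" "\<And>i. i \<in> I \<Longrightarrow> Y i \<in> carrier_mat k k"
    and "E \<in> carrier_mat m m"
  shows "ptrace_left m k E (mat_lincomb (m * k) I c (\<lambda>i. tensor (X i) (Y i))) =
    mat_lincomb k I (\<lambda>i. c i * mat_trace (E * X i)) Y"
proof (rule eq_matI)
  fix p q assume "p < dim_row (mat_lincomb k I (\<lambda>i. c i * mat_trace (E * X i)) Y)"
    "q < dim_col (mat_lincomb k I (\<lambda>i. c i * mat_trace (E * X i)) Y)"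
  then have pq: "p < k" "q < k" by (simp_all add: mat_lincomb_def)
  show "ptrace_left m k E (mat_lincomb (m * k) I c (\<lambda>i. tensor (X i) (Y i))) $$ (p, q) =
    mat_lincomb k I (\<lambda>i. c i * mat_trace (E * X i)) Y $$ (p, q)"
    using pq
    by (simp only: ptrace_left_index[OF assms(3) pq] block_tensor_lincomb[OF assms(1,2) pq]
        mat_trace_mult_lincomb[OF assms(3,1)]) (simp add: mat_lincomb_def mult_ac)
qed (simp_all add: ptrace_left_def mat_lincomb_def)

lemma ptrace_right_tensor_lincomb:
  assumes "\<And>i. i \<in> I \<Longrightarrow> X i \<in> carrier_mat n n" "\<And>i. i \<in> I \<Longrightarrow> Y i \<in> carrier_mat k k"
    and "F \<in> carrier_mat k k"
  shows "ptrace_right n k F (mat_lincomb (n * k) I c (\<lambda>i. tensor (X i) (Y i))) =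
    mat_lincomb n I (\<lambda>i. c i * mat_trace (F * Y i)) X"
proof (rule eq_matI)
  fix a b assume "a < dim_row (mat_lincomb n I (\<lambda>i. c i * mat_trace (F * Y i)) X)"
    "b < dim_col (mat_lincomb n I (\<lambda>i. c i * mat_trace (F * Y i)) X)"
  then have ab: "a < n" "b < n" by (simp_all add: mat_lincomb_def)
  have "ptrace_right n k F (mat_lincomb (n * k) I c (\<lambda>i. tensor (X i) (Y i))) $$ (a, b) =
    (\<Sum>p<k. \<Sum>q<k. \<Sum>i\<in>I. \<Sum>j\<in>{()}. c i * X i $$ (a, b) * (F $$ (p, q) * Y i $$ (q, p)))"
    using ab
    by (simp add: ptrace_right_def tensor_lincomb_index[OF assms(1,2)] sum_distrib_left) (simp add: mult_ac)
  also have "\<dots> = (\<Sum>i\<in>I. \<Sum>j\<in>{()}. \<Sum>p<k. \<Sum>q<k. c i * X i $$ (a, b) * (F $$ (p, q) * Y i $$ (q, p)))"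
    by (rule sum_swap_pairs)
  also have "\<dots> = (\<Sum>i\<in>I. c i * X i $$ (a, b) * mat_trace (F * Y i))"
    using assms by (intro sum.cong refl) (simp add: mat_trace_mult[of _ k k] sum_distrib_left del: index_mult_mat)
  finally show "ptrace_right n k F (mat_lincomb (n * k) I c (\<lambda>i. tensor (X i) (Y i))) $$ (a, b) =
    mat_lincomb n I (\<lambda>i. c i * mat_trace (F * Y i)) X $$ (a, b)"
    using ab by (simp add: mat_lincomb_def mult_ac)
qed (simp_all add: ptrace_right_def mat_lincomb_def)

text \<open>Each block of \<open>Z\<close> is expanded in the basis \<open>A\<close>; the
  coefficients at \<open>A i\<close>, collected over all blocks, are the entries of the partial
  trace against \<open>A i\<close>.\<close>

lemma tensor_lincomb_ptrace_left:
  assumes "orthonormal_basis m I A" "finite I" "\<And>i. i \<in> I \<Longrightarrow> hermitian (A i)"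
    and "Z \<in> carrier_mat (m * k) (m * k)"
  shows "Z = mat_lincomb (m * k) I (\<lambda>i. 1) (\<lambda>i. tensor (A i) (ptrace_left m k (A i) Z))"
proof (rule eq_mat_prodI[OF assms(4) mat_lincomb_carrier])
  have A: "A i \<in> carrier_mat m m" if "i \<in> I" for i using assms(1) that by (auto simp: orthonormal_basis_def)
  fix a p b q assume i: "a < m" "p < k" "b < m" "q < k"
  have "Z $$ (a * k + p, b * k + q) = block m k Z p q $$ (a, b)" using i by (simp add: block_def)
  also have "\<dots> = mat_lincomb m I (\<lambda>i. mat_trace (A i * block m k Z p q)) A $$ (a, b)"
    by (subst orthonormal_basis_expansion[OF assms(1-3) block_carrier]) (auto simp: assms)
  also have "\<dots> = (\<Sum>i\<in>I. 1 * (A i $$ (a, b) * ptrace_left m k (A i) Z $$ (p, q)))"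
    using i by (simp add: mat_lincomb_def ptrace_left_index[OF A] mult.commute)
  also have "\<dots> = mat_lincomb (m * k) I (\<lambda>i. 1) (\<lambda>i. tensor (A i) (ptrace_left m k (A i) Z)) $$ (a * k + p, b * k + q)"
    by (rule tensor_lincomb_index[symmetric]) (use A i in auto)
  finally show "Z $$ (a * k + p, b * k + q) = \<dots>" .
qed

text \<open>Used twice: for \<rho> with its Schmidt coefficients, and for an arbitrary state on two
  copies of the input with coefficients 1.\<close>

lemma tensor_id_difference_lincomb:
  assumes "channel m n \<Lambda>0" "channel m n \<Lambda>1" "finite I"
    and "\<And>i. i \<in> I \<Longrightarrow> X i \<in> carrier_mat m m" "\<And>i. i \<in> I \<Longrightarrow> Y i \<in> carrier_mat k k"
    and "Z = mat_lincomb (m * k) I c (\<lambda>i. tensor (X i) (Y i))"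
  shows "tensor_id m n k \<Lambda>0 Z - tensor_id m n k \<Lambda>1 Z =
    mat_lincomb (n * k) I c (\<lambda>i. tensor (\<Lambda>0 (X i) - \<Lambda>1 (X i)) (Y i))"
proof (rule eq_mat_prodI[OF minus_carrier_mat[OF tensor_id_carrier] mat_lincomb_carrier])
  fix a p b q assume i: "a < n" "p < k" "b < n" "q < k"
  have \<Lambda>: "tensor_id m n k \<Lambda> Z $$ (a * k + p, b * k + q) = (\<Sum>i\<in>I. c i * (\<Lambda> (X i) $$ (a, b) * Y i $$ (p, q)))"
    if "channel m n \<Lambda>" for \<Lambda>
    using i
    by (simp only: tensor_id_index[OF i] assms(6) block_tensor_lincomb[OF assms(4,5) i(2,4)]
        linear_map_lincomb[OF channelD(1)[OF that] assms(3,4)]) (simp add: mat_lincomb_def mult_ac)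
  have D: "\<Lambda>0 (X i) - \<Lambda>1 (X i) \<in> carrier_mat n n" "\<Lambda>1 (X i) \<in> carrier_mat n n" if "i \<in> I" for i
    using channelD(2)[OF assms(2) assms(4)[OF that]] by auto
  have "(tensor_id m n k \<Lambda>0 Z - tensor_id m n k \<Lambda>1 Z) $$ (a * k + p, b * k + q) =
      tensor_id m n k \<Lambda>0 Z $$ (a * k + p, b * k + q) - tensor_id m n k \<Lambda>1 Z $$ (a * k + p, b * k + q)"
    using i prod_index_less carrier_matD[OF tensor_id_carrier[of m n k \<Lambda>1 Z]] by simp
  also have "\<dots> = (\<Sum>i\<in>I. c i * ((\<Lambda>0 (X i) - \<Lambda>1 (X i)) $$ (a, b) * Y i $$ (p, q)))"
    unfolding \<Lambda>[OF assms(1)] \<Lambda>[OF assms(2)] sum_subtractf[symmetric]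
  proof (intro sum.cong refl)
    fix j assume "j \<in> I"
    then have e: "(\<Lambda>0 (X j) - \<Lambda>1 (X j)) $$ (a, b) = \<Lambda>0 (X j) $$ (a, b) - \<Lambda>1 (X j) $$ (a, b)"
      using carrier_matD[OF D(2)] i by simp
    show "c j * (\<Lambda>0 (X j) $$ (a, b) * Y j $$ (p, q)) - c j * (\<Lambda>1 (X j) $$ (a, b) * Y j $$ (p, q)) =
      c j * ((\<Lambda>0 (X j) - \<Lambda>1 (X j)) $$ (a, b) * Y j $$ (p, q))"
      unfolding e by (simp add: algebra_simps)
  qed
  also have "\<dots> = mat_lincomb (n * k) I c (\<lambda>i. tensor (\<Lambda>0 (X i) - \<Lambda>1 (X i)) (Y i)) $$ (a * k + p, b * k + q)"
    by (rule tensor_lincomb_index[symmetric]) (use D assms(5) i in auto)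
  finally show "(tensor_id m n k \<Lambda>0 Z - tensor_id m n k \<Lambda>1 Z) $$ (a * k + p, b * k + q) = \<dots>" .
qed

text \<open>Hermiticity is part of the claim because \<open>trace_norm_add\<close> asks for it at
  each step of the induction.\<close>

lemma trace_norm_sum_le:
  assumes "finite I" "\<And>i. i \<in> I \<Longrightarrow> hermitian (M i)" "\<And>i. i \<in> I \<Longrightarrow> M i \<in> carrier_mat d d"
  shows "hermitian (mat_lincomb d I (\<lambda>i. 1) M) \<and>
    trace_norm (mat_lincomb d I (\<lambda>i. 1) M) \<le> (\<Sum>i\<in>I. trace_norm (M i))"
  using assms
proof (induction I)
  case empty
  have e: "mat_lincomb d {} (\<lambda>i. 1) M = 0\<^sub>m d d" by (intro eq_matI) (auto simp: mat_lincomb_def)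
  have h: "hermitian (0\<^sub>m d d)" by (subst hermitian_iff[of _ d]) auto
  have "complex_of_real 0 \<cdot>\<^sub>m 0\<^sub>m d d = 0\<^sub>m d d" by (intro eq_matI) auto
  then have "trace_norm (0\<^sub>m d d) = 0" using trace_norm_smult[OF h, of d 0] by simp
  then show ?case using e h by simp
next
  case (insert i I)
  have L: "mat_lincomb d (insert i I) (\<lambda>i. 1) M = M i + mat_lincomb d I (\<lambda>i. 1) M"
    using insert by (intro eq_matI) (auto simp: mat_lincomb_def)
  have "hermitian (M i)" "M i \<in> carrier_mat d d" using insert.prems by auto
  then show ?case
    unfolding L
    using trace_norm_add[of "M i" d "mat_lincomb d I (\<lambda>i. 1) M"] hermitian_add[of "M i" d "mat_lincomb d I (\<lambda>i. 1) M"]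
      insert by auto
qed

lemma mat_lincomb_cong:
  "(\<And>i. i \<in> I \<Longrightarrow> M i = M' i) \<Longrightarrow> mat_lincomb n I c M = mat_lincomb n I c M'"
  by (simp add: mat_lincomb_def)

lemma channel_difference:
  assumes "channel m n \<Lambda>0" "channel m n \<Lambda>1" "X \<in> carrier_mat m m"
  shows "\<Lambda>0 X - \<Lambda>1 X \<in> carrier_mat n n" "hermitian X \<Longrightarrow> hermitian (\<Lambda>0 X - \<Lambda>1 X)"
  using channelD(2)[OF assms(1,3)] channelD(2)[OF assms(2,3)]
    channel_hermitian[OF assms(1) _ assms(3)] channel_hermitian[OF assms(2) _ assms(3)]
  by (auto intro: hermitian_minus minus_carrier_mat)

text \<open>By linearity distinct channels differ on some \<open>A i\<close>, hence on an
  eigenprojection of that \<open>A i\<close>. This is a state, and with an ancilla attached it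
  yields a positive trace distance.\<close>

lemma diamond_distance_pos:
  assumes "channel m n \<Lambda>0" "channel m n \<Lambda>1" "0 < m" "finite I"
    and "orthonormal_basis m I A" "\<And>i. i \<in> I \<Longrightarrow> hermitian (A i)" "distinct_maps m \<Lambda>0 \<Lambda>1"
  shows "0 < diamond_distance m n \<Lambda>0 \<Lambda>1"
proof -
  note lin = linear_map_lincomb[OF channelD(1)[OF assms(1)]] linear_map_lincomb[OF channelD(1)[OF assms(2)]]
  have A: "A i \<in> carrier_mat m m" if "i \<in> I" for i using assms(5) that by (auto simp: orthonormal_basis_def)
  obtain X where X: "X \<in> carrier_mat m m" "\<Lambda>0 X \<noteq> \<Lambda>1 X" using assms(7) by (auto simp: distinct_maps_def)
  have "\<exists>i\<in>I. \<Lambda>0 (A i) \<noteq> \<Lambda>1 (A i)"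
  proof (rule ccontr)
    assume "\<not> ?thesis"
    then have eq: "\<Lambda>0 (A i) = \<Lambda>1 (A i)" if "i \<in> I" for i using that by blast
    have "\<Lambda>0 (mat_lincomb m I c A) = \<Lambda>1 (mat_lincomb m I c A)" for c
      by (simp only: lin(1)[OF assms(4) A] lin(2)[OF assms(4) A] mat_lincomb_cong[OF eq])
    then show False using orthonormal_basis_expansion[OF assms(5,4,6) X(1)] X(2) by metis
  qed
  then obtain i where i: "i \<in> I" "\<Lambda>0 (A i) \<noteq> \<Lambda>1 (A i)" by blast
  obtain u l where u: "spectral_decomposition m (A i) u l"
    using spectral_theorem[OF assms(6) A] i(1) by blast
  have "\<exists>j<m. \<Lambda>0 (rank_one m (u j)) \<noteq> \<Lambda>1 (rank_one m (u j))"
  proof (rule ccontr)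
    assume "\<not> ?thesis"
    then have eq: "\<Lambda>0 (rank_one m (u j)) = \<Lambda>1 (rank_one m (u j))" if "j \<in> {..<m}" for j using that by blast
    have "\<Lambda>0 (mat_lincomb m {..<m} c (\<lambda>j. rank_one m (u j))) =
        \<Lambda>1 (mat_lincomb m {..<m} c (\<lambda>j. rank_one m (u j)))" for c
      unfolding lin(1)[OF finite_lessThan rank_one_carrier] lin(2)[OF finite_lessThan rank_one_carrier]
      by (rule mat_lincomb_cong[OF eq])
    then show False using spectral_decomposition_lincomb[OF u A[OF i(1)]] i(2) by metis
  qed
  then obtain j where j: "j < m" "\<Lambda>0 (rank_one m (u j)) \<noteq> \<Lambda>1 (rank_one m (u j))" by blast
  have dens: "density_operator m (rank_one m (u j))"
    using spectral_decompositionD(1)[OF u] j(1)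
    by (intro density_operator_rank_one) (simp add: orthonormal_family_def)
  show ?thesis
    using trace_distance_ancilla_ge(2)[OF assms(1,2) dens assms(3) j(2)]
      trace_distance_le_diamond[OF assms(1,2) density_operator_tensor[OF dens density_operator_ancilla[OF assms(3)]]]
    by simp
qed

section \<open>Both bounds for a fixed operator Schmidt decomposition\<close>

context
  fixes dA dB :: nat and \<rho> :: "complex mat" and r :: "nat \<Rightarrow> real" and A B :: "nat \<Rightarrow> complex mat"
  assumes dens: "density_operator (dA * dB) \<rho>"
    and osd: "operator_schmidt_decomposition dA dB \<rho> r A B"
    and hA: "\<forall>i\<in>{1..dA\<^sup>2}. hermitian (A i)"
    and hB: "\<forall>i\<in>{1..dB\<^sup>2}. hermitian (B i)"
begin

text \<open>In dimension 0 the trace would be 0 instead of 1.\<close>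

lemma dims_pos: "0 < dA" "0 < dB"
proof -
  have "dA * dB \<noteq> 0"
  proof
    assume z: "dA * dB = 0"
    then have "\<rho> \<in> carrier_mat 0 0" using dens psd_carrier unfolding density_operator_def by metis
    then have "mat_trace \<rho> = 0" by (simp add: mat_trace_def)
    then show False using dens by (simp add: density_operator_def)
  qed
  then show "0 < dA" "0 < dB" by auto
qed

lemma schmidt:
  shows "orthonormal_basis dA {1..dA\<^sup>2} A" "orthonormal_basis dB {1..dB\<^sup>2} B"
    "i \<in> {1..dA\<^sup>2} \<Longrightarrow> A i \<in> carrier_mat dA dA" "i \<in> {1..dB\<^sup>2} \<Longrightarrow> B i \<in> carrier_mat dB dB"
    "1 \<le> i \<Longrightarrow> 0 \<le> r i" "1 \<le> i \<Longrightarrow> i \<le> j \<Longrightarrow> r j \<le> r i"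
    "min (dA\<^sup>2) (dB\<^sup>2) < i \<Longrightarrow> r i = 0"
    "\<rho> = mat_lincomb (dA * dB) {1..min (dA\<^sup>2) (dB\<^sup>2)} (\<lambda>i. complex_of_real (r i)) (\<lambda>i. tensor (A i) (B i))"
  using osd unfolding operator_schmidt_decomposition_def orthonormal_basis_def by auto

lemma schmidt_component_bound:
  assumes "channel dA n \<Lambda>0" "channel dA n \<Lambda>1" "i \<in> {1..min (dA\<^sup>2) (dB\<^sup>2)}"
  shows "r i * trace_norm (\<Lambda>0 (A i) - \<Lambda>1 (A i)) \<le>
    trace_norm (tensor_id dA n dB \<Lambda>0 \<rho> - tensor_id dA n dB \<Lambda>1 \<rho>)"
proof -
  let ?I = "{1..min (dA\<^sup>2) (dB\<^sup>2)}"
  define T where "T = tensor_id dA n dB \<Lambda>0 \<rho> - tensor_id dA n dB \<Lambda>1 \<rho>"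
  define D where "D = (\<lambda>i. \<Lambda>0 (A i) - \<Lambda>1 (A i))"
  have cA: "A j \<in> carrier_mat dA dA" and cB: "B j \<in> carrier_mat dB dB" if "j \<in> ?I" for j
    using schmidt(3)[of j] schmidt(4)[of j] that by auto
  have hD: "hermitian (D j)" and cD: "D j \<in> carrier_mat n n" if "j \<in> ?I" for j
    unfolding D_def using channel_difference[OF assms(1,2) cA[OF that]] hA that by auto
  have T: "T = mat_lincomb (n * dB) ?I (\<lambda>i. complex_of_real (r i)) (\<lambda>i. tensor (D i) (B i))"
    unfolding T_def D_def by (rule tensor_id_difference_lincomb[OF assms(1,2) _ cA cB schmidt(8)]) simp
  have hBi: "hermitian (B i)" using hB assms(3) by simp
  \<comment> \<open>Orthonormality of the \<open>B j\<close> annihilates every other Schmidt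
    term.\<close>
  have "ptrace_right n dB (B i) T = complex_of_real (r i) \<cdot>\<^sub>m D i"
  proof (rule eq_matI)
    fix a b assume "a < dim_row (complex_of_real (r i) \<cdot>\<^sub>m D i)" "b < dim_col (complex_of_real (r i) \<cdot>\<^sub>m D i)"
    then have ab: "a < n" "b < n" using cD[OF assms(3)] by auto
    have "ptrace_right n dB (B i) T $$ (a, b) =
      (\<Sum>j\<in>?I. complex_of_real (r j) * mat_trace (B i * B j) * D j $$ (a, b))"
      unfolding T using ab
      by (simp only: ptrace_right_tensor_lincomb[OF cD cB cB[OF assms(3)]]) (simp add: mat_lincomb_def)
    also have "\<dots> = (\<Sum>j\<in>?I. if i = j then complex_of_real (r i) * D i $$ (a, b) else 0)"
    proof (intro sum.cong refl)
      fix j assume "j \<in> ?I"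
      then have "mat_trace (B i * B j) = (if i = j then 1 else 0)"
        using hB assms(3) by (intro orthonormal_basis_trace[OF schmidt(2)]) auto
      then show "complex_of_real (r j) * mat_trace (B i * B j) * D j $$ (a, b) =
        (if i = j then complex_of_real (r i) * D i $$ (a, b) else 0)" by simp
    qed
    also have "\<dots> = complex_of_real (r i) * D i $$ (a, b)" using assms(3) by simp
    finally show "ptrace_right n dB (B i) T $$ (a, b) = (complex_of_real (r i) \<cdot>\<^sub>m D i) $$ (a, b)"
      using ab cD[OF assms(3)] by simp
  qed (use cD[OF assms(3)] in \<open>auto simp: ptrace_right_def\<close>)
  moreover have "hs_inner (B i) (B i) = 1" using schmidt(2) assms(3) by (auto simp: orthonormal_basis_def)
  then have "trace_norm (ptrace_right n dB (B i) T) \<le> trace_norm T"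
    using hs_unit_contraction[OF hBi cB[OF assms(3)]] tensor_id_difference(1)[OF assms(1,2) dens]
    unfolding T_def by (intro trace_norm_ptrace_right_le minus_carrier_mat tensor_id_carrier)
  ultimately show ?thesis
    using trace_norm_smult[OF hD[OF assms(3)] cD[OF assms(3)], of "r i"] schmidt(5)[of i] assms(3)
    by (simp add: T_def D_def)
qed

lemma diamond_le_components:
  assumes "channel dA n \<Lambda>0" "channel dA n \<Lambda>1"
  shows "diamond_distance dA n \<Lambda>0 \<Lambda>1 \<le> (\<Sum>i\<in>{1..dA\<^sup>2}. trace_norm (\<Lambda>0 (A i) - \<Lambda>1 (A i))) / 2"
  unfolding diamond_distance_def
proof (rule cSUP_least)
  \<comment> \<open>Bounding a real supremum from above by \<open>cSUP_least\<close> asks for a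
    nonempty index set.\<close>
  show "{\<rho>. density_operator (dA * dA) \<rho>} \<noteq> {}"
    using density_operator_tensor[OF density_operator_ancilla density_operator_ancilla] dims_pos(1) by blast
  fix \<sigma> assume "\<sigma> \<in> {\<rho>. density_operator (dA * dA) \<rho>}"
  then have \<sigma>: "psd (dA * dA) \<sigma>" "mat_trace \<sigma> = 1" by (auto simp: density_operator_def)
  define C where "C = (\<lambda>i. ptrace_left dA dA (A i) \<sigma>)"
  define D where "D = (\<lambda>i. \<Lambda>0 (A i) - \<Lambda>1 (A i))"
  let ?I = "{1..dA\<^sup>2}"
  have hAi: "hermitian (A j)" if "j \<in> ?I" for j using hA that by simp
  note cA = schmidt(3)
  have cC: "C j \<in> carrier_mat dA dA" for j by (simp add: C_def)
  have C: "hermitian (C j)" "trace_norm (C j) \<le> 1" if "j \<in> ?I" for j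
  proof -
    have "hs_inner (A j) (A j) = 1" using schmidt(1) that by (auto simp: orthonormal_basis_def)
    then have "contraction dA (A j)" by (rule hs_unit_contraction[OF hAi[OF that] cA[OF that]])
    then show "hermitian (C j)" "trace_norm (C j) \<le> 1"
      unfolding C_def using ptrace_left_psd_contraction[OF _ \<sigma>(1)] \<sigma>(2) by auto
  qed
  have hD: "hermitian (D j)" and cD: "D j \<in> carrier_mat n n" if "j \<in> ?I" for j
    unfolding D_def using channel_difference[OF assms cA[OF that]] hAi[OF that] by auto
  have "\<sigma> = mat_lincomb (dA * dA) ?I (\<lambda>i. 1) (\<lambda>i. tensor (A i) (C i))"
    unfolding C_def by (rule tensor_lincomb_ptrace_left[OF schmidt(1) _ hAi psd_carrier[OF \<sigma>(1)]]) simp_all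
  then have T: "tensor_id dA n dA \<Lambda>0 \<sigma> - tensor_id dA n dA \<Lambda>1 \<sigma> =
      mat_lincomb (n * dA) ?I (\<lambda>i. 1) (\<lambda>i. tensor (D i) (C i))"
    unfolding D_def using cA cC by (intro tensor_id_difference_lincomb[OF assms]) auto
  have "trace_norm (tensor_id dA n dA \<Lambda>0 \<sigma> - tensor_id dA n dA \<Lambda>1 \<sigma>) \<le> (\<Sum>i\<in>?I. trace_norm (tensor (D i) (C i)))"
    unfolding T using hermitian_tensor[OF cD cC hD C(1)] tensor_carrier[OF cD cC]
    by (intro conjunct2[OF trace_norm_sum_le]) auto
  also have "\<dots> \<le> (\<Sum>i\<in>?I. trace_norm (D i))"
  proof (intro sum_mono)
    fix i assume i: "i \<in> ?I"
    have "trace_norm (tensor (D i) (C i)) \<le> trace_norm (D i) * trace_norm (C i)"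
      by (rule trace_norm_tensor_le[OF hD[OF i] cD[OF i] C(1)[OF i] cC])
    also have "\<dots> \<le> trace_norm (D i) * 1"
      using C(2)[OF i] trace_norm_nonneg[OF hD[OF i] cD[OF i]] by (rule mult_left_mono)
    finally show "trace_norm (tensor (D i) (C i)) \<le> trace_norm (D i)" by simp
  qed
  finally show "trace_distance (tensor_id dA n dA \<Lambda>0 \<sigma>) (tensor_id dA n dA \<Lambda>1 \<sigma>) \<le>
      (\<Sum>i\<in>?I. trace_norm (\<Lambda>0 (A i) - \<Lambda>1 (A i))) / 2"
    by (simp add: trace_distance_def D_def)
qed

lemma ratio_lower_bound:
  assumes "channel dA n \<Lambda>0" "channel dA n \<Lambda>1" "distinct_maps dA \<Lambda>0 \<Lambda>1"
  shows "r (dA\<^sup>2) / (real dA)\<^sup>2 \<le>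
    trace_distance (tensor_id dA n dB \<Lambda>0 \<rho>) (tensor_id dA n dB \<Lambda>1 \<rho>) / diamond_distance dA n \<Lambda>0 \<Lambda>1"
proof -
  have hA': "\<And>i. i \<in> {1..dA\<^sup>2} \<Longrightarrow> hermitian (A i)" using hA by simp
  have pos: "0 < diamond_distance dA n \<Lambda>0 \<Lambda>1"
    by (rule diamond_distance_pos[OF assms(1,2) dims_pos(1) _ schmidt(1) hA' assms(3)]) simp_all
  define t where "t = trace_distance (tensor_id dA n dB \<Lambda>0 \<rho>) (tensor_id dA n dB \<Lambda>1 \<rho>)"
  have t0: "0 \<le> t" unfolding t_def by (rule trace_distance_nonneg[OF assms(1,2) dens])
  have d1: "1 \<le> dA\<^sup>2" using dims_pos(1) by simp
  have "r (dA\<^sup>2) * diamond_distance dA n \<Lambda>0 \<Lambda>1 \<le> (real dA)\<^sup>2 * t"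
  proof (cases "r (dA\<^sup>2) = 0")
    case False
    \<comment> \<open>A nonzero last coefficient means that the basis on B does not run out, so the
      component bound is available for all \<open>dA\<^sup>2\<close> indices.\<close>
    then have le: "min (dA\<^sup>2) (dB\<^sup>2) = dA\<^sup>2" using schmidt(7)[of "dA\<^sup>2"] by linarith
    have "r (dA\<^sup>2) * diamond_distance dA n \<Lambda>0 \<Lambda>1 \<le>
        r (dA\<^sup>2) * ((\<Sum>i\<in>{1..dA\<^sup>2}. trace_norm (\<Lambda>0 (A i) - \<Lambda>1 (A i))) / 2)"
      using diamond_le_components[OF assms(1,2)] schmidt(5)[OF d1] by (rule mult_left_mono)
    also have "\<dots> = (\<Sum>i\<in>{1..dA\<^sup>2}. r (dA\<^sup>2) * trace_norm (\<Lambda>0 (A i) - \<Lambda>1 (A i))) / 2"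
      by (simp add: sum_distrib_left)
    \<comment> \<open>Each of the \<open>dA\<^sup>2\<close> terms is at most twice the trace
      distance, since the last coefficient is the smallest; the 2 cancels the factor 1/2.\<close>
    also have "\<dots> \<le> (\<Sum>i\<in>{1..dA\<^sup>2}. 2 * t) / 2"
    proof (intro divide_right_mono sum_mono)
      fix i assume i: "i \<in> {1..dA\<^sup>2}"
      have "0 \<le> trace_norm (\<Lambda>0 (A i) - \<Lambda>1 (A i))"
        using channel_difference[OF assms(1,2) schmidt(3)[OF i]] hA'[OF i] by (intro trace_norm_nonneg)
      then have "r (dA\<^sup>2) * trace_norm (\<Lambda>0 (A i) - \<Lambda>1 (A i)) \<le> r i * trace_norm (\<Lambda>0 (A i) - \<Lambda>1 (A i))"
        using i by (intro mult_right_mono schmidt(6)) auto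
      also have "\<dots> \<le> 2 * t"
        using schmidt_component_bound[OF assms(1,2), of i] i le by (simp add: t_def trace_distance_def)
      finally show "r (dA\<^sup>2) * trace_norm (\<Lambda>0 (A i) - \<Lambda>1 (A i)) \<le> 2 * t" .
    qed simp
    finally show ?thesis by simp
  qed (use t0 in simp)
  then show ?thesis using pos dims_pos(1) unfolding t_def[symmetric] by (simp add: field_simps)
qed

text \<open>The last fact obtained concerns \<open>A i\<close> alone; it comes from the eigenvalues
  already at hand and is used again in \<open>last_term_bound\<close>.\<close>

lemma ratio_upper_bound:
  assumes i: "i \<in> {1..dA\<^sup>2}"
  obtains n \<Lambda>0 \<Lambda>1 where "channel dA n \<Lambda>0" "channel dA n \<Lambda>1" "distinct_maps dA \<Lambda>0 \<Lambda>1"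
    "trace_distance (tensor_id dA n dB \<Lambda>0 \<rho>) (tensor_id dA n dB \<Lambda>1 \<rho>) / diamond_distance dA n \<Lambda>0 \<Lambda>1
      \<le> (if r i = 0 then 0 else r i * (trace_norm (B i) / operator_norm (A i)))"
    "1 / sqrt (real dA) \<le> operator_norm (A i)"
proof -
  have hAi: "hermitian (A i)" using hA i by simp
  note cA = schmidt(3)[OF i]
  obtain u l where u: "spectral_decomposition dA (A i) u l" using spectral_theorem[OF hAi cA] by blast
  obtain j where j: "j < dA" "operator_norm (A i) = \<bar>l j\<bar>" "\<And>k. k < dA \<Longrightarrow> \<bar>l k\<bar> \<le> \<bar>l j\<bar>"
    using operator_norm_attained[OF u cA dims_pos(1)] by blast
  define c where "c = operator_norm (A i)"
  have "hs_inner (A i) (A i) = 1" using schmidt(1) i by (auto simp: orthonormal_basis_def)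
  \<comment> \<open>A sum of \<open>dA\<close> squares equal to 1 has a term of at least 1 / dA, so
    the largest modulus \<open>c\<close> satisfies \<open>1 \<le> dA * c\<^sup>2\<close>.\<close>
  then have "1 = (\<Sum>k<dA. (l k)\<^sup>2)" using hs_inner_spectral[OF u cA] by (metis of_real_eq_1_iff)
  also have "\<dots> \<le> (\<Sum>k<dA. c\<^sup>2)"
    using j(3) unfolding c_def j(2) by (intro sum_mono) (auto simp: abs_le_square_iff)
  finally have c2: "1 \<le> real dA * c\<^sup>2" by simp
  have c0: "0 \<le> c" by (simp add: c_def j(2))
  then have cpos: "0 < c" using c2 by (cases "c = 0") auto
  have cge: "1 / sqrt (real dA) \<le> c"
  proof -
    have "1 \<le> sqrt (real dA * c\<^sup>2)" using c2 by simp
    then show ?thesis using c0 dims_pos(1) by (simp add: real_sqrt_mult field_simps)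
  qed
  \<comment> \<open>The largest multiple of \<open>A i\<close> that is still a contraction: its
    eigenvalue at index \<open>j\<close> is 1 or -1, so the measurement is deterministic on
    \<open>u j\<close>.\<close>
  define F where "F = complex_of_real (1 / c) \<cdot>\<^sub>m A i"
  have cF: "F \<in> carrier_mat dA dA" using cA by (simp add: F_def)
  have uF: "spectral_decomposition dA F u (\<lambda>k. 1 / c * l k)"
    unfolding F_def by (rule spectral_decomposition_smult[OF u cA])
  have "contraction dA F"
    by (rule spectral_contraction[OF uF cF]) (use j(3) cpos in \<open>auto simp: abs_mult c_def j(2) divide_le_eq_1\<close>)
  then obtain E E' where E: "psd dA E" "psd dA E'" "E + E' = 1\<^sub>m dA" "F = E - E'"
    by (auto simp: contraction_def)
  note cE = psd_carrier[OF E(1)] psd_carrier[OF E(2)]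
  define \<Lambda>0 where "\<Lambda>0 = measure_prepare E E'"
  define \<Lambda>1 where "\<Lambda>1 = measure_prepare E' E"
  have ch: "channel dA 2 \<Lambda>0" "channel dA 2 \<Lambda>1"
    unfolding \<Lambda>0_def \<Lambda>1_def using E(1-3) cE by (auto intro!: channel_measure_prepare simp: comm_add_mat[of E' dA dA E])
  define X where "X = rank_one dA (u j)"
  have one: "(\<Sum>a<dA. cnj (u j a) * u j a) = 1"
    using spectral_decompositionD(1)[OF u] j(1) by (simp add: orthonormal_family_def)
  have dX: "density_operator dA X" unfolding X_def by (rule density_operator_rank_one[OF one])
  have cX: "X \<in> carrier_mat dA dA" by (simp add: X_def)
  have "mat_trace (F * X) = complex_of_real (l j / c)"
  proof -
    have "mat_trace (F * X) = (\<Sum>a<dA. cnj (u j a) * (\<Sum>b<dA. F $$ (a, b) * u j b))"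
      unfolding mat_trace_mult[OF cF cX] sum_distrib_left
      by (intro sum.cong refl) (simp add: X_def rank_one_def mult_ac)
    also have "\<dots> = complex_of_real (1 / c * l j) * (\<Sum>a<dA. cnj (u j a) * u j a)"
      using spectral_decomposition_eigenpair[OF uF j(1)]
      by (simp add: eigenpair_def sum_distrib_left mult_ac)
    finally show ?thesis using one by simp
  qed
  then have diff: "\<Lambda>0 X - \<Lambda>1 X = complex_of_real (l j / c) \<cdot>\<^sub>m pauli_z"
    unfolding \<Lambda>0_def \<Lambda>1_def measure_prepare_difference[OF cE cX] E(4) by simp
  have "cmod (complex_of_real (l j / c)) = 1" using cpos by (simp add: c_def j(2) norm_divide)
  then have sum2: "(\<Sum>a<2. cmod ((\<Lambda>0 X - \<Lambda>1 X) $$ (a, a))) = 2"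
    unfolding diff by (simp add: numeral_2_eq_2 pauli_z_def norm_mult)
  \<comment> \<open>On the eigenvector state the two channels prepare opposite basis states of the
    qubit, hence perfectly distinguishable ones.\<close>
  have d1: "1 \<le> diamond_distance dA 2 \<Lambda>0 \<Lambda>1"
    using trace_distance_ancilla_ge(1)[OF ch dX dims_pos(1)] sum2
      trace_distance_le_diamond[OF ch density_operator_tensor[OF dX density_operator_ancilla[OF dims_pos(1)]]]
    by simp
  have dist: "distinct_maps dA \<Lambda>0 \<Lambda>1"
    unfolding distinct_maps_def
  proof (intro bexI[OF _ cX] notI)
    assume eq: "\<Lambda>0 X = \<Lambda>1 X"
    have "\<Lambda>1 X \<in> carrier_mat 2 2" by (rule channelD(2)[OF ch(2) cX])
    then have "(\<Sum>a<2. cmod ((\<Lambda>0 X - \<Lambda>1 X) $$ (a, a))) = 0" unfolding eq by simp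
    then show False using sum2 by simp
  qed
  let ?I = "{1..min (dA\<^sup>2) (dB\<^sup>2)}"
  have cA': "A k \<in> carrier_mat dA dA" and cB': "B k \<in> carrier_mat dB dB" if "k \<in> ?I" for k
    using schmidt(3)[of k] schmidt(4)[of k] that by auto
  define R where "R = ptrace_left dA dB F \<rho>"
  \<comment> \<open>\<open>F\<close> is proportional to \<open>A i\<close>, so only the term
    \<open>i\<close> of \<rho> survives; beyond the range of the decomposition nothing survives, and
    no \<open>B i\<close> is consulted.\<close>
  have R: "R $$ (p, q) = (if i \<in> ?I then complex_of_real (r i / c) * B i $$ (p, q) else 0)" if pq: "p < dB" "q < dB" for p q
  proof -
    have "R $$ (p, q) = (\<Sum>k\<in>?I. complex_of_real (r k) * mat_trace (F * A k) * B k $$ (p, q))"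
      unfolding R_def using pq
      by (subst schmidt(8), simp only: ptrace_left_tensor_lincomb[OF cA' cB' cF]) (simp add: mat_lincomb_def)
    also have "\<dots> = (\<Sum>k\<in>?I. if i = k then complex_of_real (r i / c) * B i $$ (p, q) else 0)"
    proof (intro sum.cong refl)
      fix k assume k: "k \<in> ?I"
      have "F * A k = complex_of_real (1 / c) \<cdot>\<^sub>m (A i * A k)"
        unfolding F_def by (rule mult_smult_assoc_mat[OF cA cA'[OF k]])
      moreover have "mat_trace (A i * A k) = (if i = k then 1 else 0)"
        using hA i k by (intro orthonormal_basis_trace[OF schmidt(1)]) auto
      ultimately have "mat_trace (F * A k) = (if i = k then complex_of_real (1 / c) else 0)"
        using mat_trace_smult[OF mult_carrier_mat[OF cA cA'[OF k]]] by simp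
      then show "complex_of_real (r k) * mat_trace (F * A k) * B k $$ (p, q) =
        (if i = k then complex_of_real (r i / c) * B i $$ (p, q) else 0)" by simp
    qed
    also have "\<dots> = (if i \<in> ?I then complex_of_real (r i / c) * B i $$ (p, q) else 0)" by simp
    finally show ?thesis .
  qed
  have cR: "R \<in> carrier_mat dB dB" by (simp add: R_def)
  have R2: "hermitian R \<and> trace_norm R \<le> (if r i = 0 then 0 else r i * (trace_norm (B i) / c))"
  proof (cases "r i = 0")
    case True
    then have z: "R = complex_of_real 0 \<cdot>\<^sub>m 1\<^sub>m dB" using R cR by (intro eq_matI) auto
    have h: "hermitian (1\<^sub>m dB)" by (subst hermitian_iff[of _ dB]) auto
    show ?thesis
      unfolding z using True hermitian_smult[OF h one_carrier_mat, of 0]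
        trace_norm_smult[OF h one_carrier_mat, of 0] by simp
  next
    case False
    then have iI: "i \<in> ?I" using schmidt(7)[of i] i by force
    have hB': "hermitian (B i)" using hB iI by simp
    have z: "R = complex_of_real (r i / c) \<cdot>\<^sub>m B i" using R cR cB'[OF iI] iI by (intro eq_matI) auto
    show ?thesis
      unfolding z using False hermitian_smult[OF hB' cB'[OF iI], of "r i / c"]
        trace_norm_smult[OF hB' cB'[OF iI], of "r i / c"] schmidt(5)[of i] i cpos by simp
  qed
  have "trace_norm (tensor_id dA 2 dB \<Lambda>0 \<rho> - tensor_id dA 2 dB \<Lambda>1 \<rho>) = trace_norm (tensor pauli_z R)"
    unfolding \<Lambda>0_def \<Lambda>1_def R_def tensor_id_measure_prepare_difference[OF cE] E(4) ..
  \<comment> \<open>The 2 is the trace norm of \<open>pauli_z\<close>; it cancels the 1/2 in the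
    trace distance.\<close>
  also have "\<dots> \<le> 2 * trace_norm R"
    using trace_norm_tensor_le[OF spectral_decomposition_hermitian[OF spectral_decomposition_pauli_z pauli_z_carrier]
        pauli_z_carrier conjunct1[OF R2] cR] by (simp add: trace_norm_pauli_z)
  finally have t: "trace_distance (tensor_id dA 2 dB \<Lambda>0 \<rho>) (tensor_id dA 2 dB \<Lambda>1 \<rho>)
      \<le> (if r i = 0 then 0 else r i * (trace_norm (B i) / c))"
    using R2 by (simp add: trace_distance_def)
  have "trace_distance (tensor_id dA 2 dB \<Lambda>0 \<rho>) (tensor_id dA 2 dB \<Lambda>1 \<rho>) / diamond_distance dA 2 \<Lambda>0 \<Lambda>1
      \<le> trace_distance (tensor_id dA 2 dB \<Lambda>0 \<rho>) (tensor_id dA 2 dB \<Lambda>1 \<rho>)"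
    using trace_distance_nonneg[OF ch dens] d1 by (simp add: divide_le_eq mult_le_cancel_left1)
  then show thesis
    using that[OF ch dist] t cge unfolding c_def by simp
qed

lemma CDP_bounds:
  shows "r (dA\<^sup>2) / (real dA)\<^sup>2 \<le> CDP dA dB \<rho>"
    and "i \<in> {1..dA\<^sup>2} \<Longrightarrow>
      CDP dA dB \<rho> \<le> (if r i = 0 then 0 else r i * (trace_norm (B i) / operator_norm (A i)))"
proof -
  define S where "S = {trace_distance (tensor_id dA n dB \<Lambda>0 \<rho>) (tensor_id dA n dB \<Lambda>1 \<rho>)
      / diamond_distance dA n \<Lambda>0 \<Lambda>1 | n \<Lambda>0 \<Lambda>1.
      channel dA n \<Lambda>0 \<and> channel dA n \<Lambda>1 \<and> distinct_maps dA \<Lambda>0 \<Lambda>1}"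
  have CDP: "CDP dA dB \<rho> = Inf S" by (simp add: CDP_def S_def)
  have low: "r (dA\<^sup>2) / (real dA)\<^sup>2 \<le> x" if "x \<in> S" for x
    using that ratio_lower_bound unfolding S_def by blast
  have up: "\<exists>x\<in>S. x \<le> (if r i = 0 then 0 else r i * (trace_norm (B i) / operator_norm (A i)))"
    if "i \<in> {1..dA\<^sup>2}" for i
    by (rule ratio_upper_bound[OF that], unfold S_def) blast
  \<comment> \<open>Over the reals, \<open>Inf\<close> exceeds a lower bound only for a nonempty
    set; the pair built for index 1 supplies a member.\<close>
  have "S \<noteq> {}" using up[of 1] dims_pos(1) by auto
  then show "r (dA\<^sup>2) / (real dA)\<^sup>2 \<le> CDP dA dB \<rho>"
    unfolding CDP using low by (rule cInf_greatest)
  assume "i \<in> {1..dA\<^sup>2}"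
  then obtain x where "x \<in> S" "x \<le> (if r i = 0 then 0 else r i * (trace_norm (B i) / operator_norm (A i)))"
    using up by blast
  \<comment> \<open>The lower estimate doubles as the boundedness from below that
    \<open>cInf_lower\<close> demands.\<close>
  moreover have "Inf S \<le> x" using \<open>x \<in> S\<close> low by (intro cInf_lower bdd_belowI) auto
  ultimately show "CDP dA dB \<rho> \<le> (if r i = 0 then 0 else r i * (trace_norm (B i) / operator_norm (A i)))"
    unfolding CDP by linarith
qed

text \<open>The minimum is at most its last term. There \<open>trace_norm_le_hs\<close> bounds the
  numerator by sqrt dB, and the denominator is at least 1 / sqrt dA. If the coefficient is nonzero,
  then \<open>dA\<^sup>2 \<le> dB\<^sup>2\<close>, so the last \<open>B i\<close> belongs to the
  basis.\<close>

lemma last_term_bound: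
  "(if r (dA\<^sup>2) = 0 then 0 else r (dA\<^sup>2) * (trace_norm (B (dA\<^sup>2)) / operator_norm (A (dA\<^sup>2))))
    \<le> r (dA\<^sup>2) * sqrt (real dA * real dB)"
proof (cases "r (dA\<^sup>2) = 0")
  case False
  let ?i = "dA\<^sup>2"
  have iA: "?i \<in> {1..dA\<^sup>2}" using dims_pos(1) by simp
  have "\<not> min (dA\<^sup>2) (dB\<^sup>2) < dA\<^sup>2" using False schmidt(7)[of ?i] by blast
  then have "dA\<^sup>2 \<le> dB\<^sup>2" by linarith
  then have iB: "?i \<in> {1..dB\<^sup>2}" using iA by simp
  have "hs_inner (B ?i) (B ?i) = 1" using schmidt(2) iB by (auto simp: orthonormal_basis_def)
  then have "trace_norm (B ?i) \<le> sqrt dB" using hB iB by (intro trace_norm_le_hs schmidt(4)) auto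
  moreover have c: "1 / sqrt (real dA) \<le> operator_norm (A ?i)" by (rule ratio_upper_bound[OF iA])
  ultimately have "trace_norm (B ?i) / operator_norm (A ?i) \<le> sqrt dB / (1 / sqrt (real dA))"
    using dims_pos(1) by (intro frac_le) auto
  also have "\<dots> = sqrt (real dA * real dB)" by (simp add: real_sqrt_mult)
  finally show ?thesis
    unfolding if_not_P[OF False] using schmidt(5)[of ?i] iA by (intro mult_left_mono) auto
qed simp

end

theorem theorem2:
  fixes dA dB :: nat and \<rho> :: "complex mat" and r :: "nat \<Rightarrow> real"
    and A B :: "nat \<Rightarrow> complex mat"
  assumes "density_operator (dA * dB) \<rho>"
    and "operator_schmidt_decomposition dA dB \<rho> r A B"
    and "\<forall>i\<in>{1..dA\<^sup>2}. hermitian (A i)"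
    and "\<forall>i\<in>{1..dB\<^sup>2}. hermitian (B i)"
  shows "r (dA\<^sup>2) / real dA powr (5 / 2) \<le> CDP dA dB \<rho> \<and>
    CDP dA dB \<rho> \<le>
      (MIN i\<in>{1..dA\<^sup>2}. if r i = 0 then 0 else r i * (trace_norm (B i) / operator_norm (A i))) \<and>
    (MIN i\<in>{1..dA\<^sup>2}. if r i = 0 then 0 else r i * (trace_norm (B i) / operator_norm (A i)))
      \<le> r (dA\<^sup>2) * sqrt (real dA * real dB)"
proof -
  have d: "1 \<le> real dA" using dims_pos(1)[OF assms] by simp
  have i: "dA\<^sup>2 \<in> {1..dA\<^sup>2}" using dims_pos(1)[OF assms] by simp
  have "(real dA)\<^sup>2 = real dA powr 2" using d by (simp add: powr_numeral)
  \<comment> \<open>Monotone in the exponent because the base is at least 1.\<close>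
  also have "\<dots> \<le> real dA powr (5 / 2)" using d by (intro powr_mono) auto
  finally have "r (dA\<^sup>2) / real dA powr (5 / 2) \<le> r (dA\<^sup>2) / (real dA)\<^sup>2"
    using d schmidt(5)[OF assms, of "dA\<^sup>2"] i by (intro divide_left_mono) auto
  also have "\<dots> \<le> CDP dA dB \<rho>" by (rule CDP_bounds(1)[OF assms])
  finally have "r (dA\<^sup>2) / real dA powr (5 / 2) \<le> CDP dA dB \<rho>" .
  moreover have "CDP dA dB \<rho> \<le>
      (MIN i\<in>{1..dA\<^sup>2}. if r i = 0 then 0 else r i * (trace_norm (B i) / operator_norm (A i)))"
  proof (rule Min.boundedI)
    fix x assume "x \<in> (\<lambda>i. if r i = 0 then 0 else r i * (trace_norm (B i) / operator_norm (A i))) ` {1..dA\<^sup>2}"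
    then show "CDP dA dB \<rho> \<le> x" using CDP_bounds(2)[OF assms] by blast
  qed (simp, use i in blast)
  moreover have "(MIN i\<in>{1..dA\<^sup>2}. if r i = 0 then 0 else r i * (trace_norm (B i) / operator_norm (A i)))
      \<le> (if r (dA\<^sup>2) = 0 then 0 else r (dA\<^sup>2) * (trace_norm (B (dA\<^sup>2)) / operator_norm (A (dA\<^sup>2))))"
    using i by (intro Min_le) auto
  ultimately show ?thesis using last_term_bound[OF assms] by linarith
qed

end
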